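(* Every (finite, nonempty, simple) planar graph $G$ has independence ratio at least $\frac{3}{13}$; that is, $\frac{\alpha(G)}{|V(G)|} \ge \frac{3}{13}$.
   Context: An independent set in a graph is a set of vertices that induces no edges. The independence number $\alpha(G)$ is the size of a largest independent set in $G$. The independence ratio of $G$ is $\alpha(G)/|V(G)|$. *)

theory Defs
  imports "HOL-Analysis.Analysis"
begin

definition finite_simple_graph :: "'a set \<Rightarrow> 'a set set \<Rightarrow> bool" where
  "finite_simple_graph V E \<longleftrightarrow> finite V \<and> (\<forall>e\<in>E. e \<subseteq> V \<and> card e = 2)"

definition independent_set :: "'a set \<Rightarrow> 'a set set \<Rightarrow> 'a set \<Rightarrow> bool" where
  "independent_set V E S \<longleftrightarrow> S \<subseteq> V \<and> (\<forall>e\<in>E. \<not> e \<subseteq> S)"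

definition independence_number :: "'a set \<Rightarrow> 'a set set \<Rightarrow> nat" where
  "independence_number V E = Max {card S | S. independent_set V E S}"

definition independence_ratio :: "'a set \<Rightarrow> 'a set set \<Rightarrow> real" where
  "independence_ratio V E = real (independence_number V E) / real (card V)"

(* The plane is the type complex, for which the library states the Jordan curve theorem.
   Edges are arbitrary Jordan arcs (injective continuous images of [0,1]), not necessarily
   polygonal.  An arc passes through no vertex other than its two ends, and two distinct
   arcs share exactly the points of their common end vertices. *)
definition plane_drawing ::
    "'a set \<Rightarrow> 'a set set \<Rightarrow> ('a \<Rightarrow> complex) \<Rightarrow> ('a set \<Rightarrow> real \<Rightarrow> complex) \<Rightarrow> bool" where
  "plane_drawing V E p \<gamma> \<longleftrightarrow>
     inj_on p V \<and>
     (\<forall>e\<in>E. arc (\<gamma> e) \<and> {pathstart (\<gamma> e), pathfinish (\<gamma> e)} = p ` e \<and>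
             path_image (\<gamma> e) \<inter> p ` V = p ` e) \<and>
     (\<forall>e\<in>E. \<forall>f\<in>E. e \<noteq> f \<longrightarrow> path_image (\<gamma> e) \<inter> path_image (\<gamma> f) = p ` (e \<inter> f))"

definition planar :: "'a set \<Rightarrow> 'a set set \<Rightarrow> bool" where
  "planar V E \<longleftrightarrow> (\<exists>p \<gamma>. plane_drawing V E p \<gamma>)"

end

theory Submission
  imports Defs "HOL-Complex_Analysis.Complex_Analysis"
begin

text \<open>
  A plane drawing yields a set of cycles that spans the cycle space over the two-element field and
  covers every edge at most twice, namely the boundaries of the bounded faces.  By MacLane, having
  such a set characterises planarity, and this criterion is all that is used about the plane:
  it passes to minors, and it gives Euler's bound.

  Take a counterexample with as few vertices, and then as many edges, as possible.  Independent sets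
  of smaller pieces can be glued along a clique of at most three vertices, or along an induced
  4-cycle after adding a chord or identifying two opposite corners on one side.  So the graph is a
  triangulation of minimum degree at least 5 in which every triangle is a face and no 4-cycle is
  induced.

  Call nonadjacent vertices opposite if they have exactly two common neighbours and these are
  adjacent, so that they are the apexes of two triangles with a common edge.  If an independent
  set \<open>J\<close> and its neighbourhood are deleted, except for some disjoint connected parts that are
  contracted, then minimality shows that certain configurations do not occur.  It follows that a
  vertex of degree 5 is opposite to at least three vertices of degree at least 7, whereas a
  vertex of degree \<open>d \<ge> 7\<close> is opposite to at most \<open>3 (d - 6)\<close> vertices of degree 5.  Sending \<open>1/3\<close>
  from the large vertices to each of the opposite vertices of degree 5 shows that the average degree is at
  least 6, which contradicts Euler's bound.
\<close>

section \<open>The cycle space and MacLane's criterion\<close>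

text \<open>The constant enters through one inequality: deleting \<open>R\<close> while keeping
  \<open>card I\<close> contracted vertices and gaining \<open>card J\<close> independent ones is
  possible only if \<open>3 * card R > 13 * card J + 3 * card I\<close>. A chosen vertex pays for
  four deleted vertices with 1 to spare, and each contracted part pays for one more. So a vertex of
  degree 4 is reducible (15 against 13 + 3), but one of degree 5 is not by itself (18 against 16);
  the configurations with two or three chosen vertices exist to get past degree 5, and most of them
  balance exactly. The obstacle is that vertices may be identified only by contracting connected
  sets, since planarity must survive. Hence the search for disjoint connected parts, and hence the
  form of the 4-cycle argument: each side of the cycle supplies the path that is contracted on
  behalf of the other. The surplus 13 - 12 = 1 is what makes separators of four vertices tractable.
  Describing everything by edge sets turns faces, sides of a cycle and the order around a vertex
  into parity statements, and topology is confined to producing the first generators.\<close>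

definition sd :: "'a set \<Rightarrow> 'a set \<Rightarrow> 'a set" where
  "sd A B = (A - B) \<union> (B - A)"

lemma sd_iff: "x \<in> sd A B \<longleftrightarrow> (x \<in> A) \<noteq> (x \<in> B)"
  by (auto simp: sd_def)

lemma sd_empty [simp]: "sd {} A = A" "sd A {} = A" "sd A A = {}"
  by (auto simp: sd_def)

lemma sd_commute: "sd A B = sd B A"
  by (auto simp: sd_def)

lemma sd_assoc: "sd (sd A B) C = sd A (sd B C)"
  by (auto simp: sd_def)

lemma sd_cancel [simp]: "sd A (sd A B) = B"
  by (auto simp: sd_def)

lemma sd_eq_empty_iff [simp]: "sd A B = {} \<longleftrightarrow> A = B"
  by (auto simp: sd_def)

lemma finite_sd [simp]: "finite A \<Longrightarrow> finite B \<Longrightarrow> finite (sd A B)"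
  by (simp add: sd_def)

lemma sd_insert: "x \<notin> A \<Longrightarrow> insert x A = sd {x} A"
  by (auto simp: sd_def)

lemma Int_sd: "sd A B \<inter> C = sd (A \<inter> C) (B \<inter> C)"
  by (auto simp: sd_def)

lemma Collect_sd: "{x \<in> sd A B. P x} = sd {x \<in> A. P x} {x \<in> B. P x}"
  by (auto simp: sd_def)

lemma even_card_sd:
  assumes "finite A" "finite B"
  shows "even (card (sd A B)) \<longleftrightarrow> (even (card A) \<longleftrightarrow> even (card B))"
proof -
  have "card (sd A B) = card (A - B) + card (B - A)"
    unfolding sd_def using assms by (intro card_Un_disjoint) auto
  moreover have "card A = card (A \<inter> B) + card (A - B)" "card B = card (B \<inter> A) + card (B - A)"
    using assms by (auto intro: card_Int_Diff)
  ultimately show ?thesis by (simp add: Int_commute) blast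
qed

text \<open>The boundary map of the graph as a one-dimensional complex, with coefficients modulo 2.
  Additivity is stated for finite sets because \<open>card\<close> is 0 on infinite ones.\<close>

definition bd :: "'v set set \<Rightarrow> 'v set" where
  "bd z = {v. odd (card {e \<in> z. v \<in> e})}"

lemma bd_sd:
  assumes "finite y" "finite z"
  shows "bd (sd y z) = sd (bd y) (bd z)"
  using assms by (auto simp: bd_def sd_iff[of _ "Collect _"] Collect_sd even_card_sd)

lemma bd_empty [simp]: "bd {} = {}"
  by (simp add: bd_def)

lemma bd_singleton [simp]: "bd {e} = e"
proof -
  have "{e' \<in> {e}. v \<in> e'} = (if v \<in> e then {e} else {})" for v by auto
  then show ?thesis by (auto simp: bd_def)
qed

lemma bd_insert:
  assumes "finite z" "e \<notin> z"
  shows "bd (insert e z) = sd e (bd z)"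
  using assms by (subst sd_insert) (auto simp: bd_sd)

lemma bd_subset: "bd z \<subseteq> \<Union>z"
proof
  fix v assume "v \<in> bd z"
  then have odd: "odd (card {e \<in> z. v \<in> e})" by (simp add: bd_def)
  have "{e \<in> z. v \<in> e} \<noteq> {}"
  proof
    assume "{e \<in> z. v \<in> e} = {}"
    from odd[unfolded this] show False by simp
  qed
  then show "v \<in> \<Union>z" by auto
qed

lemma bd_Un_disjoint:
  assumes "finite y" "finite z" "y \<inter> z = {}"
  shows "bd (y \<union> z) = sd (bd y) (bd z)"
proof -
  have "y \<union> z = sd y z" using assms by (auto simp: sd_def)
  with assms show ?thesis by (simp add: bd_sd)
qed

lemma bd_Diff:
  assumes "finite y" "z \<subseteq> y"
  shows "bd (y - z) = sd (bd y) (bd z)"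
proof -
  have "y - z = sd y z" using assms by (auto simp: sd_def)
  with assms show ?thesis by (metis bd_sd finite_subset)
qed

definition sgraph :: "'v set set \<Rightarrow> bool" where
  "sgraph E \<longleftrightarrow> finite E \<and> (\<forall>e\<in>E. card e = 2)"

lemma sgraph_finite: "sgraph E \<Longrightarrow> finite E"
  by (simp add: sgraph_def)

lemma sgraph_subset: "sgraph E \<Longrightarrow> E' \<subseteq> E \<Longrightarrow> sgraph E'"
  by (auto simp: sgraph_def intro: finite_subset)

lemma sgraph_edge: "sgraph E \<Longrightarrow> e \<in> E \<Longrightarrow> \<exists>x y. e = {x, y} \<and> x \<noteq> y"
  by (auto simp: sgraph_def card_2_iff)

lemma sgraph_edge_neq: "sgraph E \<Longrightarrow> {x, y} \<in> E \<Longrightarrow> x \<noteq> y"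
  by (force simp: sgraph_def)

definition cyc :: "'v set set \<Rightarrow> 'v set set set" where
  "cyc E = {z. z \<subseteq> E \<and> bd z = {}}"

lemma cyc_sd: "finite E \<Longrightarrow> y \<in> cyc E \<Longrightarrow> z \<in> cyc E \<Longrightarrow> sd y z \<in> cyc E"
  by (auto simp: cyc_def bd_sd finite_subset sd_iff)

lemma empty_in_cyc [simp]: "{} \<in> cyc E"
  by (simp add: cyc_def)

lemma cyc_mono: "E \<subseteq> E' \<Longrightarrow> z \<in> cyc E \<Longrightarrow> z \<in> cyc E'"
  by (auto simp: cyc_def)

text \<open>The linear span: modulo 2 the only scalars are 0 and 1, so adding generators one at a
  time gives all combinations.\<close>

inductive_set zspan :: "'a set set \<Rightarrow> 'a set set" for Phi where
  zspan_empty: "{} \<in> zspan Phi"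
| zspan_step: "F \<in> Phi \<Longrightarrow> z \<in> zspan Phi \<Longrightarrow> sd F z \<in> zspan Phi"

lemma zspan_base: "F \<in> Phi \<Longrightarrow> F \<in> zspan Phi"
  using zspan_step[OF _ zspan_empty] by simp

lemma zspan_sd: "y \<in> zspan Phi \<Longrightarrow> z \<in> zspan Phi \<Longrightarrow> sd y z \<in> zspan Phi"
  by (induction rule: zspan.induct) (auto simp: sd_assoc intro: zspan.intros)

lemma zspan_trans: "z \<in> zspan Phi \<Longrightarrow> Phi \<subseteq> zspan Psi \<Longrightarrow> z \<in> zspan Psi"
  by (induction rule: zspan.induct) (auto intro: zspan_empty zspan_sd)

lemma zspan_mono: "Phi \<subseteq> Psi \<Longrightarrow> zspan Phi \<subseteq> zspan Psi"
  using zspan_trans[of _ Phi Psi] zspan_base by blast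

text \<open>Parity of the intersection with \<open>D\<close> is a linear functional, so it vanishes
  on the span once it vanishes on the generators. Later \<open>D\<close> is a set of edges at one
  vertex, and a single cycle that meets it oddly gives the contradiction.\<close>

lemma zspan_even:
  assumes "z \<in> zspan Phi" "finite E" "\<Union>Phi \<subseteq> E"
    and "\<And>F. F \<in> Phi \<Longrightarrow> even (card (F \<inter> D))"
  shows "even (card (z \<inter> D))"
proof -
  have "z \<subseteq> E \<and> even (card (z \<inter> D))" using assms(1)
  proof (induction rule: zspan.induct)
    case (zspan_step F z)
    then have "F \<subseteq> E" using assms(3) by auto
    then have "finite (F \<inter> D)" "finite (z \<inter> D)"
      using zspan_step assms(2) by (auto intro: finite_subset)
    then show ?case
      using zspan_step assms(4)[of F] \<open>F \<subseteq> E\<close> by (auto simp: Int_sd even_card_sd sd_iff)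
  qed auto
  then show ?thesis by simp
qed

text \<open>The sum of a finite set of vectors. Unlike membership in \<open>zspan\<close> it records
  which generators occur, which is needed for speaking of dependencies.\<close>

definition xsum :: "'a set set \<Rightarrow> 'a set" where
  "xsum S = {e. odd (card {F \<in> S. e \<in> F})}"

lemma xsum_empty [simp]: "xsum {} = {}"
  by (simp add: xsum_def)

lemma xsum_sd:
  assumes "finite S" "finite T"
  shows "xsum (sd S T) = sd (xsum S) (xsum T)"
  using assms by (auto simp: xsum_def sd_iff[of _ "Collect _"] Collect_sd even_card_sd)

lemma xsum_singleton [simp]: "xsum {F} = F"
proof -
  have "{F' \<in> {F}. e \<in> F'} = (if e \<in> F then {F} else {})" for e by auto
  then show ?thesis by (auto simp: xsum_def)
qed

lemma xsum_insert:
  assumes "finite S" "F \<notin> S"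
  shows "xsum (insert F S) = sd F (xsum S)"
proof -
  have "xsum (insert F S) = xsum (sd {F} S)" using assms sd_insert by metis
  also have "\<dots> = sd F (xsum S)" using xsum_sd[of "{F}" S] assms by simp
  finally show ?thesis .
qed

lemma xsum_in_zspan: "finite S \<Longrightarrow> S \<subseteq> Phi \<Longrightarrow> xsum S \<in> zspan Phi"
  by (induction S rule: finite_induct) (auto simp: xsum_insert intro: zspan.intros)

lemma zspan_imp_xsum:
  assumes "z \<in> zspan Phi"
  obtains S where "finite S" "S \<subseteq> Phi" "z = xsum S"
proof -
  have "\<exists>S. finite S \<and> S \<subseteq> Phi \<and> z = xsum S" using assms
  proof (induction rule: zspan.induct)
    case zspan_empty
    then show ?case by (intro exI[of _ "{}"]) simp
  next
    case (zspan_step F z)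
    then obtain S where S: "finite S" "S \<subseteq> Phi" "z = xsum S" by auto
    have "xsum (sd {F} S) = sd F z" using S by (simp add: xsum_sd)
    moreover have "sd {F} S \<subseteq> Phi" "finite (sd {F} S)" using S zspan_step by (auto simp: sd_iff)
    ultimately show ?case by metis
  qed
  with that show ?thesis by auto
qed

section \<open>Generators covering every edge at most twice, and edge deletion\<close>

definition cover2 :: "'a set set \<Rightarrow> bool" where
  "cover2 Phi \<longleftrightarrow> (\<forall>e. card {F \<in> Phi. e \<in> F} \<le> 2)"

text \<open>MacLane's planarity criterion: the cycle space has a spanning set that covers no edge
  more than twice.  Unlike plane drawings, it is inherited by minors for purely algebraic reasons.\<close>

definition mac :: "'v set set \<Rightarrow> 'v set set set \<Rightarrow> bool" where
  "mac E Phi \<longleftrightarrow> Phi \<subseteq> cyc E \<and> cover2 Phi \<and> cyc E \<subseteq> zspan Phi"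

definition maclane :: "'v set set \<Rightarrow> bool" where
  "maclane E \<longleftrightarrow> (\<exists>Phi. mac E Phi)"

lemma cyc_subset_Pow: "cyc E \<subseteq> Pow E"
  by (auto simp: cyc_def)

lemma finite_cyc: "finite E \<Longrightarrow> finite (cyc E)"
  using cyc_subset_Pow finite_subset by blast

lemma zspan_cyc: "z \<in> zspan Phi \<Longrightarrow> finite E \<Longrightarrow> Phi \<subseteq> cyc E \<Longrightarrow> z \<in> cyc E"
  by (induction rule: zspan.induct) (auto intro: cyc_sd)

lemma card_le_2_third:
  assumes "card A \<le> 2" "finite A" "a \<in> A" "b \<in> A" "a \<noteq> b" "c \<in> A"
  shows "c = a \<or> c = b"
proof (rule ccontr)
  assume "\<not> ?thesis"
  then have "card {a, b, c} = 3" using assms by auto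
  moreover have "card {a, b, c} \<le> card A" using assms by (intro card_mono) auto
  ultimately show False using assms by simp
qed

lemma card_le_2I:
  assumes "\<And>a b c. a \<in> A \<Longrightarrow> b \<in> A \<Longrightarrow> c \<in> A \<Longrightarrow> a = b \<or> a = c \<or> b = c"
  shows "card A \<le> 2"
proof (rule ccontr)
  assume "\<not> ?thesis"
  then have "3 \<le> card A" by simp
  then obtain B where "B \<subseteq> A" "card B = 3" by (meson obtain_subset_with_card_n)
  then obtain a b c where "B = {a, b, c}" "a \<noteq> b" "a \<noteq> c" "b \<noteq> c" by (auto simp: card_3_iff)
  with \<open>B \<subseteq> A\<close> assms[of a b c] show False by auto
qed

lemma cover2_mono: "cover2 Phi \<Longrightarrow> finite Phi \<Longrightarrow> Psi \<subseteq> Phi \<Longrightarrow> cover2 Psi"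
  unfolding cover2_def
proof
  fix e assume *: "\<forall>e. card {F \<in> Phi. e \<in> F} \<le> 2" "finite Phi" "Psi \<subseteq> Phi"
  have "card {F \<in> Psi. e \<in> F} \<le> card {F \<in> Phi. e \<in> F}"
    using * by (intro card_mono) auto
  with * show "card {F \<in> Psi. e \<in> F} \<le> 2" using le_trans by blast
qed

text \<open>Bookkeeping for splitting the generator \<open>F\<close> into \<open>P\<close> and
  \<open>Q\<close>: an edge in both halves must be new, and an edge in one half must be new or be
  released by \<open>F\<close>.\<close>

lemma cover2_replace:
  assumes "finite Phi" "cover2 Phi" "F \<in> Phi"
    and both: "\<And>e H. \<lbrakk>e \<in> P; e \<in> Q; H \<in> Phi\<rbrakk> \<Longrightarrow> e \<notin> H"
    and one: "\<And>e. e \<in> P \<union> Q \<Longrightarrow> e \<in> F \<or> (\<forall>H\<in>Phi. e \<notin> H)"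
  shows "cover2 (Phi - {F} \<union> {P, Q})"
  unfolding cover2_def
proof
  fix e
  have fin: "finite {H \<in> Phi - {F} \<union> {P, Q}. e \<in> H}" "finite {H \<in> Phi. e \<in> H}"
    using assms(1) by auto
  consider "\<forall>H\<in>Phi. e \<notin> H" | "e \<notin> P \<union> Q" | "e \<in> P \<union> Q" "e \<in> F"
    using one by blast
  then show "card {H \<in> Phi - {F} \<union> {P, Q}. e \<in> H} \<le> 2"
  proof cases
    case 1
    then have "card {H \<in> Phi - {F} \<union> {P, Q}. e \<in> H} \<le> card {P, Q}"
      by (intro card_mono) auto
    also have "\<dots> \<le> 2" by (simp add: card_insert_if)
    finally show ?thesis .
  next
    case 2
    then have "card {H \<in> Phi - {F} \<union> {P, Q}. e \<in> H} \<le> card {H \<in> Phi. e \<in> H}"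
      using fin by (intro card_mono) auto
    then show ?thesis using assms(2) by (auto simp: cover2_def intro: le_trans)
  next
    case 3
    define X where "X = (if e \<in> P then P else Q)"
    have "{H \<in> Phi - {F} \<union> {P, Q}. e \<in> H} \<subseteq> insert X ({H \<in> Phi. e \<in> H} - {F})"
      using 3 both[of e F] assms(3) by (auto simp: X_def)
    then have "card {H \<in> Phi - {F} \<union> {P, Q}. e \<in> H} \<le> card (insert X ({H \<in> Phi. e \<in> H} - {F}))"
      using fin by (intro card_mono) auto
    also have "\<dots> \<le> Suc (card ({H \<in> Phi. e \<in> H} - {F}))"
      by (rule card_insert_le_m1) auto
    also have "\<dots> = card {H \<in> Phi. e \<in> H}"
      using assms fin 3 by (intro card.remove[symmetric]) auto
    finally show ?thesis using assms(2) by (auto simp: cover2_def intro: le_trans)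
  qed
qed

text \<open>Deleting \<open>d\<close> merges the two generators that contain it. A combination that
  avoids \<open>d\<close> uses both or neither of them, so their sum can stand in for the pair; a
  generator that alone contains \<open>d\<close> never occurs in such a combination.\<close>

lemma maclane_delete_edge:
  assumes "finite E" "maclane E"
  shows "maclane (E - {d})"
proof -
  obtain Phi where Phi: "Phi \<subseteq> cyc E" "cover2 Phi" "cyc E \<subseteq> zspan Phi"
    using assms by (auto simp: maclane_def mac_def)
  have fin: "finite Phi" using Phi(1) finite_cyc[OF assms(1)] finite_subset by blast
  define A where "A = {F \<in> Phi. d \<in> F}"
  have A: "card A \<le> 2" "finite A" using Phi fin by (auto simp: A_def cover2_def)
  have nA: "F \<in> cyc (E - {d})" if "F \<in> Phi - A" for F
    using that Phi(1) by (auto simp: A_def cyc_def)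
  \<comment> \<open>\<open>S \<inter> A\<close> consists of the summands through \<open>d\<close>,
    whose parity decides whether \<open>d\<close> survives in the sum.\<close>
  have even: "even (card (S \<inter> A))" if S: "finite S" "S \<subseteq> Phi" "xsum S \<in> cyc (E - {d})" for S
  proof -
    have "S \<inter> A = {F \<in> S. d \<in> F}" using S by (auto simp: A_def)
    then show ?thesis using S by (auto simp: xsum_def cyc_def)
  qed
  have rep: "\<exists>S. finite S \<and> S \<subseteq> Phi \<and> xsum S = z \<and> even (card (S \<inter> A))"
    if "z \<in> cyc (E - {d})" for z
  proof -
    have "z \<in> zspan Phi" using that Phi(3) cyc_mono[of "E - {d}" E] by auto
    then show ?thesis using even that by (metis zspan_imp_xsum)
  qed
  show ?thesis
  proof (cases "\<exists>F G. A = {F, G} \<and> F \<noteq> G")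
    case True
    then obtain F G where FG: "A = {F, G}" "F \<noteq> G" by auto
    then have FG': "F \<in> Phi" "G \<in> Phi" "d \<in> F" "d \<in> G" by (auto simp: A_def)
    define Psi where "Psi = (Phi - A) \<union> {sd F G}"
    have "sd F G \<in> cyc (E - {d})"
    proof -
      have "sd F G \<in> cyc E" using FG' Phi(1) cyc_sd[OF assms(1)] by blast
      then show ?thesis using FG' by (auto simp: cyc_def sd_iff)
    qed
    then have 1: "Psi \<subseteq> cyc (E - {d})" using nA by (auto simp: Psi_def)
    have 2: "cover2 Psi" unfolding cover2_def
    proof
      fix e
      show "card {H \<in> Psi. e \<in> H} \<le> 2"
      proof (cases "e \<in> sd F G")
        case False
        then have "card {H \<in> Psi. e \<in> H} \<le> card {H \<in> Phi. e \<in> H}"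
          using fin by (intro card_mono) (auto simp: Psi_def)
        then show ?thesis using Phi(2) by (auto simp: cover2_def intro: le_trans)
      next
        case True
        \<comment> \<open>\<open>e\<close> lies in exactly one of \<open>F\<close> and
          \<open>G\<close>; dropping that one makes room for their sum.\<close>
        define X where "X = (if e \<in> F then F else G)"
        have X: "X \<in> Phi" "e \<in> X" "X \<in> A" using True FG FG' by (auto simp: X_def sd_iff)
        have "{H \<in> Psi. e \<in> H} \<subseteq> insert (sd F G) ({H \<in> Phi. e \<in> H} - {X})"
          using X by (auto simp: Psi_def)
        then have "card {H \<in> Psi. e \<in> H} \<le> card (insert (sd F G) ({H \<in> Phi. e \<in> H} - {X}))"
          using fin by (intro card_mono) auto
        also have "\<dots> \<le> Suc (card ({H \<in> Phi. e \<in> H} - {X}))"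
          by (rule card_insert_le_m1) auto
        also have "\<dots> = card {H \<in> Phi. e \<in> H}"
          using fin X by (intro card.remove[symmetric]) auto
        finally show ?thesis using Phi(2) by (auto simp: cover2_def intro: le_trans)
      qed
    qed
    have 3: "z \<in> zspan Psi" if z: "z \<in> cyc (E - {d})" for z
    proof -
      obtain S where S: "finite S" "S \<subseteq> Phi" "xsum S = z" "even (card (S \<inter> A))"
        using rep[OF z] by auto
      have "xsum (S - A) \<in> zspan Psi"
        using S by (intro xsum_in_zspan) (auto simp: Psi_def)
      moreover have "z = xsum (S - A) \<or> z = sd (sd F G) (xsum (S - A))"
      proof (cases "F \<in> S")
        case True
        have "G \<in> S"
        proof (rule ccontr)
          assume "G \<notin> S"
          then have "S \<inter> A = {F}" using True FG by auto
          then show False using S(4) by simp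
        qed
        then have "S = insert F (insert G (S - A))" using True FG by auto
        then have "xsum S = sd F (sd G (xsum (S - A)))"
          using FG S by (metis (no_types, lifting) DiffE finite_Diff finite_insert insertI1 insert_iff xsum_insert)
        then show ?thesis using S by (simp add: sd_assoc)
      next
        case False
        have "G \<notin> S"
        proof
          assume "G \<in> S"
          then have "S \<inter> A = {G}" using False FG by auto
          then show False using S(4) by simp
        qed
        then show ?thesis using False FG S by (metis Diff_empty Diff_insert0)
      qed
      moreover have "sd F G \<in> zspan Psi" by (intro zspan_base) (auto simp: Psi_def)
      ultimately show ?thesis using zspan_sd by metis
    qed
    show ?thesis using 1 2 3 by (auto simp: maclane_def mac_def)
  next
    case False
    have "card A = 0 \<or> card A = 1 \<or> card A = 2" using A(1) by linarith
    then have "A = {} \<or> (\<exists>F. A = {F})" using False A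
      by (auto simp: card_1_singleton_iff card_2_iff)
    then have 3: "S \<inter> A = {}" if "even (card (S \<inter> A))" for S
      using that by (metis Int_commute Int_insert_right_if0 Int_insert_right_if1 card_1_singleton_iff inf_bot_right odd_one One_nat_def)
    have "z \<in> zspan (Phi - A)" if z: "z \<in> cyc (E - {d})" for z
    proof -
      obtain S where S: "finite S" "S \<subseteq> Phi" "xsum S = z" "even (card (S \<inter> A))"
        using rep[OF z] by auto
      then have "S \<subseteq> Phi - A" using 3[of S] by auto
      then show ?thesis using S xsum_in_zspan by blast
    qed
    then have "cyc (E - {d}) \<subseteq> zspan (Phi - A)" by auto
    moreover have "cover2 (Phi - A)" using cover2_mono[OF Phi(2) fin] by auto
    ultimately show ?thesis using nA unfolding maclane_def mac_def by (metis subsetI)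
  qed
qed

lemma maclane_subset:
  assumes "finite E" "maclane E" "E' \<subseteq> E"
  shows "maclane E'"
proof -
  have "maclane (E - D)" if "finite D" for D
    using that
  proof (induction D rule: finite_induct)
    case (insert d D)
    have "E - insert d D = (E - D) - {d}" by auto
    then show ?case using maclane_delete_edge[of "E - D" d] insert assms(1) by simp
  qed (use assms in simp)
  from this[of "E - E'"] show ?thesis
    using assms by (metis Diff_Diff_Int finite_Diff inf.absorb2)
qed

section \<open>Minors\<close>

text \<open>The closure is reflexive, so \<open>reach E W x x\<close> holds even for
  \<open>x\<close> outside \<open>W\<close>; conclusions about membership in \<open>W\<close>
  therefore need it for the first vertex.\<close>

definition reach :: "'v set set \<Rightarrow> 'v set \<Rightarrow> 'v \<Rightarrow> 'v \<Rightarrow> bool" where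
  "reach E W = (\<lambda>x y. x \<in> W \<and> y \<in> W \<and> {x, y} \<in> E)\<^sup>*\<^sup>*"

lemma reach_refl [simp]: "reach E W x x"
  by (simp add: reach_def)

lemma reach_step: "x \<in> W \<Longrightarrow> y \<in> W \<Longrightarrow> {x, y} \<in> E \<Longrightarrow> reach E W x y"
  unfolding reach_def by (rule r_into_rtranclp) auto

lemma reach_trans: "reach E W x y \<Longrightarrow> reach E W y z \<Longrightarrow> reach E W x z"
  unfolding reach_def by (rule rtranclp_trans)

lemma reach_sym: "reach E W x y \<Longrightarrow> reach E W y x"
  unfolding reach_def
  by (rule sympD[OF symp_rtranclp]) (auto simp: symp_def insert_commute)

lemma reach_mono: "reach E W x y \<Longrightarrow> W \<subseteq> W' \<Longrightarrow> reach E W' x y"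
  unfolding reach_def by (rule rtranclp_mono[THEN predicate2D, rotated]) auto

lemma reach_in: "reach E W x y \<Longrightarrow> x \<in> W \<Longrightarrow> y \<in> W"
  unfolding reach_def by (induction rule: rtranclp_induct) auto

lemma reach_closed:
  assumes "reach E W x y" "x \<in> X" "\<And>a b. a \<in> X \<Longrightarrow> a \<in> W \<Longrightarrow> b \<in> W \<Longrightarrow> {a, b} \<in> E \<Longrightarrow> b \<in> X"
  shows "y \<in> X"
  using assms(1,2) unfolding reach_def
  by (induction rule: rtranclp_induct) (auto intro: assms(3))

text \<open>A walk, summed edge by edge modulo 2, has its two ends as boundary. The form
  \<open>sd {a} {b}\<close> keeps the case \<open>a = b\<close> correct, where the boundary is
  empty.\<close>

lemma reach_join:
  assumes "sgraph E" "reach E W a b"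
  obtains z where "z \<subseteq> {e \<in> E. e \<subseteq> W}" "bd z = sd {a} {b}"
proof -
  have "\<exists>z \<subseteq> {e \<in> E. e \<subseteq> W}. bd z = sd {a} {b}"
    using assms(2) unfolding reach_def
  proof (induction rule: rtranclp_induct)
    case base
    then show ?case by (intro exI[of _ "{}"]) auto
  next
    case (step b c)
    then obtain z where z: "z \<subseteq> {e \<in> E. e \<subseteq> W}" "bd z = sd {a} {b}" by auto
    have "b \<noteq> c" using step assms(1) sgraph_edge_neq by metis
    have "finite z" using z assms(1) by (auto simp: sgraph_def intro: finite_subset)
    then have "bd (sd z {{b, c}}) = sd {a} {c}"
      using z \<open>b \<noteq> c\<close> by (auto simp: bd_sd sd_iff)
    moreover have "sd z {{b, c}} \<subseteq> {e \<in> E. e \<subseteq> W}" using z step by (auto simp: sd_iff)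
    ultimately show ?case by blast
  qed
  with that show ?thesis by auto
qed

lemma finite_bd:
  assumes "sgraph E" "z \<subseteq> E"
  shows "finite (bd z)"
proof (rule finite_subset[OF bd_subset])
  have "finite z" using assms by (auto simp: sgraph_def intro: finite_subset)
  moreover have "finite e" if "e \<in> z" for e
    using that assms by (auto simp: sgraph_def intro!: card_ge_0_finite)
  ultimately show "finite (\<Union>z)" by auto
qed

text \<open>The fibres of \<open>rho\<close> are the branch sets, each named by its value. Vertices
  outside \<open>V0\<close> are deleted, edges inside a fibre vanish, and parallel edges merge
  because edges form a set.\<close>

definition minor :: "'v set set \<Rightarrow> 'v set \<Rightarrow> ('v \<Rightarrow> 'w) \<Rightarrow> 'w set set" where
  "minor E V0 rho = {{rho x, rho y} | x y. {x, y} \<in> E \<and> x \<in> V0 \<and> y \<in> V0 \<and> rho x \<noteq> rho y}"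

lemma sgraph_minor:
  assumes "sgraph E"
  shows "sgraph (minor E V0 rho)"
proof -
  have "minor E V0 rho \<subseteq> (`) rho ` E"
  proof
    fix e assume "e \<in> minor E V0 rho"
    then obtain x y where "{x, y} \<in> E" "e = rho ` {x, y}" by (auto simp: minor_def)
    then show "e \<in> (`) rho ` E" by blast
  qed
  then have "finite (minor E V0 rho)" using assms by (auto simp: sgraph_def intro: finite_surj)
  then show ?thesis by (auto simp: sgraph_def) (auto simp: minor_def)
qed

text \<open>Existence of a T-join inside the fibres: two elements of \<open>T\<close> in the same
  fibre are joined by a path there and removed from \<open>T\<close>; parity guarantees that a
  partner exists.\<close>

lemma even_join_in_fibers:
  fixes rho :: "'v \<Rightarrow> 'w"
  assumes "sgraph E"
    and fib: "\<And>x y. \<lbrakk>x \<in> V0; y \<in> V0; rho x = rho y\<rbrakk> \<Longrightarrow> reach E {v \<in> V0. rho v = rho x} x y"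
    and "finite T" "T \<subseteq> V0" "\<And>w. even (card (T \<inter> {v \<in> V0. rho v = w}))"
  shows "\<exists>J \<subseteq> {e \<in> E. e \<subseteq> V0 \<and> (\<exists>w. rho ` e = {w})}. bd J = T"
  using assms(3-5)
proof (induction "card T" arbitrary: T rule: less_induct)
  case less
  show ?case
  proof (cases "T = {}")
    case True
    then show ?thesis by (intro exI[of _ "{}"]) auto
  next
    case False
    then obtain a where a: "a \<in> T" by auto
    define X where "X = {v \<in> V0. rho v = rho a}"
    have aX: "a \<in> T \<inter> X" using a less by (auto simp: X_def)
    have "T \<inter> X \<noteq> {a}" using less(4)[of "rho a"] by (auto simp: X_def)
    then obtain b where b: "b \<in> T" "b \<in> X" "b \<noteq> a" using aX by auto
    have "reach E X a b" using fib[of a b] b aX by (auto simp: X_def)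
    then obtain z where z: "z \<subseteq> {e \<in> E. e \<subseteq> X}" "bd z = sd {a} {b}"
      using reach_join[OF assms(1)] by metis
    have e1: "e \<in> {e \<in> E. e \<subseteq> V0 \<and> (\<exists>w. rho ` e = {w})}" if "e \<in> z" for e
    proof -
      from that z have "e \<in> E" "e \<subseteq> X" by auto
      moreover then obtain x where "x \<in> e" using sgraph_edge[OF assms(1)] by blast
      ultimately have "rho ` e = {rho a}" by (auto simp: X_def image_iff subset_iff intro!: bexI[of _ x])
      with \<open>e \<in> E\<close> \<open>e \<subseteq> X\<close> show ?thesis by (auto simp: X_def)
    qed
    have "\<exists>J \<subseteq> {e \<in> E. e \<subseteq> V0 \<and> (\<exists>w. rho ` e = {w})}. bd J = T - {a, b}"
    proof (rule less(1))
      show "card (T - {a, b}) < card T" using a less(2) by (intro psubset_card_mono) auto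
      fix w
      show "even (card ((T - {a, b}) \<inter> {v \<in> V0. rho v = w}))"
      proof (cases "w = rho a")
        case True
        then have "(T - {a, b}) \<inter> {v \<in> V0. rho v = w} = T \<inter> {v \<in> V0. rho v = w} - {a, b}" by auto
        moreover have "{a, b} \<subseteq> T \<inter> {v \<in> V0. rho v = w}" using True aX b by (auto simp: X_def)
        ultimately show ?thesis using less(4)[of w] less(2) b
          by (simp add: card_Diff_subset)
      next
        case False
        then have "(T - {a, b}) \<inter> {v \<in> V0. rho v = w} = T \<inter> {v \<in> V0. rho v = w}"
          using b by (auto simp: X_def)
        then show ?thesis using less(4)[of w] by simp
      qed
    qed (use less in auto)
    then obtain J where J: "J \<subseteq> {e \<in> E. e \<subseteq> V0 \<and> (\<exists>w. rho ` e = {w})}" "bd J = T - {a, b}" by auto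
    have "finite z" "finite J" using z J assms(1) by (auto simp: sgraph_def intro: finite_subset)
    then have "bd (sd z J) = T" using z J a b by (auto simp: bd_sd sd_iff)
    moreover have "sd z J \<subseteq> {e \<in> E. e \<subseteq> V0 \<and> (\<exists>w. rho ` e = {w})}"
      using J(1) e1 unfolding sd_def by blast
    ultimately show ?thesis by blast
  qed
qed

text \<open>\<open>push\<close> forgets the contracted edges. It is linear, and the boundary of
  \<open>push z\<close> counts \<open>bd z\<close> by fibres modulo 2, so cycles go to cycles; an
  edge of the minor is covered at most as often as its lift. Every cycle of the minor is reached,
  because its lift has an even boundary in every fibre and can be closed up inside the
  fibres.\<close>

lemma maclane_minor:
  fixes rho :: "'v \<Rightarrow> 'w"
  assumes "sgraph E" "maclane E"
    and fib: "\<And>x y. \<lbrakk>x \<in> V0; y \<in> V0; rho x = rho y\<rbrakk> \<Longrightarrow> reach E {v \<in> V0. rho v = rho x} x y"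
  shows "maclane (minor E V0 rho)"
proof -
  define E' where "E' = minor E V0 rho"
  have gE': "sgraph E'" using sgraph_minor[OF assms(1)] by (simp add: E'_def)
  define I where "I = {e \<in> E. e \<subseteq> V0 \<and> (\<exists>w. rho ` e = {w})}"
  have ex: "\<exists>e. e \<in> E \<and> e \<subseteq> V0 \<and> rho ` e = e'" if "e' \<in> E'" for e'
    using that by (force simp: E'_def minor_def)
  then obtain g where g: "\<And>e'. e' \<in> E' \<Longrightarrow> g e' \<in> E \<and> g e' \<subseteq> V0 \<and> rho ` g e' = e'" by metis
  \<comment> \<open>One lift is kept for every edge of the minor; its parallel edges are deleted
    beforehand, so that \<open>push\<close> sees each edge once.\<close>
  define H where "H = I \<union> g ` E'"
  have HE: "H \<subseteq> E" using g by (auto simp: H_def I_def)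
  have gH: "sgraph H" using sgraph_subset[OF assms(1) HE] .
  have finH: "finite H" "finite E'" using gH gE' sgraph_finite by auto
  have HV: "e \<subseteq> V0" if "e \<in> H" for e using that g by (auto simp: H_def I_def)
  have gI: "g e' \<notin> I" if e': "e' \<in> E'" for e'
  proof
    assume "g e' \<in> I"
    then obtain w where "e' = {w}" using g[OF e'] by (auto simp: I_def)
    then show False using e' gE' by (auto simp: sgraph_def)
  qed
  have ginj: "g e1 = g e2 \<Longrightarrow> e1 = e2" if "e1 \<in> E'" "e2 \<in> E'" for e1 e2
    using g that by metis
  define push where "push z = {e' \<in> E'. g e' \<in> z}" for z
  have push_sd: "push (sd y z) = sd (push y) (push z)" for y z
    by (auto simp: push_def sd_iff)
  \<comment> \<open>Both sides change in step: an edge inside a fibre changes neither, and a lifted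
    edge changes the parity in exactly its two end fibres.\<close>
  have push_bd: "bd (push z) = {w. odd (card (bd z \<inter> {v \<in> V0. rho v = w}))}"
    if "z \<subseteq> H" for z
  proof -
    have "finite z" using that finH finite_subset by auto
    then show ?thesis using that
    proof (induction z rule: finite_induct)
      case empty
      then show ?case by (simp add: push_def)
    next
      case (insert e z)
      let ?X = "\<lambda>w. {v \<in> V0. rho v = w}"
      have IH: "bd (push z) = {w. odd (card (bd z \<inter> ?X w))}" using insert by auto
      have eH: "e \<in> H" using insert by auto
      then obtain x y where xy: "e = {x, y}" "x \<noteq> y" using sgraph_edge[OF gH] by metis
      have xyV: "x \<in> V0" "y \<in> V0" using HV[OF eH] xy by auto
      have "finite (bd z)" using finite_bd[OF gH] insert by auto
      moreover have "bd (insert e z) = sd e (bd z)" using insert bd_insert by metis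
      ultimately have par: "odd (card (bd (insert e z) \<inter> ?X w)) \<longleftrightarrow>
          (odd (card (e \<inter> ?X w)) \<noteq> odd (card (bd z \<inter> ?X w)))" for w
        using xy by (simp add: Int_sd even_card_sd)
      show ?case
      proof (cases "e \<in> I")
        case True
        then have pxy: "rho x = rho y" using xy by (auto simp: I_def)
        have "push (insert e z) = push z" using gI True by (auto simp: push_def)
        moreover have "even (card (e \<inter> ?X w))" for w
        proof -
          have "e \<inter> ?X w = (if w = rho x then e else {})" using xy pxy xyV by auto
          then show ?thesis using xy by simp
        qed
        ultimately show ?thesis using IH par by auto
      next
        case False
        then obtain e0 where e0: "e0 \<in> E'" "e = g e0" using eH by (auto simp: H_def)
        have pe: "e0 = {rho x, rho y}" using g[OF e0(1)] e0 xy by auto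
        have pn: "rho x \<noteq> rho y" using pe gE' e0 by (metis sgraph_edge_neq)
        have "push (insert e z) = insert e0 (push z)" using e0 ginj by (auto simp: push_def)
        moreover have "e0 \<notin> push z" using insert e0 by (auto simp: push_def)
        moreover have "finite (push z)" using finH by (auto simp: push_def)
        ultimately have 1: "bd (push (insert e z)) = sd e0 (bd (push z))" using bd_insert by metis
        have "odd (card (e \<inter> ?X w)) \<longleftrightarrow> w \<in> e0" for w
        proof -
          have "e \<inter> ?X w = (if w = rho x then {x} else if w = rho y then {y} else {})"
            using xy pn xyV by auto
          then show ?thesis using pe by simp
        qed
        then show ?thesis using 1 IH par by (auto simp: sd_iff)
      qed
    qed
  qed
  have "maclane H" using maclane_subset[OF sgraph_finite[OF assms(1)] assms(2) HE] .
  then obtain Phi where Phi: "Phi \<subseteq> cyc H" "cover2 Phi" "cyc H \<subseteq> zspan Phi"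
    by (auto simp: maclane_def mac_def)
  have finPhi: "finite Phi" using Phi(1) finite_cyc[OF finH(1)] finite_subset by auto
  define Phi' where "Phi' = push ` Phi"
  have 1: "Phi' \<subseteq> cyc E'"
  proof
    fix F assume "F \<in> Phi'"
    then obtain G where G: "F = push G" "G \<in> cyc H" using Phi by (auto simp: Phi'_def)
    then have "bd F = {}" using push_bd[of G] by (auto simp: cyc_def)
    moreover have "F \<subseteq> E'" using G by (auto simp: push_def)
    ultimately show "F \<in> cyc E'" by (simp add: cyc_def)
  qed
  have 2: "cover2 Phi'" unfolding cover2_def
  proof
    fix e
    have "{F \<in> Phi'. e \<in> F} \<subseteq> push ` {F \<in> Phi. g e \<in> F}" by (auto simp: Phi'_def push_def)
    then have "card {F \<in> Phi'. e \<in> F} \<le> card {F \<in> Phi. g e \<in> F}"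
      using finPhi by (intro surj_card_le) auto
    then show "card {F \<in> Phi'. e \<in> F} \<le> 2" using Phi(2) by (auto simp: cover2_def intro: le_trans)
  qed
  have push_zspan: "push z \<in> zspan Phi'" if "z \<in> zspan Phi" for z
    using that
  proof (induction rule: zspan.induct)
    case zspan_empty
    then show ?case by (simp add: push_def zspan.zspan_empty)
  next
    case (zspan_step F z)
    then show ?case by (auto simp: push_sd Phi'_def intro: zspan.zspan_step)
  qed
  have 3: "z \<in> zspan Phi'" if z: "z \<in> cyc E'" for z
  proof -
    define y where "y = g ` z"
    have zE: "z \<subseteq> E'" "bd z = {}" using z by (auto simp: cyc_def)
    have yH: "y \<subseteq> H" using zE by (auto simp: y_def H_def)
    have py: "push y = z" using zE ginj by (auto simp: push_def y_def)
    have "bd y \<subseteq> \<Union>y" by (rule bd_subset)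
    also have "\<dots> \<subseteq> V0" using yH HV by auto
    finally have byV: "bd y \<subseteq> V0" .
    have ev: "even (card (bd y \<inter> {v \<in> V0. rho v = w}))" for w
      using push_bd[OF yH] py zE by auto
    have "\<exists>J\<subseteq>I. bd J = bd y"
      unfolding I_def
      by (rule even_join_in_fibers[OF assms(1) _ finite_bd[OF gH yH] byV ev]) (rule fib)
    then obtain J where J: "J \<subseteq> I" "bd J = bd y" by auto
    have JH: "J \<subseteq> H" using J by (auto simp: H_def)
    have "sd y J \<in> cyc H"
    proof -
      have "finite y" "finite J" using yH JH finH(1) finite_subset by auto
      then have "bd (sd y J) = {}" using J by (simp add: bd_sd)
      moreover have "sd y J \<subseteq> H" using yH JH by (auto simp: sd_def)
      ultimately show ?thesis by (simp add: cyc_def)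
    qed
    then have "push (sd y J) \<in> zspan Phi'" using push_zspan Phi by auto
    moreover have "push (sd y J) = z"
    proof -
      have "push J = {}" using J gI by (auto simp: push_def)
      then show ?thesis using py by (simp add: push_sd)
    qed
    ultimately show ?thesis by simp
  qed
  show ?thesis using 1 2 3 unfolding maclane_def mac_def E'_def by blast
qed

section \<open>Euler's bound and extensions inside a face\<close>

text \<open>A set of even size is determined by its part outside \<open>v\<close>.\<close>

lemma card_even_subsets:
  assumes "finite V" "v \<in> V"
  shows "card {T. T \<subseteq> V \<and> even (card T)} \<le> 2 ^ (card V - 1)"
proof -
  have "inj_on (\<lambda>T. T - {v}) {T. T \<subseteq> V \<and> even (card T)}"
  proof (rule inj_onI)
    fix S T assume ST: "S \<in> {T. T \<subseteq> V \<and> even (card T)}" "T \<in> {T. T \<subseteq> V \<and> even (card T)}"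
      and eq: "S - {v} = T - {v}"
    have fin: "finite S" "finite T" using ST assms finite_subset by auto
    have par: "even (card U) \<longleftrightarrow> (even (card (U - {v})) \<longleftrightarrow> v \<notin> U)" if U: "finite U" for U
    proof (cases "v \<in> U")
      case True
      then have "card U = Suc (card (U - {v}))" using U by (simp only: card_Suc_Diff1)
      then show ?thesis using True by simp
    qed simp
    have "v \<in> S \<longleftrightarrow> v \<in> T" using par[OF fin(1)] par[OF fin(2)] ST eq by auto
    then show "S = T" using eq by blast
  qed
  then have "card {T. T \<subseteq> V \<and> even (card T)} \<le> card (Pow (V - {v}))"
    by (rule card_inj_on_le) (use assms in auto)
  then show ?thesis using assms by (simp add: card_Pow card_Diff_singleton)
qed

lemma even_card_bd:
  assumes "sgraph E" "z \<subseteq> E"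
  shows "even (card (bd z))"
proof -
  have "finite z" using assms by (auto simp: sgraph_def intro: finite_subset)
  then show ?thesis using assms(2)
  proof (induction z rule: finite_induct)
    case (insert e z)
    have "card e = 2" "finite e" using insert assms by (auto simp: sgraph_def intro!: card_ge_0_finite)
    moreover have "finite (bd z)" using finite_bd[OF assms(1)] insert by auto
    ultimately show ?case using insert by (simp add: bd_insert even_card_sd)
  qed simp
qed

text \<open>Rank and nullity in counting form: an edge set is determined by its boundary together
  with its difference from a fixed edge set of the same boundary, and that difference is a
  cycle.\<close>

lemma card_edges_le_cyc:
  assumes "sgraph E" "finite V" "\<Union>E \<subseteq> V" "V \<noteq> {}"
  shows "2 ^ card E \<le> card (cyc E) * 2 ^ (card V - 1)"
proof -
  obtain v where v: "v \<in> V" using assms by auto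
  let ?Ev = "{T. T \<subseteq> V \<and> even (card T)}"
  have fE: "finite E" using assms(1) sgraph_finite by auto
  define r where "r T = (SOME z. z \<subseteq> E \<and> bd z = T)" for T :: "'a set"
  have r: "r (bd z) \<subseteq> E \<and> bd (r (bd z)) = bd z" if "z \<subseteq> E" for z
    unfolding r_def by (rule someI[of _ z]) (use that in auto)
  have "inj_on (\<lambda>z. (sd z (r (bd z)), bd z)) (Pow E)"
    by (rule inj_onI) (metis (no_types, lifting) prod.inject sd_cancel sd_commute)
  moreover have "(\<lambda>z. (sd z (r (bd z)), bd z)) ` Pow E \<subseteq> cyc E \<times> ?Ev"
  proof
    fix p assume "p \<in> (\<lambda>z. (sd z (r (bd z)), bd z)) ` Pow E"
    then obtain z where z: "z \<subseteq> E" "p = (sd z (r (bd z)), bd z)" by auto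
    have "finite z" "finite (r (bd z))" using z r[of z] fE finite_subset by auto
    then have "bd (sd z (r (bd z))) = {}" using r[OF z(1)] by (simp add: bd_sd)
    moreover have "sd z (r (bd z)) \<subseteq> E" using r[OF z(1)] z(1) by (auto simp: sd_def)
    moreover have "bd z \<subseteq> V" using bd_subset[of z] z assms(3) by auto
    ultimately show "p \<in> cyc E \<times> ?Ev" using z even_card_bd[OF assms(1) z(1)] by (auto simp: cyc_def)
  qed
  moreover have "finite (cyc E \<times> ?Ev)" using finite_cyc[OF fE] assms(2) by auto
  ultimately have "card (Pow E) \<le> card (cyc E \<times> ?Ev)" using card_inj_on_le by blast
  also have "\<dots> \<le> card (cyc E) * 2 ^ (card V - 1)"
    using card_even_subsets[OF assms(2) v] by (simp add: card_cartesian_product)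
  finally show ?thesis using fE by (simp add: card_Pow)
qed

lemma card_cyc_le_zspan:
  assumes "finite Phi" "cyc E \<subseteq> zspan Phi"
  shows "card (cyc E) \<le> 2 ^ card Phi"
proof -
  have "cyc E \<subseteq> xsum ` Pow Phi"
  proof
    fix z assume "z \<in> cyc E"
    then have "z \<in> zspan Phi" using assms(2) by auto
    then show "z \<in> xsum ` Pow Phi" by (rule zspan_imp_xsum) auto
  qed
  then have "card (cyc E) \<le> card (Pow Phi)" using assms(1) by (intro surj_card_le) auto
  then show ?thesis using assms(1) by (simp add: card_Pow)
qed

lemma mac_finite:
  assumes "sgraph E" "mac E Phi"
  shows "finite Phi"
proof (rule finite_subset)
  show "Phi \<subseteq> cyc E" using assms by (simp add: mac_def)
  show "finite (cyc E)" using finite_cyc sgraph_finite assms(1) by blast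
qed

lemma card_edges_le_mac:
  assumes "sgraph E" "finite V" "\<Union>E \<subseteq> V" "V \<noteq> {}" "mac E Phi"
  shows "card E + 1 \<le> card Phi + card V"
proof -
  have fPhi: "finite Phi" using mac_finite assms by blast
  have V: "card V > 0" using assms by (simp add: card_gt_0_iff)
  have "(2::nat) ^ card E \<le> card (cyc E) * 2 ^ (card V - 1)"
    using card_edges_le_cyc assms by auto
  also have "\<dots> \<le> 2 ^ card Phi * 2 ^ (card V - 1)"
    using card_cyc_le_zspan[OF fPhi] assms by (simp add: mac_def)
  also have "\<dots> = 2 ^ (card Phi + (card V - 1))" by (simp add: power_add)
  finally have "card E \<le> card Phi + (card V - 1)" by simp
  then show ?thesis using V by simp
qed

lemma card_cyc_ge_3:
  assumes "sgraph E" "F \<in> cyc E" "F \<noteq> {}"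
  shows "card F \<ge> 3"
proof (rule ccontr)
  assume "\<not> ?thesis"
  moreover have fin: "finite F" using assms by (auto simp: cyc_def sgraph_def intro: finite_subset)
  ultimately have "card F = 1 \<or> card F = 2" using assms(3) by (cases "card F") auto
  then consider e where "F = {e}" | e f where "F = {e, f}" "e \<noteq> f"
    by (auto simp: card_1_singleton_iff card_2_iff)
  then show False
  proof cases
    case (1 e)
    then have "e = {}" "e \<in> E" using assms by (auto simp: cyc_def)
    then show False using assms(1) by (auto simp: sgraph_def)
  next
    case (2 e f)
    then have "bd F = sd e f" using bd_insert[of "{f}" e] by simp
    then show False using assms 2 by (auto simp: cyc_def)
  qed
qed

text \<open>A generating set of least size is independent: a member that is a sum of others could be
  dropped, and dropping never increases the cover count.\<close>

lemma mac_basis: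
  assumes "sgraph E" "maclane E"
  obtains Phi where "mac E Phi" "\<And>S. S \<subseteq> Phi \<Longrightarrow> xsum S = {} \<Longrightarrow> S = {}"
proof -
  have "\<exists>Phi. mac E Phi" using assms by (simp add: maclane_def)
  then obtain Phi where Phi: "mac E Phi" and min: "\<And>Psi. mac E Psi \<Longrightarrow> card Phi \<le> card Psi"
    using ex_has_least_nat[of "mac E" _ card] by metis
  have fPhi: "finite Phi" using mac_finite assms(1) Phi by blast
  have indep: "S = {}" if S: "S \<subseteq> Phi" "xsum S = {}" for S
  proof (rule ccontr)
    assume "S \<noteq> {}"
    then obtain F where F: "F \<in> S" by auto
    have fS: "finite S" using S fPhi finite_subset by auto
    have "xsum (insert F (S - {F})) = sd F (xsum (S - {F}))" using fS by (intro xsum_insert) auto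
    then have "F = xsum (S - {F})" using S F by (metis insert_Diff sd_eq_empty_iff)
    also have "\<dots> \<in> zspan (Phi - {F})" using S fS by (intro xsum_in_zspan) auto
    finally have "F \<in> zspan (Phi - {F})" .
    then have "G \<in> zspan (Phi - {F})" if "G \<in> Phi" for G
      using zspan_base[of G "Phi - {F}"] that by (cases "G = F") auto
    then have "Phi \<subseteq> zspan (Phi - {F})" ..
    then have "cyc E \<subseteq> zspan (Phi - {F})" using Phi zspan_trans[of _ Phi] unfolding mac_def by blast
    moreover have "cover2 (Phi - {F})" using Phi cover2_mono[of Phi "Phi - {F}"] fPhi by (simp add: mac_def)
    moreover have "Phi - {F} \<subseteq> cyc E" using Phi by (auto simp: mac_def)
    ultimately have "mac E (Phi - {F})" by (simp add: mac_def)
    then have "card Phi \<le> card (Phi - {F})" by (rule min)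
    moreover have "card (Phi - {F}) < card Phi" using fPhi F S by (intro card_Diff1_less) auto
    ultimately show False by simp
  qed
  show ?thesis using that[OF Phi indep] .
qed

lemma sum_card_faces:
  assumes "finite E" "finite Phi" "\<And>F. F \<in> Phi \<Longrightarrow> F \<subseteq> E"
  shows "(\<Sum>F\<in>Phi. card F) = (\<Sum>e\<in>E. card {F \<in> Phi. e \<in> F})"
proof -
  have "(\<Sum>F\<in>Phi. card F) = (\<Sum>F\<in>Phi. card {e \<in> E. e \<in> F})"
    using assms(3) by (intro sum.cong refl arg_cong[where f = card]) auto
  also have "\<dots> = (\<Sum>F\<in>Phi. \<Sum>e\<in>E. of_bool (e \<in> F))"
    using assms by (simp add: Int_def)
  also have "\<dots> = (\<Sum>e\<in>E. \<Sum>F\<in>Phi. of_bool (e \<in> F))" by (rule sum.swap)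
  also have "\<dots> = (\<Sum>e\<in>E. card {F \<in> Phi. e \<in> F})" using assms by (simp add: Int_def)
  finally show ?thesis .
qed

text \<open>The sum of all basis elements plays the outer face. Independence makes it nonzero, and
  it contains exactly the edges covered once. So the \<open>card Phi + 1\<close> cycles, each with
  at least 3 edges, have at most \<open>2 * card E\<close> edges in total.\<close>

theorem euler_bound:
  assumes "sgraph E" "finite V" "\<Union>E \<subseteq> V" "3 \<le> card V" "maclane E"
  shows "card E + 6 \<le> 3 * card V"
proof -
  obtain Phi where Phi: "mac E Phi" and indep: "\<And>S. S \<subseteq> Phi \<Longrightarrow> xsum S = {} \<Longrightarrow> S = {}"
    using mac_basis assms by blast
  have fE: "finite E" using assms(1) sgraph_finite by auto
  have fPhi: "finite Phi" using mac_finite assms(1) Phi by blast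
  have k: "card E + 1 \<le> card Phi + card V" using card_edges_le_mac[OF assms(1-3) _ Phi] assms(4) by fastforce
  show ?thesis
  proof (cases "Phi = {}")
    \<comment> \<open>With no generators the graph is a forest, and the claim follows from
      \<open>3 \<le> card V\<close>.\<close>
    case True
    then show ?thesis using k assms by simp
  next
    case False
    have sub: "F \<subseteq> E" "F \<noteq> {}" "F \<in> cyc E" if "F \<in> Phi" for F
      using that Phi indep[of "{F}"] by (auto simp: mac_def cyc_def)
    have O: "xsum Phi \<in> cyc E"
      using zspan_cyc[OF xsum_in_zspan[OF fPhi] fE] Phi by (auto simp: mac_def)
    have Oc: "xsum Phi = {e \<in> E. odd (card {F \<in> Phi. e \<in> F})}"
      using O by (auto simp: xsum_def cyc_def)
    have "3 * card Phi + 3 \<le> (\<Sum>F\<in>Phi. card F) + card (xsum Phi)"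
    proof (rule add_mono)
      show "3 * card Phi \<le> (\<Sum>F\<in>Phi. card F)"
        using sum_bounded_below[of Phi 3 card] card_cyc_ge_3[OF assms(1)] sub by (simp add: mult.commute)
      show "3 \<le> card (xsum Phi)"
        using card_cyc_ge_3[OF assms(1) O] indep[of Phi] False by auto
    qed
    also have "\<dots> = (\<Sum>e\<in>E. card {F \<in> Phi. e \<in> F} + of_bool (odd (card {F \<in> Phi. e \<in> F})))"
      unfolding Oc using sum_card_faces[OF fE fPhi sub(1)] fE by (simp add: sum.distrib Int_def)
    also have "\<dots> \<le> (\<Sum>e\<in>E. 2)"
    proof (rule sum_mono)
      fix e
      have "card {F \<in> Phi. e \<in> F} \<le> 2" using Phi by (auto simp: mac_def cover2_def)
      then show "card {F \<in> Phi. e \<in> F} + of_bool (odd (card {F \<in> Phi. e \<in> F})) \<le> 2"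
        by (cases "card {F \<in> Phi. e \<in> F} = 2") auto
    qed
    also have "\<dots> = 2 * card E" by simp
    finally show ?thesis using k assms by linarith
  qed
qed

text \<open>Adding the sum of all basis elements, the outer face, puts all faces on an equal
  footing: the full sum vanishes, and this is the only dependency. The edge count gives at least two
  basis elements; with a single one the outer face would coincide with it.\<close>

lemma mac_double_basis:
  assumes "sgraph E" "maclane E" "finite V" "\<Union>E \<subseteq> V" "V \<noteq> {}" "card V < card E"
  obtains Psi where "mac E Psi" "xsum Psi = {}" "{} \<notin> Psi"
    "\<And>S. S \<subseteq> Psi \<Longrightarrow> xsum S = {} \<Longrightarrow> S = {} \<or> S = Psi"
proof -
  obtain Phi where Phi: "mac E Phi" and indep: "\<And>S. S \<subseteq> Phi \<Longrightarrow> xsum S = {} \<Longrightarrow> S = {}"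
    using mac_basis assms by blast
  have fE: "finite E" using assms(1) sgraph_finite by auto
  have fPhi: "finite Phi" using mac_finite assms(1) Phi by blast
  have k: "card Phi \<ge> 2" using card_edges_le_mac[OF assms(1,3-5) Phi] assms by auto
  define F0 where "F0 = xsum Phi"
  have F0n: "F0 \<notin> Phi"
  proof
    assume F0: "F0 \<in> Phi"
    have "xsum (insert F0 (Phi - {F0})) = sd F0 (xsum (Phi - {F0}))" using fPhi by (intro xsum_insert) auto
    then have "F0 = sd F0 (xsum (Phi - {F0}))" using F0 by (metis insert_Diff F0_def)
    then have "xsum (Phi - {F0}) = {}" by (metis sd_cancel sd_empty(3))
    then have "Phi - {F0} = {}" using indep[of "Phi - {F0}"] by blast
    then have "Phi = {F0}" using F0 by auto
    then show False using k by simp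
  qed
  define Psi where "Psi = insert F0 Phi"
  have fPsi: "finite Psi" using fPhi by (simp add: Psi_def)
  have xs: "xsum Psi = {}" unfolding Psi_def using xsum_insert[OF fPhi F0n] by (simp add: F0_def)
  have "F0 \<in> cyc E"
    unfolding F0_def using zspan_cyc[OF xsum_in_zspan[OF fPhi] fE] Phi by (auto simp: mac_def)
  then have 1: "Psi \<subseteq> cyc E" using Phi by (auto simp: Psi_def mac_def)
  have 2: "cover2 Psi" unfolding cover2_def
  proof
    fix e
    have "e \<in> F0 \<longleftrightarrow> odd (card {F \<in> Phi. e \<in> F})" by (simp add: F0_def xsum_def)
    moreover have "card {F \<in> Phi. e \<in> F} \<le> 2" using Phi by (auto simp: mac_def cover2_def)
    moreover have "{F \<in> Psi. e \<in> F} = (if e \<in> F0 then insert F0 {F \<in> Phi. e \<in> F} else {F \<in> Phi. e \<in> F})"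
      by (auto simp: Psi_def)
    ultimately show "card {F \<in> Psi. e \<in> F} \<le> 2"
      using F0n fPhi by (cases "card {F \<in> Phi. e \<in> F} = 2") auto
  qed
  have 3: "cyc E \<subseteq> zspan Psi" using Phi zspan_mono[of Phi Psi] by (auto simp: mac_def Psi_def)
  have 4: "S = {} \<or> S = Psi" if S: "S \<subseteq> Psi" "xsum S = {}" for S
  proof (cases "F0 \<in> S")
    case False
    then show ?thesis using indep[of S] S by (auto simp: Psi_def)
  next
    case True
    have "xsum (sd S Psi) = {}" using S xs fPsi xsum_sd[of S Psi] finite_subset[OF S(1) fPsi] by auto
    moreover have "sd S Psi \<subseteq> Phi" using True S by (auto simp: sd_def Psi_def)
    ultimately have "sd S Psi = {}" using indep[of "sd S Psi"] by blast
    then show ?thesis by simp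
  qed
  have 5: "{} \<notin> Psi"
  proof
    assume "{} \<in> Psi"
    then have "{{}} = ({} :: 'a set set set) \<or> {{}} = Psi" using 4[of "{{}}"] by simp
    then have "Psi = {{}}" by auto
    then have "card Phi \<le> 1" using fPsi card_mono[of "{{}}" Phi] by (auto simp: Psi_def)
    then show False using k by simp
  qed
  show ?thesis using that[of Psi] 1 2 3 4 5 xs by (auto simp: mac_def)
qed

text \<open>In a simple graph these are the simple closed paths, described as minimal nonzero cycle
  vectors; minimality replaces any ordering of the vertices.\<close>

definition circuit :: "'v set set \<Rightarrow> bool" where
  "circuit F \<longleftrightarrow> F \<noteq> {} \<and> bd F = {} \<and> (\<forall>z\<subseteq>F. bd z = {} \<longrightarrow> z = {} \<or> z = F)"

text \<open>No edge leaves the set of vertices that can be joined to \<open>x\<close>, so the edges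
  within it have zero boundary; minimality makes them all of \<open>F\<close>.\<close>

lemma circuit_join:
  assumes "circuit F" "sgraph F" "x \<in> \<Union>F" "y \<in> \<Union>F"
  obtains R where "R \<subseteq> F" "bd R = sd {x} {y}"
proof -
  have fF: "finite F" using assms(2) sgraph_finite by auto
  define X where "X = {v. \<exists>R\<subseteq>F. bd R = sd {x} {v}}"
  have xX: "x \<in> X" by (auto simp: X_def intro!: exI[of _ "{}"])
  have closed: "e \<subseteq> X" if e: "e \<in> F" "e \<inter> X \<noteq> {}" for e
  proof -
    obtain p q where pq: "e = {p, q}" "p \<noteq> q" using sgraph_edge[OF assms(2) e(1)] by auto
    obtain a b where ab: "e = {a, b}" "a \<in> X" "a \<noteq> b"
    proof (cases "p \<in> X")
      case True
      then show ?thesis using that[of p q] pq by simp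
    next
      case False
      then show ?thesis using that[of q p] pq e(2) by auto
    qed
    then obtain R where R: "R \<subseteq> F" "bd R = sd {x} {a}" by (auto simp: X_def)
    have "finite R" using finite_subset[OF R(1) fF] .
    then have "bd (sd R {e}) = sd {x} {b}" using R ab by (auto simp: bd_sd sd_iff)
    moreover have "sd R {e} \<subseteq> F" using R e by (auto simp: sd_def)
    ultimately show ?thesis using ab by (auto simp: X_def)
  qed
  define K where "K = {e \<in> F. e \<subseteq> X}"
  have "bd K = {}"
  proof -
    have "{e \<in> K. v \<in> e} = (if v \<in> X then {e \<in> F. v \<in> e} else {})" for v
      using closed by (auto simp: K_def)
    moreover have "even (card {e \<in> F. v \<in> e})" for v
      using assms(1) by (auto simp: circuit_def bd_def)
    ultimately show ?thesis by (simp add: bd_def)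
  qed
  moreover obtain e where "e \<in> F" "x \<in> e" using assms by auto
  then have "e \<in> K" using closed[of e] xX by (auto simp: K_def)
  then have "K \<noteq> {}" by auto
  moreover have "K \<subseteq> F" by (auto simp: K_def)
  ultimately have "K = F" using assms(1) unfolding circuit_def by blast
  then have "y \<in> X" using assms(4) by (auto simp: K_def)
  with that show ?thesis by (auto simp: X_def)
qed

lemma circuit_subset_join:
  assumes "circuit F" "finite F" "R \<subseteq> F" "z \<subseteq> R" "R \<noteq> F" "bd z = {}"
  shows "z = {}"
proof -
  have "z = {} \<or> z = F" using assms unfolding circuit_def by (meson subset_trans)
  then show ?thesis using assms by auto
qed

text \<open>\<open>D\<close> is a new edge or path, used by a cycle wholly or not at all. A cycle
  containing \<open>D\<close> becomes, after adding \<open>R \<union> D\<close>, a cycle inside the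
  proper part \<open>R\<close>, hence empty.\<close>

lemma circuit_add_path:
  assumes "circuit F" "finite F" "R \<subseteq> F" "bd R = bd D" "bd D \<noteq> {}" "D \<inter> F = {}" "finite D"
    and D: "\<And>z. z \<subseteq> F \<union> D \<Longrightarrow> bd z = {} \<Longrightarrow> z \<inter> D = {} \<or> z \<inter> D = D"
  shows "circuit (R \<union> D)"
  unfolding circuit_def
proof (intro conjI allI impI)
  have RF: "R \<noteq> F" using assms by (auto simp: circuit_def)
  have "R \<noteq> {}" using assms by auto
  then show "R \<union> D \<noteq> {}" by auto
  have fR: "finite R" "R \<inter> D = {}" using finite_subset[OF assms(3,2)] assms(3,6) by auto
  show bdRD: "bd (R \<union> D) = {}" using bd_Un_disjoint[OF fR(1) assms(7) fR(2)] assms(4) by simp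
  fix z assume z: "z \<subseteq> R \<union> D" "bd z = {}"
  consider "z \<inter> D = {}" | "D \<subseteq> z" using D[of z] z assms(3) by auto
  then show "z = {} \<or> z = R \<union> D"
  proof cases
    case 1
    then have "z \<subseteq> R" using z by auto
    then show ?thesis using circuit_subset_join[OF assms(1-3) _ RF] z by auto
  next
    case 2
    have "finite z" using finite_subset[OF z(1)] fR assms(7) by auto
    then have "bd (sd z (R \<union> D)) = {}" using bdRD z fR assms(7) by (simp add: bd_sd)
    moreover have "sd z (R \<union> D) \<subseteq> R" using z 2 by (auto simp: sd_def)
    ultimately have "sd z (R \<union> D) = {}" using circuit_subset_join[OF assms(1-3) _ RF] by blast
    then show ?thesis by simp
  qed
qed

text \<open>The face \<open>F\<close> is cut along \<open>D\<close> into two halves with sum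
  \<open>F\<close>, so nothing generated before is lost, and a cycle through \<open>D\<close>
  differs from one half by a cycle of the old graph. Old edges keep their cover count, and new edges
  lie in just the two halves.\<close>

lemma mac_add_path:
  assumes "sgraph E" "finite D" "D \<noteq> {}" "D \<inter> E = {}" "mac E Phi" "F \<in> Phi" "R \<subseteq> F" "bd R = bd D"
    and D: "\<And>z. z \<subseteq> E \<union> D \<Longrightarrow> bd z = {} \<Longrightarrow> z \<inter> D = {} \<or> z \<inter> D = D"
  shows "mac (E \<union> D) (Phi - {F} \<union> {R \<union> D, (F - R) \<union> D})" (is "mac _ ?Psi")
proof -
  have fE: "finite E" using assms(1) sgraph_finite by auto
  have fPhi: "finite Phi" using mac_finite assms(1,5) by blast
  have F: "F \<subseteq> E" "bd F = {}" and sub: "\<And>H. H \<in> Phi \<Longrightarrow> H \<subseteq> E"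
    using assms(5,6) by (auto simp: mac_def cyc_def)
  have fin: "finite F" "finite R"
    using finite_subset[OF F(1) fE] finite_subset[OF assms(7)] by auto
  define A where "A = R \<union> D"
  define B where "B = (F - R) \<union> D"
  have bdA: "bd A = {}" unfolding A_def
    using bd_Un_disjoint[OF fin(2) assms(2)] assms(4,7,8) F by (simp add: disjoint_iff subset_iff) blast
  have bdB: "bd B = {}" unfolding B_def
  proof -
    have "(F - R) \<inter> D = {}" using assms(4) F by auto
    then show "bd (F - R \<union> D) = {}"
      using bd_Un_disjoint[of "F - R" D] bd_Diff[OF fin(1) assms(7)] fin assms(2,8) F by simp
  qed
  have AB: "A \<in> cyc (E \<union> D)" "B \<in> cyc (E \<union> D)"
    using bdA bdB F assms(7) by (auto simp: cyc_def A_def B_def)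
  have FAB: "F = sd A B" using assms F by (auto simp: A_def B_def sd_def)
  have 1: "?Psi \<subseteq> cyc (E \<union> D)"
    using AB assms(5) cyc_mono[of E "E \<union> D"] by (auto simp: A_def B_def mac_def)
  have 2: "cover2 ?Psi"
  proof (rule cover2_replace)
    show "e \<notin> H" if "e \<in> R \<union> D" "e \<in> F - R \<union> D" "H \<in> Phi" for e H
      using that sub[of H] assms(4) by auto
    show "e \<in> F \<or> (\<forall>H\<in>Phi. e \<notin> H)" if "e \<in> R \<union> D \<union> (F - R \<union> D)" for e
      using that sub assms(4,7) by blast
  qed (use assms fPhi in \<open>auto simp: mac_def\<close>)
  have AP: "A \<in> zspan ?Psi" "B \<in> zspan ?Psi" by (auto simp: A_def B_def intro!: zspan_base)
  have "Phi \<subseteq> zspan ?Psi"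
  proof
    fix H assume "H \<in> Phi"
    then show "H \<in> zspan ?Psi"
      using AP zspan_sd FAB zspan_base[of H ?Psi] by (cases "H = F") auto
  qed
  then have sp: "cyc E \<subseteq> zspan ?Psi" using assms(5) zspan_trans[of _ Phi ?Psi] unfolding mac_def by blast
  have 3: "z \<in> zspan ?Psi" if z: "z \<in> cyc (E \<union> D)" for z
  proof -
    consider "z \<inter> D = {}" | "D \<subseteq> z" using D[of z] z by (auto simp: cyc_def)
    then show ?thesis
    proof cases
      case 1
      then have "z \<in> cyc E" using z by (auto simp: cyc_def)
      then show ?thesis using sp by auto
    next
      case 2
      have "sd A z \<in> cyc (E \<union> D)" using cyc_sd[of "E \<union> D"] fE assms(2) AB z by auto
      moreover have "sd A z \<inter> D = {}" using 2 by (auto simp: A_def sd_def)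
      ultimately have "sd A z \<in> cyc E" by (auto simp: cyc_def)
      then have "sd A (sd A z) \<in> zspan ?Psi" using sp zspan_sd AP by blast
      then show ?thesis by simp
    qed
  qed
  show ?thesis using 1 2 3 by (auto simp: mac_def)
qed

lemma circuit_iff_mac:
  "F \<in> Phi \<Longrightarrow> mac E Phi \<Longrightarrow> F \<subseteq> E \<and> bd F = {}"
  by (auto simp: mac_def cyc_def)

lemma mac_add_edge:
  assumes "sgraph E" "mac E Phi" "F \<in> Phi" "circuit F" "a \<in> \<Union>F" "b \<in> \<Union>F" "a \<noteq> b" "{a, b} \<notin> E"
  obtains A B where "mac (insert {a, b} E) (Phi - {F} \<union> {A, B})" "circuit A" "circuit B"
    "a \<in> \<Union>A" "a \<in> \<Union>B" "b \<in> \<Union>A" "b \<in> \<Union>B" "\<Union>F \<subseteq> \<Union>A \<union> \<Union>B"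
proof -
  have F: "F \<subseteq> E" "bd F = {}" using circuit_iff_mac[OF assms(3,2)] by auto
  have gF: "sgraph F" using sgraph_subset[OF assms(1) F(1)] .
  have fF: "finite F" using sgraph_finite[OF gF] .
  obtain R where R: "R \<subseteq> F" "bd R = sd {a} {b}" using circuit_join[OF assms(4) gF assms(5,6)] .
  let ?D = "{{a, b}}"
  have bdD: "bd ?D = sd {a} {b}" using assms(7) by (auto simp: sd_iff)
  have D: "z \<inter> ?D = {} \<or> z \<inter> ?D = ?D" for z by auto
  have m: "mac (E \<union> ?D) (Phi - {F} \<union> {R \<union> ?D, (F - R) \<union> ?D})"
    by (rule mac_add_path) (use assms R bdD in auto)
  have 1: "circuit (R \<union> ?D)"
    by (rule circuit_add_path[OF assms(4) fF R(1)]) (use R bdD assms F in auto)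
  have 2: "circuit ((F - R) \<union> ?D)"
  proof (rule circuit_add_path[OF assms(4) fF])
    show "bd (F - R) = bd ?D" using bd_Diff[OF fF R(1)] R F bdD by simp
  qed (use assms F in auto)
  show ?thesis using that[of "R \<union> ?D" "(F - R) \<union> ?D"] m 1 2 by auto
qed

lemma mac_add_vertex:
  assumes "sgraph E" "mac E Phi" "F \<in> Phi" "circuit F" "a \<in> \<Union>F" "b \<in> \<Union>F" "a \<noteq> b" "x \<notin> \<Union>E" "x \<noteq> a" "x \<noteq> b"
  obtains A B where "mac (E \<union> {{a, x}, {x, b}}) (Phi - {F} \<union> {A, B})" "circuit A" "circuit B"
    "x \<in> \<Union>A" "x \<in> \<Union>B" "\<Union>F \<subseteq> \<Union>A \<union> \<Union>B"
proof -
  have F: "F \<subseteq> E" "bd F = {}" using circuit_iff_mac[OF assms(3,2)] by auto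
  have gF: "sgraph F" using sgraph_subset[OF assms(1) F(1)] .
  have fF: "finite F" using sgraph_finite[OF gF] .
  obtain R where R: "R \<subseteq> F" "bd R = sd {a} {b}" using circuit_join[OF assms(4) gF assms(5,6)] .
  let ?D = "{{a, x}, {x, b}}"
  have ne: "{a, x} \<noteq> {x, b}" using assms(7) by (auto simp: doubleton_eq_iff)
  have bdD: "bd ?D = sd {a} {b}"
    using bd_insert[of "{{x, b}}" "{a, x}"] ne assms(7-10) by (auto simp: sd_iff)
  \<comment> \<open>The new vertex \<open>x\<close> has degree two, and a cycle uses an even number
    of the edges at \<open>x\<close>.\<close>
  have D: "z \<inter> ?D = {} \<or> z \<inter> ?D = ?D" if z: "z \<subseteq> E \<union> ?D" "bd z = {}" for z
  proof -
    have "{e \<in> z. x \<in> e} = z \<inter> ?D" using z assms(8) by auto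
    moreover have "even (card {e \<in> z. x \<in> e})" using z(2) by (auto simp: bd_def)
    ultimately have ev: "even (card (z \<inter> ?D))" by simp
    show ?thesis
    proof (rule ccontr)
      assume "\<not> ?thesis"
      then have "z \<inter> ?D = {{a, x}} \<or> z \<inter> ?D = {{x, b}}" by blast
      then show False using ev by auto
    qed
  qed
  have DF: "?D \<inter> E = {}" using assms(8) by auto
  have m: "mac (E \<union> ?D) (Phi - {F} \<union> {R \<union> ?D, (F - R) \<union> ?D})"
    by (rule mac_add_path[OF assms(1) _ _ DF assms(2,3) R(1) _ D]) (use R bdD in auto)
  have DF': "?D \<inter> F = {}" using DF F by auto
  have D': "z \<inter> ?D = {} \<or> z \<inter> ?D = ?D" if "z \<subseteq> F \<union> ?D" "bd z = {}" for z
    using D[of z] that F by blast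
  have n0: "bd ?D \<noteq> {}" using bdD assms(7) by auto
  have 1: "circuit (R \<union> ?D)"
    by (rule circuit_add_path[OF assms(4) fF R(1) _ n0 DF' _ D']) (use R bdD in auto)
  have 2: "circuit ((F - R) \<union> ?D)"
  proof (rule circuit_add_path[OF assms(4) fF _ _ n0 DF' _ D'])
    show "bd (F - R) = bd ?D" using bd_Diff[OF fF R(1)] R F bdD by simp
  qed auto
  show ?thesis using that[of "R \<union> ?D" "(F - R) \<union> ?D"] m 1 2 by auto
qed

text \<open>Four mutually adjacent vertices on a common face would allow a fifth one to be placed
  inside that face, contradicting the nonplanarity of the complete graph on five vertices.\<close>

lemma no_clique4_on_face:
  fixes a :: "'v"
  assumes "infinite (UNIV :: 'v set)" "sgraph E" "mac E Phi" "F \<in> Phi" "circuit F"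
    and abcd: "a \<in> \<Union>F" "b \<in> \<Union>F" "c \<in> \<Union>F" "d \<in> \<Union>F" "distinct [a, b, c, d]"
    and K: "{a, b} \<in> E" "{a, c} \<in> E" "{a, d} \<in> E" "{b, c} \<in> E" "{b, d} \<in> E" "{c, d} \<in> E"
  shows False
proof -
  have "finite e" if "e \<in> E" for e using that assms(2) by (auto simp: sgraph_def intro!: card_ge_0_finite)
  then have "finite (\<Union>E)" using sgraph_finite[OF assms(2)] by auto
  then obtain x where x: "x \<notin> \<Union>E" using assms(1) ex_new_if_finite by blast
  have F: "\<Union>F \<subseteq> \<Union>E" using circuit_iff_mac assms(3,4) by blast
  have xn: "x \<noteq> a" "x \<noteq> b" "x \<noteq> c" "x \<noteq> d" using x F abcd by auto
  have dis: "a \<noteq> b" "a \<noteq> c" "a \<noteq> d" "b \<noteq> c" "b \<noteq> d" "c \<noteq> d" using abcd(5) by auto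
  define E1 where "E1 = E \<union> {{a, x}, {x, b}}"
  obtain A B where AB: "mac E1 (Phi - {F} \<union> {A, B})" "circuit A" "circuit B"
    "x \<in> \<Union>A" "x \<in> \<Union>B" "\<Union>F \<subseteq> \<Union>A \<union> \<Union>B"
    unfolding E1_def by (rule mac_add_vertex[OF assms(2-5) abcd(1,2) dis(1) x xn(1,2)])
  define Phi1 where "Phi1 = Phi - {F} \<union> {A, B}"
  have g1: "sgraph E1" using assms(2) xn by (auto simp: E1_def sgraph_def)
  \<comment> \<open>Both halves of the split face contain \<open>x\<close>, so every boundary vertex
    still shares a face with \<open>x\<close> and the next edge can be inserted.\<close>
  have f1: "\<exists>G\<in>Phi1. circuit G \<and> x \<in> \<Union>G \<and> v \<in> \<Union>G" if "v \<in> \<Union>F" for v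
  proof -
    have "v \<in> \<Union>A \<or> v \<in> \<Union>B" using AB(6) \<open>v \<in> \<Union>F\<close> by blast
    then show ?thesis using AB(2-5) unfolding Phi1_def by fast
  qed
  obtain G where G: "G \<in> Phi1" "circuit G" "x \<in> \<Union>G" "c \<in> \<Union>G" using f1[OF abcd(3)] by auto
  have n1: "{x, c} \<notin> E1" using x xn dis by (auto simp: E1_def doubleton_eq_iff)
  define E2 where "E2 = insert {x, c} E1"
  obtain A' B' where AB': "mac E2 (Phi1 - {G} \<union> {A', B'})" "circuit A'" "circuit B'"
    "x \<in> \<Union>A'" "x \<in> \<Union>B'" "\<Union>G \<subseteq> \<Union>A' \<union> \<Union>B'"
    unfolding E2_def
    by (rule mac_add_edge[OF g1 _ G(1,2,3,4) xn(3) n1]) (use AB Phi1_def in auto)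
  define Phi2 where "Phi2 = Phi1 - {G} \<union> {A', B'}"
  have g2: "sgraph E2" using g1 xn by (auto simp: E2_def sgraph_def)
  have f2: "\<exists>G\<in>Phi2. circuit G \<and> x \<in> \<Union>G \<and> v \<in> \<Union>G" if "v \<in> \<Union>F" for v
  proof -
    obtain H where H: "H \<in> Phi1" "circuit H" "x \<in> \<Union>H" "v \<in> \<Union>H"
      using f1[OF \<open>v \<in> \<Union>F\<close>] by auto
    show ?thesis
    proof (cases "H = G")
      case True
      then have "v \<in> \<Union>A' \<or> v \<in> \<Union>B'" using H AB' by blast
      then show ?thesis using AB'(2-5) unfolding Phi2_def by fast
    next
      case False
      then show ?thesis using H unfolding Phi2_def by fast
    qed
  qed
  obtain H where H: "H \<in> Phi2" "circuit H" "x \<in> \<Union>H" "d \<in> \<Union>H" using f2[OF abcd(4)] by auto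
  have n2: "{x, d} \<notin> E2" using x xn dis by (auto simp: E1_def E2_def doubleton_eq_iff)
  define E3 where "E3 = insert {x, d} E2"
  obtain A'' B'' where "mac E3 (Phi2 - {H} \<union> {A'', B''})"
    unfolding E3_def
    by (rule mac_add_edge[OF g2 _ H(1,2,3,4) xn(4) n2]) (use AB' Phi2_def in auto)
  then have m3: "maclane E3" by (auto simp: maclane_def)
  have g3: "sgraph E3" using g2 xn by (auto simp: E3_def sgraph_def)
  let ?K = "{{a, b}, {a, c}, {a, d}, {b, c}, {b, d}, {c, d}, {a, x}, {b, x}, {c, x}, {d, x}}"
  have "?K \<subseteq> E3" using K by (auto simp: E1_def E2_def E3_def insert_commute)
  then have mK: "maclane ?K" "sgraph ?K"
    using maclane_subset[OF sgraph_finite[OF g3] m3] sgraph_subset[OF g3] by auto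
  \<comment> \<open>Ten edges on five vertices violate Euler's bound, as 10 + 6 > 15.\<close>
  have "card ?K = 10" using dis xn by (simp add: doubleton_eq_iff)
  moreover have c5: "card {a, b, c, d, x} = 5" using dis xn by auto
  have "card ?K + 6 \<le> 3 * card {a, b, c, d, x}"
    using mK c5 by (intro euler_bound) auto
  ultimately show False using c5 by simp
qed

section \<open>Circuits and paths\<close>

text \<open>A path together with its edge set \<open>P\<close> and vertex set \<open>S\<close>. It
  has at least one edge and distinct ends, as arcs do.\<close>

inductive gpath :: "'v set set \<Rightarrow> 'v \<Rightarrow> 'v \<Rightarrow> 'v set set \<Rightarrow> 'v set \<Rightarrow> bool" for E where
  gpath_edge: "{a, b} \<in> E \<Longrightarrow> a \<noteq> b \<Longrightarrow> gpath E a b {{a, b}} {a, b}"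
| gpath_step: "{a, b} \<in> E \<Longrightarrow> a \<notin> S \<Longrightarrow> gpath E b c P S \<Longrightarrow> gpath E a c (insert {a, b} P) (insert a S)"

lemma gpath_facts:
  "gpath E a b P S \<Longrightarrow> a \<in> S \<and> b \<in> S \<and> a \<noteq> b \<and> P \<subseteq> E \<and> finite P \<and> S = \<Union>P \<and> P \<noteq> {}"
  by (induction rule: gpath.induct) auto

lemma gpath_bd: "gpath E a b P S \<Longrightarrow> bd P = {a, b}"
proof (induction rule: gpath.induct)
  case (gpath_step a b S c P)
  note f = gpath_facts[OF gpath_step(3)]
  have "{a, b} \<notin> P" using f gpath_step by auto
  then have "bd (insert {a, b} P) = sd {a, b} {b, c}" using f gpath_step bd_insert by metis
  moreover have "a \<noteq> b" "a \<noteq> c" using f gpath_step by auto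
  ultimately show ?case using f by (auto simp: sd_iff)
qed auto

lemma gpath_mono: "gpath E a b P S \<Longrightarrow> E \<subseteq> E' \<Longrightarrow> gpath E' a b P S"
  by (induction rule: gpath.induct) (auto intro: gpath.intros)

text \<open>Induction along the path: a subset containing the first edge must go on, since otherwise
  an inner vertex would be in its boundary. This is the counterpart for paths of the minimality of
  circuits.\<close>

lemma gpath_subset_eq:
  assumes "gpath E a b P S" "z \<subseteq> P" "bd z \<subseteq> {a, b}"
  shows "z = {} \<or> z = P"
  using assms
proof (induction arbitrary: z rule: gpath.induct)
  case (gpath_edge a b)
  then show ?case by auto
next
  case (gpath_step a b S c P)
  note f = gpath_facts[OF gpath_step(3)]
  have nP: "{a, b} \<notin> P" and ne: "a \<noteq> b" "a \<noteq> c" "b \<noteq> c" using f gpath_step by auto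
  have fz: "finite z" using gpath_step(5) f finite_subset by auto
  show ?case
  proof (cases "{a, b} \<in> z")
    case True
    define y where "y = z - {{a, b}}"
    have yP: "y \<subseteq> P" using gpath_step(5) by (auto simp: y_def)
    have "bd z = sd {a, b} (bd y)"
      using bd_insert[of y "{a, b}"] fz True by (simp add: y_def insert_absorb)
    then have eq: "bd y = sd {a, b} (bd z)" by simp
    have "a \<notin> bd y" using bd_subset[of y] yP f gpath_step by auto
    then have "bd y \<subseteq> {b, c}" using eq gpath_step(6) by (auto simp: sd_iff)
    then have "y = {} \<or> y = P" using gpath_step(4) yP by blast
    then show ?thesis
    proof
      assume "y = {}"
      then have "b \<in> bd z" using eq by (auto simp: sd_iff)
      then show ?thesis using gpath_step(6) ne by auto
    next
      assume "y = P"
      then show ?thesis using True by (auto simp: y_def)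
    qed
  next
    case False
    then have zP: "z \<subseteq> P" using gpath_step(5) by auto
    have "a \<notin> bd z" using bd_subset[of z] zP f gpath_step by auto
    then have bz: "bd z \<subseteq> {c}" using gpath_step(6) by auto
    then have "z = {} \<or> z = P" using gpath_step(4) zP by blast
    moreover have "b \<in> bd P" using gpath_bd[OF gpath_step(3)] by auto
    ultimately show ?thesis using bz ne by auto
  qed
qed

lemma gpath_split:
  assumes "gpath E a b P S" "v \<in> S" "v \<noteq> a" "v \<noteq> b"
  shows "\<exists>P1 P2 S1 S2. gpath E a v P1 S1 \<and> gpath E v b P2 S2 \<and> P = P1 \<union> P2 \<and> P1 \<inter> P2 = {}"
  using assms
proof (induction rule: gpath.induct)
  case (gpath_edge a b)
  then show ?case by auto
next
  case (gpath_step a b S c P)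
  note f = gpath_facts[OF gpath_step(3)]
  have nP: "{a, b} \<notin> P" and ab: "a \<noteq> b" using f gpath_step by auto
  show ?case
  proof (cases "v = b")
    case True
    have "gpath E a v {{a, b}} {a, b}" using gpath_step ab True by (auto intro: gpath.intros)
    then show ?thesis using gpath_step(3) True nP by (metis Int_insert_left inf_bot_left insert_is_Un)
  next
    case False
    then obtain P1 P2 S1 S2 where *: "gpath E b v P1 S1" "gpath E v c P2 S2" "P = P1 \<union> P2" "P1 \<inter> P2 = {}"
      using gpath_step by blast
    have "a \<notin> S1" using gpath_facts[OF *(1)] f * gpath_step(2) by auto
    then have "gpath E a v (insert {a, b} P1) (insert a S1)"
      using gpath_step(1) * by (auto intro: gpath.intros)
    then show ?thesis using * nP by (metis Int_insert_left Un_insert_left UnCI)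
  qed
qed

text \<open>A walk is straightened from its end backwards: if the new first vertex already lies on
  the path, only the part behind it is kept.\<close>

lemma reach_imp_gpath:
  assumes "sgraph z" "reach z UNIV a b" "a \<noteq> b"
  shows "\<exists>P S. gpath z a b P S"
  using assms(2,3) unfolding reach_def
proof (induction rule: converse_rtranclp_induct)
  case (step a a')
  then have e: "{a, a'} \<in> z" "a \<noteq> a'" using sgraph_edge_neq[OF assms(1)] by auto
  show ?case
  proof (cases "a' = b")
    case True
    then show ?thesis using e by (auto intro: gpath.intros)
  next
    case False
    then obtain P S where P: "gpath z a' b P S" using step by auto
    show ?thesis
    proof (cases "a \<in> S")
      case True
      then show ?thesis using gpath_split[OF P, of a] e step by blast
    next
      case False
      then show ?thesis using e P by (auto intro: gpath.intros)
    qed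
  qed
qed simp

text \<open>By the handshake parity the component of \<open>a\<close> contains an even number of
  boundary vertices, hence also \<open>b\<close>.\<close>

lemma bd_imp_gpath:
  assumes "sgraph z" "bd z = {a, b}" "a \<noteq> b"
  shows "\<exists>P S. gpath z a b P S"
proof -
  define X where "X = {v. reach z UNIV a v}"
  define K where "K = {e \<in> z. e \<subseteq> X}"
  have closed: "e \<subseteq> X" if e: "e \<in> z" "x \<in> e" "x \<in> X" for e x
  proof
    fix y assume "y \<in> e"
    have "y = x \<or> e = {x, y}" using sgraph_edge[OF assms(1) e(1)] e \<open>y \<in> e\<close> by auto
    then show "y \<in> X" using e reach_trans[OF _ reach_step[of x UNIV y z]] by (auto simp: X_def)
  qed
  have "{e \<in> K. v \<in> e} = (if v \<in> X then {e \<in> z. v \<in> e} else {})" for v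
    using closed by (auto simp: K_def)
  then have "bd K = bd z \<inter> X" by (auto simp: bd_def)
  moreover have "even (card (bd K))" using even_card_bd[OF assms(1), of K] by (auto simp: K_def)
  moreover have "a \<in> X" by (simp add: X_def)
  ultimately have "b \<in> X" using assms(2,3) by (cases "b \<in> X") auto
  then show ?thesis using reach_imp_gpath assms by (auto simp: X_def)
qed

text \<open>Two edge-disjoint paths are found from parity alone and exhaust \<open>F\<close> by
  minimality. A further common vertex \<open>v\<close> would close their two initial pieces to a
  proper subcycle.\<close>

lemma circuit_split:
  assumes "circuit F" "sgraph F" "a \<in> \<Union>F" "b \<in> \<Union>F" "a \<noteq> b"
  obtains P Q S T where "gpath F a b P S" "gpath F a b Q T" "P \<inter> Q = {}" "F = P \<union> Q" "S \<inter> T = {a, b}"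
proof -
  have fF: "finite F" using sgraph_finite[OF assms(2)] .
  have min: "z = {} \<or> z = F" if "z \<subseteq> F" "bd z = {}" for z
    using assms(1) that by (auto simp: circuit_def)
  have bdF: "bd F = {}" using assms(1) by (simp add: circuit_def)
  obtain R where R: "R \<subseteq> F" "bd R = sd {a} {b}" using circuit_join[OF assms(1-4)] .
  have "bd R = {a, b}" using R assms(5) by (auto simp: sd_iff)
  then obtain P S where "gpath R a b P S"
    using bd_imp_gpath[of R a b] sgraph_subset[OF assms(2) R(1)] assms(5) by auto
  then have P: "gpath F a b P S" using gpath_mono R by metis
  have PF: "P \<subseteq> F" using gpath_facts[OF P] by simp
  have "bd (F - P) = {a, b}" using bd_Diff[OF fF PF] gpath_bd[OF P] bdF by simp
  then obtain Q T where Q0: "gpath (F - P) a b Q T"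
    using bd_imp_gpath[of "F - P" a b] sgraph_subset[OF assms(2), of "F - P"] assms(5) by auto
  then have Q: "gpath F a b Q T" using gpath_mono by (metis Diff_subset)
  have QF: "Q \<subseteq> F - P" using gpath_facts[OF Q0] by simp
  have fin: "finite P" "finite Q" using gpath_facts[OF P] gpath_facts[OF Q] by auto
  have dis: "P \<inter> Q = {}" using QF by auto
  have "bd (P \<union> Q) = {}" using bd_Un_disjoint[OF fin dis] gpath_bd[OF P] gpath_bd[OF Q] by simp
  moreover have "P \<noteq> {}" using gpath_facts[OF P] by simp
  ultimately have FPQ: "F = P \<union> Q" using min[of "P \<union> Q"] PF QF by auto
  have "v = a \<or> v = b" if v: "v \<in> S" "v \<in> T" for v
  proof (rule ccontr)
    assume "\<not> ?thesis"
    then obtain P1 P2 Q1 Q2 S1 S2 T1 T2 where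
      P': "gpath F a v P1 S1" "gpath F v b P2 S2" "P = P1 \<union> P2" "P1 \<inter> P2 = {}" and
      Q': "gpath F a v Q1 T1" "gpath F v b Q2 T2" "Q = Q1 \<union> Q2" "Q1 \<inter> Q2 = {}"
      using gpath_split[OF P v(1)] gpath_split[OF Q v(2)] by metis
    have ne: "P2 \<noteq> {}" "P1 \<noteq> {}" using gpath_facts[OF P'(2)] gpath_facts[OF P'(1)] by auto
    have d: "P1 \<inter> Q1 = {}" using dis P' Q' by auto
    have "bd (P1 \<union> Q1) = {}"
      using bd_Un_disjoint[OF _ _ d] gpath_facts[OF P'(1)] gpath_facts[OF Q'(1)]
        gpath_bd[OF P'(1)] gpath_bd[OF Q'(1)] by simp
    then have "P1 \<union> Q1 = F" using min[of "P1 \<union> Q1"] ne P' Q' FPQ by auto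
    then have "P2 \<subseteq> P1 \<union> Q1" using P' FPQ by auto
    then show False using ne P' Q' dis by auto
  qed
  then have "S \<inter> T = {a, b}" using gpath_facts[OF P] gpath_facts[OF Q] by auto
  with that P Q dis FPQ show ?thesis by blast
qed

text \<open>A cycle inside the union has the same boundary on both paths. That boundary lies in both
  vertex sets, hence in \<open>{a, b}\<close>, so each path is used wholly or not at all.\<close>

lemma theta_circuit:
  assumes P: "gpath E a b P S" and Q: "gpath E a b Q T" and dis: "P \<inter> Q = {}" and ST: "S \<inter> T = {a, b}"
  shows "circuit (P \<union> Q)"
proof -
  note f = gpath_facts[OF P] gpath_facts[OF Q]
  have b: "bd P = {a, b}" "bd Q = {a, b}" using gpath_bd[OF P] gpath_bd[OF Q] by auto
  have "bd (P \<union> Q) = {}" using bd_Un_disjoint[OF _ _ dis] f b by simp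
  moreover have "z = {} \<or> z = P \<union> Q" if z: "z \<subseteq> P \<union> Q" "bd z = {}" for z
  proof -
    have fz: "finite (z \<inter> P)" "finite (z \<inter> Q)" using f by auto
    have zz: "z = (z \<inter> P) \<union> (z \<inter> Q)" using z by auto
    have "bd z = sd (bd (z \<inter> P)) (bd (z \<inter> Q))"
      using bd_Un_disjoint[OF fz] dis zz by auto
    then have eq: "bd (z \<inter> P) = bd (z \<inter> Q)" using z(2) by (metis sd_eq_empty_iff)
    have "bd (z \<inter> P) \<subseteq> S" "bd (z \<inter> Q) \<subseteq> T"
      using bd_subset[of "z \<inter> P"] bd_subset[of "z \<inter> Q"] f by auto
    then have sub: "bd (z \<inter> P) \<subseteq> {a, b}" using eq ST by auto
    have "z \<inter> P = {} \<or> z \<inter> P = P" using gpath_subset_eq[OF P _ sub] by auto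
    moreover have "z \<inter> Q = {} \<or> z \<inter> Q = Q" using gpath_subset_eq[OF Q, of "z \<inter> Q"] sub eq by auto
    moreover have "\<not> (z \<inter> P = {} \<and> z \<inter> Q = Q)" "\<not> (z \<inter> P = P \<and> z \<inter> Q = {})" using eq b by auto
    ultimately show ?thesis using zz by auto
  qed
  ultimately show ?thesis using f by (auto simp: circuit_def)
qed

lemma circuit_exists:
  assumes "finite z" "bd z = {}" "z \<noteq> {}"
  shows "\<exists>C\<subseteq>z. circuit C"
proof -
  obtain C where C: "C \<subseteq> z \<and> bd C = {} \<and> C \<noteq> {}"
    and min: "\<And>y. y \<subseteq> z \<and> bd y = {} \<and> y \<noteq> {} \<Longrightarrow> card C \<le> card y"
    using ex_has_least_nat[of "\<lambda>y. y \<subseteq> z \<and> bd y = {} \<and> y \<noteq> {}" z card] assms by blast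
  have fC: "finite C" using C assms(1) finite_subset by auto
  have "y = {} \<or> y = C" if y: "y \<subseteq> C" "bd y = {}" for y
  proof (rule ccontr)
    assume *: "\<not> ?thesis"
    then have "card y < card C" using y fC by (intro psubset_card_mono) auto
    moreover have "card C \<le> card y" using min[of y] y C * by auto
    ultimately show False by simp
  qed
  then have "circuit C" using C by (auto simp: circuit_def)
  then show ?thesis using C by auto
qed

section \<open>Plane drawings\<close>

locale drawing =
  fixes V :: "'a set" and E :: "'a set set" and p :: "'a \<Rightarrow> complex" and \<gamma> :: "'a set \<Rightarrow> real \<Rightarrow> complex"
  assumes simple: "finite_simple_graph V E" and draw: "plane_drawing V E p \<gamma>"
begin

lemma sgraph_E: "sgraph E"
proof -
  have "E \<subseteq> Pow V" "finite V" using simple by (auto simp: finite_simple_graph_def)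
  then have "finite E" by (meson finite_Pow_iff finite_subset)
  then show ?thesis using simple by (auto simp: sgraph_def finite_simple_graph_def)
qed

lemma finite_E: "finite E"
  using sgraph_E sgraph_finite by auto

lemma edge_V: "e \<in> E \<Longrightarrow> e \<subseteq> V"
  using simple by (auto simp: finite_simple_graph_def)

lemma p_inj: "x \<in> V \<Longrightarrow> y \<in> V \<Longrightarrow> p x = p y \<Longrightarrow> x = y"
  using draw by (auto simp: plane_drawing_def inj_on_def)

lemma edge_arc: "e \<in> E \<Longrightarrow> arc (\<gamma> e)"
  and edge_ends: "e \<in> E \<Longrightarrow> {pathstart (\<gamma> e), pathfinish (\<gamma> e)} = p ` e"
  and edge_vertices: "e \<in> E \<Longrightarrow> path_image (\<gamma> e) \<inter> p ` V = p ` e"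
  and edge_cross: "e \<in> E \<Longrightarrow> f \<in> E \<Longrightarrow> e \<noteq> f \<Longrightarrow> path_image (\<gamma> e) \<inter> path_image (\<gamma> f) = p ` (e \<inter> f)"
  using draw by (auto simp: plane_drawing_def)

definition img :: "'a set set \<Rightarrow> complex set" where
  "img z = (\<Union>e\<in>z. path_image (\<gamma> e))"

lemma img_Un: "img (y \<union> z) = img y \<union> img z"
  by (auto simp: img_def)

lemma ends_in_edge: "e \<in> E \<Longrightarrow> p ` e \<subseteq> path_image (\<gamma> e)"
  using edge_vertices by blast

lemma ends_in_img: "z \<subseteq> E \<Longrightarrow> v \<in> \<Union>z \<Longrightarrow> p v \<in> img z"
  using ends_in_edge by (auto simp: img_def) blast

text \<open>The midpoint of the parameter interval works, because an arc is injective. Such a point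
  tells an edge apart from all others.\<close>

lemma edge_interior_point:
  assumes "e \<in> E"
  obtains x where "x \<in> path_image (\<gamma> e)" "x \<notin> p ` V"
proof -
  have arc: "inj_on (\<gamma> e) {0..1}" using edge_arc[OF assms] by (simp add: arc_def)
  let ?x = "\<gamma> e (1/2)"
  have "?x \<noteq> \<gamma> e 0" "?x \<noteq> \<gamma> e 1" using inj_onD[OF arc, of "1/2" 0] inj_onD[OF arc, of "1/2" 1] by auto
  then have "?x \<notin> p ` e" using edge_ends[OF assms] by (auto simp: pathstart_def pathfinish_def)
  moreover have "?x \<in> path_image (\<gamma> e)" by (auto simp: path_image_def)
  ultimately show ?thesis using that edge_vertices[OF assms] by auto
qed

lemma img_mono_iff:
  assumes "y \<subseteq> E" "z \<subseteq> E" "img y \<subseteq> img z"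
  shows "y \<subseteq> z"
proof
  fix e assume e: "e \<in> y"
  then have eE: "e \<in> E" using assms by auto
  obtain x where x: "x \<in> path_image (\<gamma> e)" "x \<notin> p ` V" using edge_interior_point[OF eE] .
  then have "x \<in> img y" using e by (auto simp: img_def)
  then have "x \<in> img z" using assms by auto
  then obtain f where f: "f \<in> z" "x \<in> path_image (\<gamma> f)" by (auto simp: img_def)
  have "e = f"
  proof (rule ccontr)
    assume "e \<noteq> f"
    then have "x \<in> p ` (e \<inter> f)" using edge_cross[of e f] x f eE assms by blast
    then show False using x edge_V[OF eE] by auto
  qed
  then show "e \<in> z" using f by simp
qed

lemma img_Int:
  assumes "y \<subseteq> E" "z \<subseteq> E" "y \<inter> z = {}"
  shows "img y \<inter> img z \<subseteq> p ` (\<Union>y \<inter> \<Union>z)"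
proof
  fix x assume "x \<in> img y \<inter> img z"
  then obtain e f where ef: "e \<in> y" "f \<in> z" "x \<in> path_image (\<gamma> e)" "x \<in> path_image (\<gamma> f)"
    by (auto simp: img_def)
  then have "e \<noteq> f" using assms by auto
  then have "x \<in> p ` (e \<inter> f)" using edge_cross[of e f] ef assms by blast
  then show "x \<in> p ` (\<Union>y \<inter> \<Union>z)" using ef by auto
qed

lemma gpath_V: "gpath E a b P S \<Longrightarrow> S \<subseteq> V"
  using gpath_facts[of E a b P S] edge_V by blast

lemma edge_arc_oriented:
  assumes "{a, b} \<in> E"
  obtains g where "arc g" "pathstart g = p a" "pathfinish g = p b" "path_image g = path_image (\<gamma> {a, b})"
proof -
  let ?g = "\<gamma> {a, b}"
  have "{pathstart ?g, pathfinish ?g} = {p a, p b}" using edge_ends[OF assms] by simp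
  then consider "pathstart ?g = p a" "pathfinish ?g = p b" | "pathstart ?g = p b" "pathfinish ?g = p a"
    by (auto simp: doubleton_eq_iff)
  then show ?thesis
  proof cases
    case 1
    then show ?thesis using that[of ?g] edge_arc[OF assms] by simp
  next
    case 2
    then show ?thesis using that[of "reversepath ?g"] edge_arc[OF assms] by (simp add: arc_reversepath)
  qed
qed

lemma gpath_arc:
  "gpath E a b P S \<Longrightarrow> \<exists>g. arc g \<and> pathstart g = p a \<and> pathfinish g = p b \<and> path_image g = img P"
proof (induction rule: gpath.induct)
  case (gpath_edge a b)
  then obtain g where "arc g" "pathstart g = p a" "pathfinish g = p b" "path_image g = path_image (\<gamma> {a, b})"
    using edge_arc_oriented by blast
  then show ?case by (auto simp: img_def)
next
  case (gpath_step a b S c P)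
  note f = gpath_facts[OF gpath_step(3)]
  obtain g where g: "arc g" "pathstart g = p b" "pathfinish g = p c" "path_image g = img P"
    using gpath_step by auto
  obtain h where h: "arc h" "pathstart h = p a" "pathfinish h = p b" "path_image h = path_image (\<gamma> {a, b})"
    using edge_arc_oriented[OF gpath_step(1)] by blast
  have "{{a, b}} \<inter> P = {}" using f gpath_step by auto
  then have "img {{a, b}} \<inter> img P \<subseteq> p ` (\<Union>{{a, b}} \<inter> \<Union>P)"
    using f gpath_step by (intro img_Int) auto
  also have "\<dots> \<subseteq> {p b}" using f gpath_step by auto
  finally have "path_image h \<inter> path_image g \<subseteq> {pathstart g}" using g h by (simp add: img_def)
  then have "arc (h +++ g)" using g h by (intro arc_join) auto
  moreover have "path_image (h +++ g) = img (insert {a, b} P)"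
    using g h by (simp add: path_image_join img_def)
  ultimately show ?case using g h by (metis pathfinish_join pathstart_join)
qed

lemma gpath_arcs_meet:
  assumes "gpath E a b P S" "gpath E a b Q T" "P \<inter> Q = {}" "S \<inter> T = {a, b}"
  shows "img P \<inter> img Q = {p a, p b}"
proof
  note f = gpath_facts[OF assms(1)] gpath_facts[OF assms(2)]
  show "img P \<inter> img Q \<subseteq> {p a, p b}"
    using img_Int[of P Q] f assms by auto
  show "{p a, p b} \<subseteq> img P \<inter> img Q"
    using ends_in_img[of P] ends_in_img[of Q] f by auto
qed

lemma theta_curve:
  assumes "gpath E a b P S" "gpath E a b Q T" "P \<inter> Q = {}" "S \<inter> T = {a, b}"
  shows "\<exists>c. simple_path c \<and> pathfinish c = pathstart c \<and> path_image c = img (P \<union> Q)"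
proof -
  obtain g where g: "arc g" "pathstart g = p a" "pathfinish g = p b" "path_image g = img P"
    using gpath_arc[OF assms(1)] by auto
  obtain h where h: "arc h" "pathstart h = p a" "pathfinish h = p b" "path_image h = img Q"
    using gpath_arc[OF assms(2)] by auto
  have "simple_path (g +++ reversepath h)"
    using g h gpath_arcs_meet[OF assms] by (intro simple_path_join_loop) (auto simp: arc_reversepath)
  moreover have "path_image (g +++ reversepath h) = img (P \<union> Q)"
    using g h by (simp add: path_image_join img_Un)
  ultimately show ?thesis using g h by (metis pathfinish_join pathfinish_reversepath pathstart_join)
qed

lemma circuit_edge_split:
  assumes "circuit F" "F \<subseteq> E"
  obtains a b where "a \<in> \<Union>F" "b \<in> \<Union>F" "a \<noteq> b" "{a, b} \<in> F"
proof -
  obtain e where e: "e \<in> F" using assms by (auto simp: circuit_def)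
  then obtain x y where "e = {x, y}" "x \<noteq> y" using sgraph_edge[OF sgraph_E] assms by blast
  then show ?thesis using that[of x y] e by auto
qed

lemma circuit_splitE:
  assumes "circuit F" "F \<subseteq> E" "a \<in> \<Union>F" "b \<in> \<Union>F" "a \<noteq> b"
  obtains P Q S T where "gpath E a b P S" "gpath E a b Q T" "P \<inter> Q = {}" "F = P \<union> Q" "S \<inter> T = {a, b}"
proof -
  obtain P Q S T where "gpath F a b P S" "gpath F a b Q T" "P \<inter> Q = {}" "F = P \<union> Q" "S \<inter> T = {a, b}"
    using circuit_split[OF assms(1) sgraph_subset[OF sgraph_E assms(2)] assms(3-5)] .
  then show ?thesis using that[of P S Q T] gpath_mono assms(2) by metis
qed

lemma circuit_curve:
  assumes "circuit F" "F \<subseteq> E"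
  obtains c where "simple_path c" "pathfinish c = pathstart c" "path_image c = img F"
proof -
  obtain a b where ab: "a \<in> \<Union>F" "b \<in> \<Union>F" "a \<noteq> b" using circuit_edge_split[OF assms] .
  obtain P Q S T where "gpath E a b P S" "gpath E a b Q T" "P \<inter> Q = {}" "F = P \<union> Q" "S \<inter> T = {a, b}"
    using circuit_splitE[OF assms ab] .
  then show ?thesis using theta_curve that by metis
qed

section \<open>Insides of circuits and the faces of a drawing\<close>

definition ins :: "'a set set \<Rightarrow> complex set" where
  "ins F = inside (img F)"

lemma ins_facts:
  assumes "circuit F" "F \<subseteq> E"
  shows "ins F \<noteq> {}" "open (ins F)" "connected (ins F)" "open (outside (img F))"
    "frontier (ins F) = img F" "ins F \<inter> img F = {}" "ins F \<inter> outside (img F) = {}"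
    "ins F \<union> outside (img F) = - img F"
proof -
  obtain c where c: "simple_path c" "pathfinish c = pathstart c" "path_image c = img F"
    using circuit_curve[OF assms] .
  show "ins F \<noteq> {}" "open (ins F)" "connected (ins F)" "open (outside (img F))"
    "frontier (ins F) = img F" "ins F \<inter> outside (img F) = {}"
    "ins F \<union> outside (img F) = - img F"
    using Jordan_inside_outside[OF c(1,2)] c(3) by (auto simp: ins_def)
  then show "ins F \<inter> img F = {}" by auto
qed

lemma connected_in_ins:
  assumes "circuit F" "F \<subseteq> E" "connected C" "C \<inter> img F = {}" "C \<inter> ins F \<noteq> {}"
  shows "C \<subseteq> ins F"
proof -
  note f = ins_facts[OF assms(1,2)]
  have "C \<subseteq> ins F \<union> outside (img F)" using f assms by auto
  moreover have "ins F \<inter> outside (img F) \<inter> C = {}" using f by auto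
  ultimately have "ins F \<inter> C = {} \<or> outside (img F) \<inter> C = {}"
    using connectedD[OF assms(3) f(2,4)] by auto
  then show ?thesis using assms(5) f(8) assms(4) by auto
qed

text \<open>A crosscut of the disc bounded by \<open>F\<close>, formed by edges of the
  graph.\<close>

definition through :: "'a set set \<Rightarrow> 'a \<Rightarrow> 'a \<Rightarrow> 'a set set \<Rightarrow> bool" where
  "through F a b Q \<longleftrightarrow> (\<exists>S. gpath E a b Q S) \<and> a \<in> \<Union>F \<and> b \<in> \<Union>F \<and> img Q - {p a, p b} \<subseteq> ins F"

text \<open>The theta-curve theorem: the inside of \<open>F\<close> is the disjoint union of the
  insides of the two halves and the open crosscut. Each half is a proper part because the other is
  nonempty.\<close>

lemma through_splits:
  assumes F: "circuit F" "F \<subseteq> E" and thr: "through F a b Q"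
  obtains G H where "circuit G" "G \<subseteq> E" "circuit H" "H \<subseteq> E" "F = sd G H" "ins G \<subset> ins F" "ins H \<subset> ins F"
proof -
  obtain U where Q: "gpath E a b Q U" and ab: "a \<in> \<Union>F" "b \<in> \<Union>F"
    and in_F: "img Q - {p a, p b} \<subseteq> ins F" using thr by (auto simp: through_def)
  have anb: "a \<noteq> b" using gpath_facts[OF Q] by simp
  have abV: "a \<in> V" "b \<in> V" using ab F edge_V by auto
  obtain P1 P2 S1 S2 where P: "gpath E a b P1 S1" "gpath E a b P2 S2" "P1 \<inter> P2 = {}" "F = P1 \<union> P2" "S1 \<inter> S2 = {a, b}"
    using circuit_splitE[OF F ab anb] .
  note facts = gpath_facts[OF Q] gpath_facts[OF P(1)] gpath_facts[OF P(2)]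
  have disj: "ins F \<inter> img F = {}" using ins_facts[OF F] by simp
  have pab: "p a \<in> img Q" "p b \<in> img Q" using ends_in_img[of Q] facts by auto
  have QF: "Q \<inter> F = {}"
  proof (rule ccontr)
    assume "Q \<inter> F \<noteq> {}"
    then obtain e where e: "e \<in> Q" "e \<in> F" by auto
    then obtain x where x: "x \<in> path_image (\<gamma> e)" "x \<notin> p ` V" using edge_interior_point F by blast
    then have "x \<in> img Q" "x \<in> img F" using e by (auto simp: img_def)
    then show False using in_F disj x abV by blast
  qed
  have imgF: "img F = img P1 \<union> img P2" using P by (simp add: img_Un)
  have meet: "img Q \<inter> img F \<subseteq> {p a, p b}" using in_F disj by auto
  have SU: "Si \<inter> U = {a, b}" if "gpath E a b Pi Si" "Pi \<subseteq> F" for Pi Si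
  proof -
    have "v = a \<or> v = b" if v: "v \<in> Si" "v \<in> U" for v
    proof -
      have "p v \<in> img Pi" "p v \<in> img Q"
        using ends_in_img[of Pi v] ends_in_img[of Q v] gpath_facts[OF \<open>gpath E a b Pi Si\<close>] facts v by auto
      then have "p v \<in> {p a, p b}" using meet \<open>Pi \<subseteq> F\<close> by (auto simp: img_def)
      then show ?thesis using p_inj abV gpath_V[OF Q] v by blast
    qed
    then show ?thesis using gpath_facts[OF \<open>gpath E a b Pi Si\<close>] facts by auto
  qed
  have S1U: "S1 \<inter> U = {a, b}" and S2U: "S2 \<inter> U = {a, b}" using SU[OF P(1)] SU[OF P(2)] P(4) by auto
  have d: "P1 \<inter> Q = {}" "P2 \<inter> Q = {}" using QF P(4) by auto
  have GH: "circuit (P1 \<union> Q)" "circuit (P2 \<union> Q)"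
    using theta_circuit[OF P(1) Q d(1) S1U] theta_circuit[OF P(2) Q d(2) S2U] by auto
  have GHE: "P1 \<union> Q \<subseteq> E" "P2 \<union> Q \<subseteq> E" using facts by auto
  obtain c1 where c1: "arc c1" "pathstart c1 = p a" "pathfinish c1 = p b" "path_image c1 = img P1"
    using gpath_arc[OF P(1)] by auto
  obtain c2 where c2: "arc c2" "pathstart c2 = p a" "pathfinish c2 = p b" "path_image c2 = img P2"
    using gpath_arc[OF P(2)] by auto
  obtain c where c: "arc c" "pathstart c = p a" "pathfinish c = p b" "path_image c = img Q"
    using gpath_arc[OF Q] by auto
  have ne: "img Q \<inter> ins F \<noteq> {}"
  proof -
    obtain e where e: "e \<in> Q" using facts by auto
    then obtain x where "x \<in> path_image (\<gamma> e)" "x \<notin> p ` V" using edge_interior_point facts by blast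
    then have "x \<in> img Q" "x \<notin> {p a, p b}" using e abV by (auto simp: img_def)
    then show ?thesis using in_F by auto
  qed
  have pn: "p a \<noteq> p b" using p_inj abV anb by auto
  have m: "path_image c1 \<inter> path_image c2 = {p a, p b}" "path_image c1 \<inter> path_image c = {p a, p b}"
    "path_image c2 \<inter> path_image c = {p a, p b}"
    using gpath_arcs_meet[OF P(1,2,3,5)] gpath_arcs_meet[OF P(1) Q d(1) S1U]
      gpath_arcs_meet[OF P(2) Q d(2) S2U] c c1 c2 by auto
  have ne': "path_image c \<inter> inside (path_image c1 \<union> path_image c2) \<noteq> {}"
    using ne c c1 c2 imgF by (simp add: ins_def)
  have i1: "ins (P1 \<union> Q) = inside (path_image c1 \<union> path_image c)"
    and i2: "ins (P2 \<union> Q) = inside (path_image c2 \<union> path_image c)"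
    and iF: "ins F = inside (path_image c1 \<union> path_image c2)"
    using c c1 c2 imgF by (simp_all add: ins_def img_Un)
  have "ins (P1 \<union> Q) \<inter> ins (P2 \<union> Q) = {}"
       "ins (P1 \<union> Q) \<union> ins (P2 \<union> Q) \<union> (path_image c - {p a, p b}) = ins F"
    unfolding i1 i2 iF
    using split_inside_simple_closed_curve[OF arc_imp_simple_path[OF c1(1)] c1(2,3) arc_imp_simple_path[OF c2(1)]
        c2(2,3) arc_imp_simple_path[OF c(1)] c(2,3) pn m ne'] by blast+
  moreover have "ins (P1 \<union> Q) \<noteq> {}" "ins (P2 \<union> Q) \<noteq> {}"
    using ins_facts(1)[OF GH(1) GHE(1)] ins_facts(1)[OF GH(2) GHE(2)] by auto
  ultimately have "ins (P1 \<union> Q) \<subset> ins F" "ins (P2 \<union> Q) \<subset> ins F" by blast+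
  moreover have "F = sd (P1 \<union> Q) (P2 \<union> Q)" using P QF by (auto simp: sd_def)
  ultimately show ?thesis using that[of "P1 \<union> Q" "P2 \<union> Q"] GH GHE by blast
qed

text \<open>The boundaries of the bounded faces: no path of the graph crosses the inside of such a circuit.\<close>

definition faces :: "'a set set set" where
  "faces = {F. circuit F \<and> F \<subseteq> E \<and> (\<forall>a b Q. \<not> through F a b Q)}"

text \<open>Induction on how many circuits have a strictly smaller inside, a finite substitute for
  area: a circuit that is no face is cut by a crosscut into two circuits with smaller
  insides.\<close>

lemma circuit_in_zspan:
  assumes "circuit F" "F \<subseteq> E"
  shows "F \<in> zspan faces"
  using assms
proof (induction "card {G. circuit G \<and> G \<subseteq> E \<and> ins G \<subset> ins F}" arbitrary: F rule: less_induct)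
  case less
  show ?case
  proof (cases "F \<in> faces")
    case True
    then show ?thesis by (rule zspan_base)
  next
    case False
    then obtain a b Q where "through F a b Q" using less by (auto simp: faces_def)
    then obtain G H where GH: "circuit G" "G \<subseteq> E" "circuit H" "H \<subseteq> E" "F = sd G H" "ins G \<subset> ins F" "ins H \<subset> ins F"
      using through_splits[OF less(2,3)] by metis
    have IH: "G' \<in> zspan faces" if G': "circuit G'" "G' \<subseteq> E" "ins G' \<subset> ins F" for G'
    proof (rule less(1)[OF _ G'(1,2)])
      have "finite {G. circuit G \<and> G \<subseteq> E \<and> ins G \<subset> ins F}"
        by (rule finite_subset[of _ "Pow E"]) (use finite_E in auto)
      then show "card {G. circuit G \<and> G \<subseteq> E \<and> ins G \<subset> ins G'} < card {G. circuit G \<and> G \<subseteq> E \<and> ins G \<subset> ins F}"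
        by (rule psubset_card_mono) (use G' in blast)
    qed
    show ?thesis using IH[OF GH(1,2,6)] IH[OF GH(3,4,7)] GH(5) zspan_sd by metis
  qed
qed

lemma cyc_in_zspan:
  assumes "z \<in> cyc E"
  shows "z \<in> zspan faces"
  using assms
proof (induction "card z" arbitrary: z rule: less_induct)
  case less
  have z: "z \<subseteq> E" "bd z = {}" using less by (auto simp: cyc_def)
  have fz: "finite z" using z finite_E finite_subset by auto
  show ?case
  proof (cases "z = {}")
    case True
    then show ?thesis by (simp add: zspan_empty)
  next
    case False
    then obtain C where C: "C \<subseteq> z" "circuit C" using circuit_exists[OF fz z(2)] by auto
    have "bd (z - C) = {}" using bd_Diff[OF fz C(1)] z C by (simp add: circuit_def)
    then have "z - C \<in> cyc E" using z by (auto simp: cyc_def)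
    moreover have "card (z - C) < card z"
      using C fz by (intro psubset_card_mono) (auto simp: circuit_def)
    ultimately have "z - C \<in> zspan faces" using less by auto
    moreover have "C \<in> zspan faces" using circuit_in_zspan C z by auto
    moreover have "z = sd C (z - C)" using C by (auto simp: sd_def)
    ultimately show ?thesis using zspan_sd by metis
  qed
qed

text \<open>If \<open>G\<close> entered the inside of \<open>F\<close>, a shortest piece of
  \<open>G\<close> that contains the entering edge and ends on \<open>F\<close> would be a crosscut.
  The common edge \<open>e\<close> guarantees such a piece, as its two ends lie on both
  circuits.\<close>

lemma face_avoids_ins:
  assumes "F \<in> faces" "G \<in> faces" "e \<in> F" "e \<in> G"
  shows "img G \<inter> ins F = {}"
proof (rule ccontr)
  assume "img G \<inter> ins F \<noteq> {}"
  then obtain y where y: "y \<in> img G" "y \<in> ins F" by auto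
  have F: "circuit F" "F \<subseteq> E" and G: "circuit G" "G \<subseteq> E" using assms by (auto simp: faces_def)
  have disj: "ins F \<inter> img F = {}" using ins_facts[OF F] by simp
  obtain f where f: "f \<in> G" "y \<in> path_image (\<gamma> f)" using y by (auto simp: img_def)
  have fF: "f \<notin> F" using y f disj by (auto simp: img_def)
  obtain c d where cd: "e = {c, d}" "c \<noteq> d" using sgraph_edge[OF sgraph_E] assms(4) G by blast
  define good where "good = (\<lambda>(R, a, b, S). gpath E a b R S \<and> R \<subseteq> G \<and> f \<in> R \<and> a \<in> \<Union>F \<and> b \<in> \<Union>F)"
  have cdG: "c \<in> \<Union>G" "d \<in> \<Union>G" "c \<in> \<Union>F" "d \<in> \<Union>F" using cd assms by auto
  obtain P Q S T where PQ: "gpath E c d P S" "gpath E c d Q T" "G = P \<union> Q"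
    using circuit_splitE[OF G cdG(1,2) cd(2)] by metis
  have "\<exists>t. good t"
  proof (cases "f \<in> P")
    case True
    then have "good (P, c, d, S)" using PQ cdG by (auto simp: good_def)
    then show ?thesis ..
  next
    case False
    then have "good (Q, c, d, T)" using PQ cdG f by (auto simp: good_def)
    then show ?thesis ..
  qed
  then obtain t where t: "good t" and tmin: "\<And>t'. good t' \<Longrightarrow> card (fst t) \<le> card (fst t')"
    using ex_has_least_nat[of good _ "\<lambda>t. card (fst t)"] by metis
  obtain R a b U where tt: "t = (R, a, b, U)" by (cases t) auto
  have R: "gpath E a b R U" "R \<subseteq> G" "f \<in> R" "a \<in> \<Union>F" "b \<in> \<Union>F" using t tt by (auto simp: good_def)
  have Rmin: "card R \<le> card R'" if "gpath E a' b' R' U'" "R' \<subseteq> G" "f \<in> R'" "a' \<in> \<Union>F" "b' \<in> \<Union>F" for R' a' b' U'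
    using tmin[of "(R', a', b', U')"] that tt by (auto simp: good_def)
  note facts = gpath_facts[OF R(1)]
  \<comment> \<open>A further vertex on \<open>F\<close> would split the piece, and the half
    containing \<open>f\<close> would be shorter.\<close>
  have UF: "v = a \<or> v = b" if v: "v \<in> U" "v \<in> \<Union>F" for v
  proof (rule ccontr)
    assume "\<not> ?thesis"
    then obtain P1 P2 S1 S2 where P: "gpath E a v P1 S1" "gpath E v b P2 S2" "R = P1 \<union> P2" "P1 \<inter> P2 = {}"
      using gpath_split[OF R(1) v(1)] by metis
    note f' = gpath_facts[OF P(1)] gpath_facts[OF P(2)]
    have "card P1 < card R" "card P2 < card R"
      using P f' by (auto intro!: psubset_card_mono)
    moreover have "card R \<le> card P1 \<or> card R \<le> card P2"
      using Rmin[OF P(1)] Rmin[OF P(2)] P(3) R v(2) by blast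
    ultimately show False by simp
  qed
  have RF: "R \<inter> F = {}"
  proof (rule ccontr)
    assume "R \<inter> F \<noteq> {}"
    then obtain g where g: "g \<in> R" "g \<in> F" by auto
    then have "g \<subseteq> {a, b}" using UF facts by auto
    then have "{g} = {} \<or> {g} = R" using g by (intro gpath_subset_eq[OF R(1)]) auto
    then show False using g R(3) fF by auto
  qed
  have "img R \<inter> img F \<subseteq> p ` (\<Union>R \<inter> \<Union>F)" using img_Int[of R F] facts F RF by auto
  also have "\<dots> \<subseteq> {p a, p b}" using UF facts by auto
  finally have meet: "img R \<inter> img F \<subseteq> {p a, p b}" .
  obtain h where h: "arc h" "pathstart h = p a" "pathfinish h = p b" "path_image h = img R"
    using gpath_arc[OF R(1)] by auto
  have con: "connected (img R - {p a, p b})"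
    using connected_simple_path_endless[OF arc_imp_simple_path[OF h(1)]] h by simp
  have pF: "p a \<in> img F" "p b \<in> img F" using ends_in_img[OF F(2)] R by auto
  then have "y \<in> img R - {p a, p b}" using y f R disj by (auto simp: img_def)
  then have "img R - {p a, p b} \<subseteq> ins F"
    using y meet by (intro connected_in_ins[OF F con]) auto
  then have "through F a b R" using R by (auto simp: through_def)
  then show False using assms(1) by (auto simp: faces_def)
qed

text \<open>Each inside avoids the other circuit, so if the insides met, one would contain the
  other. Taking closures then puts one boundary curve into the other, and minimality of circuits
  gives equality.\<close>

lemma faces_disjoint:
  assumes "F \<in> faces" "G \<in> faces" "e \<in> F" "e \<in> G" "F \<noteq> G"
  shows "ins F \<inter> ins G = {}"
proof (rule ccontr)
  assume ne: "ins F \<inter> ins G \<noteq> {}"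
  have F: "circuit F" "F \<subseteq> E" and G: "circuit G" "G \<subseteq> E" using assms by (auto simp: faces_def)
  have 1: "img G \<inter> ins F = {}" "img F \<inter> ins G = {}"
    using face_avoids_ins[OF assms(1-4)] face_avoids_ins[OF assms(2,1,4,3)] by auto
  have "ins F \<subseteq> ins G"
    using ne 1 ins_facts(3)[OF F] by (intro connected_in_ins[OF G]) auto
  then have "closure (ins F) \<subseteq> closure (ins G)" by (rule closure_mono)
  moreover have "img F \<subseteq> closure (ins F)" using ins_facts(5)[OF F] by (auto simp: frontier_def)
  moreover have "closure (ins G) \<subseteq> ins G \<union> img G"
    using ins_facts(5,2)[OF G] by (auto simp: frontier_def interior_open)
  ultimately have "img F \<subseteq> img G" using 1 by blast
  then have FG: "F \<subseteq> G" using img_mono_iff F G by auto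
  have "bd F = {}" "F \<noteq> {}" using F by (auto simp: circuit_def)
  then have "F = G" using G(1) FG unfolding circuit_def by blast
  then show False using assms(5) by simp
qed

text \<open>Two faces with a common edge get loops with the same first arc \<open>g\<close>, so that
  this arc cancels when winding numbers are subtracted.\<close>

lemma circuit_loop:
  assumes "circuit F" "F \<subseteq> E" "{c, d} \<in> F" "arc g" "pathstart g = p c" "pathfinish g = p d"
    "path_image g = path_image (\<gamma> {c, d})"
  obtains h where "arc h" "pathstart h = p d" "pathfinish h = p c" "path_image h = img (F - {{c, d}})"
    "simple_path (g +++ h)" "path_image (g +++ h) = img F"
proof -
  let ?e = "{c, d}"
  have cd: "c \<noteq> d" using assms sgraph_edge_neq[OF sgraph_E] by blast
  have *: "\<exists>Q T. gpath E c d Q T \<and> Q = F - {?e}"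
  proof -
    have cdF: "c \<in> \<Union>F" "d \<in> \<Union>F" using assms by auto
    obtain P Q S T where PQ: "gpath E c d P S" "gpath E c d Q T" "P \<inter> Q = {}" "F = P \<union> Q"
      using circuit_splitE[OF assms(1,2) cdF cd] by metis
    show ?thesis
    proof (cases "?e \<in> P")
      case True
      then have "{?e} = {} \<or> {?e} = P" by (intro gpath_subset_eq[OF PQ(1)]) auto
      then have "Q = F - {?e}" using PQ by auto
      then show ?thesis using PQ by auto
    next
      case False
      then have "{?e} = {} \<or> {?e} = Q" using PQ assms(3) by (intro gpath_subset_eq[OF PQ(2)]) auto
      then have "P = F - {?e}" using PQ by auto
      then show ?thesis using PQ by auto
    qed
  qed
  then obtain Q T where Q: "gpath E c d Q T" "Q = F - {?e}" by auto
  obtain h where h: "arc h" "pathstart h = p c" "pathfinish h = p d" "path_image h = img Q"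
    using gpath_arc[OF Q(1)] by auto
  have "img {?e} \<inter> img Q \<subseteq> p ` (\<Union>{?e} \<inter> \<Union>Q)"
    using Q assms by (intro img_Int) auto
  then have "path_image g \<inter> path_image h \<subseteq> {p c, p d}" using assms h by (auto simp: img_def)
  then have "simple_path (g +++ reversepath h)"
    using h assms by (intro simple_path_join_loop) (auto simp: arc_reversepath)
  moreover have "path_image (g +++ reversepath h) = img F"
    using h assms Q by (auto simp: path_image_join img_def)
  ultimately show ?thesis using that[of "reversepath h"] h Q by (auto simp: arc_reversepath)
qed

text \<open>If three faces shared an edge, two of the loops around them would have the same difference
  of winding numbers near that edge, wherever it is evaluated off the edge.\<close>

lemma edge_in_two_faces:
  assumes "F1 \<in> faces" "F2 \<in> faces" "F3 \<in> faces" "e \<in> F1" "e \<in> F2" "e \<in> F3"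
  shows "F1 = F2 \<or> F1 = F3 \<or> F2 = F3"
proof (rule ccontr)
  assume ne: "\<not> ?thesis"
  have F1: "circuit F1" "F1 \<subseteq> E" and F2: "circuit F2" "F2 \<subseteq> E" and F3: "circuit F3" "F3 \<subseteq> E"
    using assms by (auto simp: faces_def)
  have eE: "e \<in> E" using assms F1 by auto
  obtain c d where cd: "e = {c, d}" using sgraph_edge[OF sgraph_E eE] by blast
  obtain g where g: "arc g" "pathstart g = p c" "pathfinish g = p d" "path_image g = path_image (\<gamma> {c, d})"
    using edge_arc_oriented[of c d] eE cd by blast
  obtain h1 where h1: "arc h1" "pathstart h1 = p d" "pathfinish h1 = p c" "path_image h1 = img (F1 - {{c, d}})"
    "simple_path (g +++ h1)" "path_image (g +++ h1) = img F1"
    using circuit_loop[OF F1 _ g] assms(4) cd by blast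
  obtain h3 where h3: "arc h3" "pathstart h3 = p d" "pathfinish h3 = p c" "path_image h3 = img (F3 - {{c, d}})"
    "simple_path (g +++ h3)" "path_image (g +++ h3) = img F3"
    using circuit_loop[OF F3 _ g] assms(6) cd by blast
  obtain m where m: "m \<in> path_image (\<gamma> e)" "m \<notin> p ` V" using edge_interior_point[OF eE] .
  have moff: "m \<notin> img (F - {e})" if "F \<subseteq> E" for F
  proof
    assume "m \<in> img (F - {e})"
    then obtain f where f: "f \<in> F" "f \<noteq> e" "m \<in> path_image (\<gamma> f)" by (auto simp: img_def)
    then have "m \<in> p ` (e \<inter> f)" using edge_cross[of e f] m eE that by blast
    then show False using m edge_V[OF eE] by auto
  qed
  have "open (- (path_image h1 \<union> path_image h3))"
    using h1(1) h3(1) by (intro open_Compl closed_Un closed_arc_image)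
  moreover have "m \<notin> path_image h1 \<union> path_image h3" using moff[OF F1(2)] moff[OF F3(2)] h1 h3 cd by auto
  ultimately obtain r where r: "r > 0" "ball m r \<subseteq> - (path_image h1 \<union> path_image h3)"
    by (metis ComplI open_contains_ball)
  have near: "\<exists>x. x \<in> ball m r \<and> x \<in> ins F" if F: "circuit F" "F \<subseteq> E" "e \<in> F" for F
  proof -
    have "m \<in> img F" using m F by (auto simp: img_def)
    then have "m \<in> closure (ins F)" using ins_facts(5)[OF F(1,2)] by (auto simp: frontier_def)
    then show ?thesis using r(1) by (auto simp: closure_approachable dist_commute)
  qed
  obtain x1 where x1: "x1 \<in> ball m r" "x1 \<in> ins F1" using near F1 assms by blast
  \<comment> \<open>\<open>F2\<close> supplies a test point close to the edge that lies inside
    neither \<open>F1\<close> nor \<open>F3\<close>.\<close>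
  obtain x2 where x2: "x2 \<in> ball m r" "x2 \<in> ins F2" using near F2 assms by blast
  have d12: "ins F1 \<inter> ins F2 = {}" and d13: "ins F1 \<inter> ins F3 = {}" and d23: "ins F2 \<inter> ins F3 = {}"
    using faces_disjoint assms ne by metis+
  have a12: "img F1 \<inter> ins F2 = {}" and a31: "img F3 \<inter> ins F1 = {}" and a32: "img F3 \<inter> ins F2 = {}"
    using face_avoids_ins assms by metis+
  have out: "x \<in> outside (img F)" if "circuit F" "F \<subseteq> E" "x \<notin> ins F" "x \<notin> img F" for x F
    using ins_facts(8)[OF that(1,2)] that by blast
  have "x1 \<notin> ins F3" "x1 \<notin> img F3" "x2 \<notin> ins F1" "x2 \<notin> img F1" "x2 \<notin> ins F3" "x2 \<notin> img F3"
    using x1(2) x2(2) d12 d13 d23 a12 a31 a32 by blast+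
  then have o: "x1 \<in> outside (img F3)" "x2 \<in> outside (img F1)" "x2 \<in> outside (img F3)"
    using out[OF F3] out[OF F1] by auto
  have xin: "x \<notin> path_image g \<and> x \<notin> path_image h1 \<and> x \<notin> path_image h3" if "x \<in> ball m r" "x \<notin> img F1" for x
    using that r h1(6) g(3) h1(2) by (auto simp: path_image_join)
  have xx1: "x1 \<notin> img F1" using x1 ins_facts(6)[OF F1] by auto
  have xx2: "x2 \<notin> img F1" using x2 a12 by auto
  have paths: "path g" "path h1" "path h3" "path (reversepath h3)" using g h1 h3 arc_imp_path by auto
  \<comment> \<open>The common arc cancels: the difference is the winding number of a loop that
    misses the whole ball, so it is the same on both sides of the edge.\<close>
  have w: "winding_number (g +++ h1) x - winding_number (g +++ h3) x = winding_number (h1 +++ reversepath h3) x"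
    if "x \<in> ball m r" "x \<notin> img F1" for x
    using xin[OF that] paths g h1 h3 by (simp add: winding_number_join winding_number_reversepath)
  have "winding_number (h1 +++ reversepath h3) x1 = winding_number (h1 +++ reversepath h3) x2"
  proof (rule winding_number_eq[of _ _ "ball m r"])
    show "ball m r \<inter> path_image (h1 +++ reversepath h3) = {}"
      using r h1 h3 by (auto simp: path_image_join)
  qed (use x1 x2 h1 h3 paths in auto)
  then have eq: "winding_number (g +++ h1) x1 - winding_number (g +++ h3) x1
      = winding_number (g +++ h1) x2 - winding_number (g +++ h3) x2"
    using w x1 x2 xx1 xx2 by metis
  have z: "winding_number (g +++ h) x = 0" if "simple_path (g +++ h)" "pathfinish h = p c" "pathstart h = p d"
    "x \<in> outside (path_image (g +++ h))" for h x
    using that g by (intro winding_number_zero_in_outside) (auto simp: simple_path_imp_path)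
  have "winding_number (g +++ h3) x1 = 0" "winding_number (g +++ h1) x2 = 0" "winding_number (g +++ h3) x2 = 0"
    using z h1 h3 o by auto
  \<comment> \<open>At \<open>x2\<close> both loops have winding number 0, and at \<open>x1\<close>
    the second one has; equal differences force 0 for the first, although \<open>x1\<close> lies
    inside it.\<close>
  then have "winding_number (g +++ h1) x1 = 0" using eq by simp
  moreover have "norm (winding_number (g +++ h1) x1) = 1"
    using simple_closed_path_norm_winding_number_inside[OF h1(5)] x1 h1(6) by (simp add: ins_def)
  ultimately show False by simp
qed

theorem drawing_maclane: "maclane E"
proof -
  have "faces \<subseteq> cyc E" by (auto simp: faces_def cyc_def circuit_def)
  moreover have "cover2 faces"
    unfolding cover2_def by (intro allI card_le_2I) (use edge_in_two_faces in blast)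
  ultimately show ?thesis using cyc_in_zspan unfolding maclane_def mac_def by blast
qed

end

section \<open>Minimal counterexamples and reducible configurations\<close>

text \<open>The ratio bound without division; the empty graph satisfies it, so a counterexample is
  nonempty.\<close>

definition good :: "'v set \<Rightarrow> 'v set set \<Rightarrow> bool" where
  "good V E \<longleftrightarrow> (\<exists>S. independent_set V E S \<and> 3 * card V \<le> 13 * card S)"

lemma simple_imp_sgraph:
  assumes "finite_simple_graph V E"
  shows "sgraph E"
proof -
  have "E \<subseteq> Pow V" "finite V" using assms by (auto simp: finite_simple_graph_def)
  then have "finite E" by (meson finite_Pow_iff finite_subset)
  then show ?thesis using assms by (auto simp: sgraph_def finite_simple_graph_def)
qed

text \<open>Vertices of a minor are named by vertices of the graph, so comparison within one type
  suffices. The type is infinite so that a fresh vertex can be placed in a face. Edge-maximality can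
  be required because adding edges only removes independent sets.\<close>

locale min_counterexample =
  fixes V :: "'v set" and E :: "'v set set"
  assumes infinite_type: "infinite (UNIV :: 'v set)"
    and simple: "finite_simple_graph V E"
    and maclane: "maclane E"
    and bad: "\<not> good V E"
    and minimal: "\<And>V' E'. finite_simple_graph V' E' \<Longrightarrow> maclane E' \<Longrightarrow> card V' < card V
      \<Longrightarrow> good (V' :: 'v set) E'"
    and maximal: "\<And>e. e \<subseteq> V \<Longrightarrow> card e = 2 \<Longrightarrow> e \<notin> E \<Longrightarrow> \<not> maclane (insert e E)"
begin

lemma finite_V [simp]: "finite V"
  using simple by (simp add: finite_simple_graph_def)

lemma sgraph_E: "sgraph E"
  using simple_imp_sgraph[OF simple] .

lemma finite_E [simp]: "finite E"
  using sgraph_E sgraph_finite by auto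

definition adj :: "'v \<Rightarrow> 'v \<Rightarrow> bool" where
  "adj x y \<longleftrightarrow> {x, y} \<in> E"

definition N :: "'v \<Rightarrow> 'v set" where
  "N v = {w. adj v w}"

definition indep :: "'v set \<Rightarrow> bool" where
  "indep S \<longleftrightarrow> (\<forall>x\<in>S. \<forall>y\<in>S. \<not> adj x y)"

lemma adj_sym: "adj x y \<Longrightarrow> adj y x"
  by (simp add: adj_def insert_commute)

lemma adj_commute: "adj x y \<longleftrightarrow> adj y x"
  by (simp add: adj_def insert_commute)

lemma adj_irrefl [simp]: "\<not> adj x x"
  using sgraph_edge_neq[OF sgraph_E, of x x] by (auto simp: adj_def)

lemma adj_V: "adj x y \<Longrightarrow> x \<in> V \<and> y \<in> V"
  using simple by (auto simp: adj_def finite_simple_graph_def)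

lemma N_iff [simp]: "w \<in> N v \<longleftrightarrow> adj v w"
  by (simp add: N_def)

lemma N_V: "N v \<subseteq> V"
  using adj_V by auto

lemma finite_N [simp]: "finite (N v)"
  by (rule finite_subset[OF N_V]) simp

lemma indep_imp_bound:
  assumes "S \<subseteq> V" "indep S"
  shows "13 * card S < 3 * card V"
proof -
  have "\<not> e \<subseteq> S" if "e \<in> E" for e
    using sgraph_edge[OF sgraph_E that] assms(2) that by (auto simp: indep_def adj_def)
  then have "independent_set V E S" using assms by (auto simp: independent_set_def)
  then show ?thesis using bad by (auto simp: good_def)
qed

lemma minor_good:
  fixes f :: "'v \<Rightarrow> 'v"
  assumes "V0 \<subseteq> V" "card (f ` V0) < card V"
    and fib: "\<And>x y. \<lbrakk>x \<in> V0; y \<in> V0; f x = f y\<rbrakk> \<Longrightarrow> reach E {v \<in> V0. f v = f x} x y"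
  obtains S where "S \<subseteq> f ` V0" "3 * card (f ` V0) \<le> 13 * card S"
    "\<And>x y. \<lbrakk>x \<in> V0; y \<in> V0; f x \<in> S; f y \<in> S; adj x y\<rbrakk> \<Longrightarrow> f x = f y"
proof -
  define E' where "E' = minor E V0 f"
  have "maclane E'" unfolding E'_def using maclane_minor[OF sgraph_E maclane fib] .
  moreover have "finite_simple_graph (f ` V0) E'"
    using sgraph_minor[OF sgraph_E, of V0 f] finite_subset[OF assms(1)]
    by (auto simp: finite_simple_graph_def E'_def sgraph_def) (auto simp: minor_def)
  ultimately have "good (f ` V0) E'" using minimal assms(2) by blast
  then obtain S where S: "independent_set (f ` V0) E' S" "3 * card (f ` V0) \<le> 13 * card S"
    by (auto simp: good_def)
  have "f x = f y" if "x \<in> V0" "y \<in> V0" "f x \<in> S" "f y \<in> S" "adj x y" for x y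
  proof (rule ccontr)
    assume "f x \<noteq> f y"
    then have "{f x, f y} \<in> E'" using that by (auto simp: E'_def minor_def adj_def)
    then show False using S that by (auto simp: independent_set_def)
  qed
  with S that show ?thesis by (auto simp: independent_set_def)
qed

lemma subgraph_good:
  assumes "W \<subseteq> V" "W \<noteq> V"
  obtains S where "S \<subseteq> W" "indep S" "3 * card W \<le> 13 * card S"
proof -
  have "card W < card V" using assms by (intro psubset_card_mono) auto
  then obtain S where S: "S \<subseteq> (\<lambda>x. x) ` W" "3 * card ((\<lambda>x. x) ` W) \<le> 13 * card S"
    and ind: "\<And>x y. \<lbrakk>x \<in> W; y \<in> W; x \<in> S; y \<in> S; adj x y\<rbrakk> \<Longrightarrow> x = y"
    using minor_good[OF assms(1), of "\<lambda>x. x"] by (auto simp: image_def)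
  have "indep S" unfolding indep_def
  proof (intro ballI notI)
    fix x y assume xy: "x \<in> S" "y \<in> S" "adj x y"
    then have "x = y" using ind[of x y] S(1) by auto
    then show False using xy by simp
  qed
  then show ?thesis using that[of S] S by auto
qed

definition connected_set :: "'v set \<Rightarrow> bool" where
  "connected_set K \<longleftrightarrow> (\<forall>x\<in>K. \<forall>y\<in>K. reach E K x y)"

text \<open>Deleting a set \<open>R\<close> of vertices, except that each \<open>F i\<close> survives as one contracted vertex,
  costs \<open>card R - card I\<close> vertices.  In an independent set of the smaller graph the vertex of
  \<open>F i\<close> is replaced by \<open>T i\<close>; this gains \<open>card (T i) - 1\<close> vertices, at least the number of
  elements of \<open>J\<close> that \<open>T i\<close> blocks, and all unblocked elements of \<open>J\<close> can be added.\<close>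

lemma reducible:
  fixes T F :: "nat \<Rightarrow> 'v set"
  assumes J: "J \<subseteq> V" "indep J" and R: "R \<subseteq> V" "R \<noteq> {}" "J \<subseteq> R" "\<And>u. u \<in> J \<Longrightarrow> N u \<subseteq> R"
    and I: "finite I"
    and F: "\<And>i. i \<in> I \<Longrightarrow> F i \<subseteq> R" "\<And>i. i \<in> I \<Longrightarrow> connected_set (F i)"
      "\<And>i j. \<lbrakk>i \<in> I; j \<in> I; i \<noteq> j\<rbrakk> \<Longrightarrow> F i \<inter> F j = {}"
    and T: "\<And>i. i \<in> I \<Longrightarrow> T i \<subseteq> F i" "\<And>i. i \<in> I \<Longrightarrow> indep (T i)" "\<And>i. i \<in> I \<Longrightarrow> T i \<inter> J = {}"
      "\<And>i. i \<in> I \<Longrightarrow> 2 \<le> card (T i)"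
      "\<And>i. i \<in> I \<Longrightarrow> card {u \<in> J. N u \<inter> T i \<noteq> {}} < card (T i)"
    and count: "3 * card R \<le> 13 * card J + 3 * card I"
  shows False
proof -
  have finR: "finite R" using R finite_subset[OF R(1)] by simp
  have finF: "finite (F i)" "finite (T i)" if "i \<in> I" for i
    using finite_subset[OF F(1)[OF that] finR] finite_subset[OF T(1)[OF that]] by auto
  have finJ: "finite J" using finite_subset[OF J(1)] by simp
  have Tne: "T i \<noteq> {}" if "i \<in> I" for i using T(4)[OF that] by auto
  have Fne: "F i \<noteq> {}" if "i \<in> I" for i using Tne[OF that] T(1)[OF that] by auto
  define r where "r i = (SOME x. x \<in> F i)" for i
  have r: "r i \<in> F i" if "i \<in> I" for i
    unfolding r_def using Fne[OF that] by (simp add: some_in_eq)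
  have rinj: "inj_on r I"
  proof (rule inj_onI)
    fix i j assume ij: "i \<in> I" "j \<in> I" "r i = r j"
    then have "r i \<in> F i \<inter> F j" using r[OF ij(1)] r[OF ij(2)] by simp
    then show "i = j" using F(3)[of i j] ij by auto
  qed
  define ix where "ix x = (THE i. i \<in> I \<and> x \<in> F i)" for x
  have ix: "ix x = i" if "i \<in> I" "x \<in> F i" for i x
    unfolding ix_def by (rule the_equality) (use that F(3) in blast)+
  define UF where "UF = (\<Union>i\<in>I. F i)"
  have UFR: "UF \<subseteq> R" using F(1) by (auto simp: UF_def)
  define V0 where "V0 = (V - R) \<union> UF"
  define f where "f x = (if x \<in> R then r (ix x) else x)" for x
  have fF: "f x = r i" if "i \<in> I" "x \<in> F i" for i x using that ix F(1) by (auto simp: f_def)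
  have fV: "f x = x" if "x \<in> V - R" for x using that by (auto simp: f_def)
  have rR: "r i \<in> R" if "i \<in> I" for i using r[OF that] F(1)[OF that] by auto
  have V0V: "V0 \<subseteq> V" using R UFR by (auto simp: V0_def)
  have img: "f ` V0 = (V - R) \<union> r ` I"
  proof
    show "f ` V0 \<subseteq> (V - R) \<union> r ` I" using fF fV by (auto simp: V0_def UF_def)
    show "(V - R) \<union> r ` I \<subseteq> f ` V0"
      using fF[OF _ r] fV r by (force simp: V0_def UF_def image_iff)
  qed
  have cardI: "card (r ` I) = card I" using rinj card_image by blast
  have cV: "card (V - R) + card R = card V" using R finR by (simp add: card_Diff_subset card_mono)
  have cimg: "card (f ` V0) = card (V - R) + card I"
    unfolding img using rR cardI I by (subst card_Un_disjoint) auto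
  \<comment> \<open>\<open>minimal\<close> asks for strictly fewer vertices. If some part survives,
    its \<open>T i\<close> has two elements, which gives \<open>R\<close> a vertex besides the
    representatives.\<close>
  have IR: "card I < card R"
  proof (cases "I = {}")
    case True
    then show ?thesis using R finR by (simp add: card_gt_0_iff)
  next
    case False
    then obtain i where i: "i \<in> I" by auto
    have "\<not> T i \<subseteq> {r i}" using T(4)[OF i] card_mono[of "{r i}" "T i"] by auto
    then obtain x where x: "x \<in> T i" "x \<noteq> r i" by auto
    have xF: "x \<in> F i" using x T(1)[OF i] by auto
    have "x \<notin> r ` I" using r F(3)[OF i] x xF by blast
    moreover have "x \<in> R" using xF F(1)[OF i] by auto
    ultimately have "card (r ` I) < card R" using rR finR by (intro psubset_card_mono) auto
    then show ?thesis using cardI by simp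
  qed
  have fib: "reach E {v \<in> V0. f v = f x} x y" if xy: "x \<in> V0" "y \<in> V0" "f x = f y" for x y
  proof (cases "x \<in> UF")
    case True
    then obtain i where i: "i \<in> I" "x \<in> F i" by (auto simp: UF_def)
    have fx: "f x = r i" using fF i by auto
    have "y \<in> R" using xy fx rR[OF i(1)] by (cases "y \<in> R") (auto simp: f_def)
    then obtain j where j: "j \<in> I" "y \<in> F j" using xy by (auto simp: V0_def UF_def)
    then have "r i = r j" using fF xy fx by auto
    then have "y \<in> F i" using rinj i j by (auto dest: inj_onD)
    then have "reach E (F i) x y" using F(2)[OF i(1)] i by (auto simp: connected_set_def)
    moreover have "F i \<subseteq> {v \<in> V0. f v = f x}" using fF[OF i(1)] fx i by (auto simp: V0_def UF_def)
    ultimately show ?thesis by (rule reach_mono)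
  next
    case False
    then have x: "x \<in> V - R" using xy by (auto simp: V0_def)
    have "y \<notin> UF"
    proof
      assume "y \<in> UF"
      then obtain j where "j \<in> I" "y \<in> F j" by (auto simp: UF_def)
      then have "f y \<in> R" using fF rR by auto
      then show False using xy fV[OF x] x by auto
    qed
    then have "y \<in> V - R" using xy by (auto simp: V0_def)
    then have "x = y" using xy fV x by metis
    then show ?thesis by simp
  qed
  have lt: "card (f ` V0) < card V" using cimg IR cV by simp
  obtain S where S: "S \<subseteq> f ` V0" "3 * card (f ` V0) \<le> 13 * card S"
    and ind: "\<And>x y. \<lbrakk>x \<in> V0; y \<in> V0; f x \<in> S; f y \<in> S; adj x y\<rbrakk> \<Longrightarrow> f x = f y"
    using minor_good[OF V0V lt fib] by blast
  \<comment> \<open>Only the parts whose representative was chosen are expanded; the other parts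
    contribute nothing and block nothing.\<close>
  define Sel where "Sel = {i \<in> I. r i \<in> S}"
  define S0 where "S0 = S - R"
  define A where "A = {u \<in> J. \<forall>i\<in>Sel. N u \<inter> T i = {}}"
  define UT where "UT = (\<Union>i\<in>Sel. T i)"
  have finSel: "finite Sel" using I by (simp add: Sel_def)
  have S0V: "S0 \<subseteq> V - R" using S(1) img rR by (auto simp: S0_def)
  have finS: "finite S" using finite_subset[OF S(1)] img I by simp
  have UTR: "UT \<subseteq> R" using T(1) F(1) by (fastforce simp: UT_def Sel_def)
  have cS: "card S = card S0 + card Sel"
  proof -
    have "S = S0 \<union> r ` Sel" using S(1) img rR by (auto simp: S0_def Sel_def)
    moreover have "S0 \<inter> r ` Sel = {}" using rR by (auto simp: S0_def Sel_def)
    moreover have "card (r ` Sel) = card Sel"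
      by (rule card_image) (rule inj_on_subset[OF rinj], auto simp: Sel_def)
    ultimately show ?thesis using finS finSel by (metis card_Un_disjoint finite_UnI finite_Un)
  qed
  have cUT: "card UT = (\<Sum>i\<in>Sel. card (T i))"
    unfolding UT_def
  proof (rule card_UN_disjoint[OF finSel])
    show "\<forall>i\<in>Sel. finite (T i)" using finF by (auto simp: Sel_def)
    show "\<forall>i\<in>Sel. \<forall>j\<in>Sel. i \<noteq> j \<longrightarrow> T i \<inter> T j = {}"
      using F(3) T(1) unfolding Sel_def by blast
  qed
  have cA: "card J \<le> card A + (\<Sum>i\<in>Sel. card (T i) - 1)"
  proof -
    have "J - A \<subseteq> (\<Union>i\<in>Sel. {u \<in> J. N u \<inter> T i \<noteq> {}})" by (auto simp: A_def)
    then have "card (J - A) \<le> card (\<Union>i\<in>Sel. {u \<in> J. N u \<inter> T i \<noteq> {}})"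
      using finJ finSel by (intro card_mono) auto
    also have "\<dots> \<le> (\<Sum>i\<in>Sel. card {u \<in> J. N u \<inter> T i \<noteq> {}})" by (rule card_UN_le[OF finSel])
    also have "\<dots> \<le> (\<Sum>i\<in>Sel. card (T i) - 1)"
    proof (rule sum_mono)
      fix i assume "i \<in> Sel"
      then show "card {u \<in> J. N u \<inter> T i \<noteq> {}} \<le> card (T i) - 1"
        using T(5)[of i] by (simp add: Sel_def)
    qed
    finally have "card (J - A) \<le> (\<Sum>i\<in>Sel. card (T i) - 1)" .
    moreover have "card J = card A + card (J - A)"
      using finJ card_Diff_subset[of A J] card_mono[of J A] by (auto simp: A_def)
    ultimately show ?thesis by simp
  qed
  have cT: "(\<Sum>i\<in>Sel. card (T i)) = (\<Sum>i\<in>Sel. card (T i) - 1) + card Sel"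
  proof -
    have "(\<Sum>i\<in>Sel. card (T i)) = (\<Sum>i\<in>Sel. (card (T i) - 1) + 1)"
    proof (rule sum.cong[OF refl])
      fix i assume "i \<in> Sel"
      then have "2 \<le> card (T i)" using T(4) by (simp add: Sel_def)
      then show "card (T i) = card (T i) - 1 + 1" by simp
    qed
    then show ?thesis by (simp only: sum.distrib) simp
  qed
  define L where "L = S0 \<union> UT \<union> A"
  have AR: "A \<subseteq> R" "A \<subseteq> J" using R(3) by (auto simp: A_def)
  have finU: "finite UT" "finite A" using finite_subset[OF UTR finR] finite_subset[OF AR(1) finR] by auto
  have "card L = card S0 + card UT + card A"
  proof -
    have "UT \<inter> A = {}" using T(3) by (fastforce simp: UT_def A_def Sel_def)
    moreover have "S0 \<inter> (UT \<union> A) = {}" using S0V UTR AR by auto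
    ultimately show ?thesis
      unfolding L_def using finS finU by (simp add: card_Un_disjoint Un_assoc S0_def)
  qed
  then have cL: "card S + card J \<le> card L" using cS cUT cA cT by simp
  have "indep L" unfolding indep_def
  proof (intro ballI notI)
    have sel: "\<exists>i. i \<in> I \<and> r i \<in> S \<and> x \<in> T i \<and> f x = r i \<and> x \<in> V0" if x: "x \<in> UT" for x
    proof -
      obtain i where i: "i \<in> I" "r i \<in> S" "x \<in> T i" using x by (auto simp: UT_def Sel_def)
      then have "x \<in> F i" using T(1) by auto
      then show ?thesis using i fF by (auto simp: V0_def UF_def)
    qed
    have s0: "x \<in> V0 \<and> f x = x \<and> x \<in> S \<and> x \<notin> R" if "x \<in> S0" for x
      using that S0V fV by (auto simp: S0_def V0_def)
    have 1: "\<not> adj x y" if x: "x \<in> S0 \<union> UT" and y: "y \<in> S0 \<union> UT" for x y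
    proof
      assume a: "adj x y"
      have "x \<in> V0" "y \<in> V0" "f x \<in> S" "f y \<in> S" using sel[of x] sel[of y] s0[of x] s0[of y] x y by auto
      then have eq: "f x = f y" using ind a by blast
      show False
      proof (cases "x \<in> S0 \<or> y \<in> S0")
        case True
        have out: "z \<in> S0 \<longleftrightarrow> f z \<notin> R" if z: "z \<in> S0 \<union> UT" for z
        proof (cases "z \<in> S0")
          case True
          then show ?thesis using s0[OF True] by simp
        next
          case False
          then obtain i where "i \<in> I" "f z = r i" using sel[of z] z by blast
          then show ?thesis using False rR[of i] by simp
        qed
        have "x \<in> S0 \<longleftrightarrow> y \<in> S0" unfolding out[OF x] out[OF y] eq ..
        then have xy: "x \<in> S0" "y \<in> S0" using True by simp_all
        have "x = f x" "y = f y" using s0[OF xy(1)] s0[OF xy(2)] by auto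
        then have "x = y" using eq by metis
        then show False using a by simp
      next
        case False
        then obtain i j where ij: "i \<in> I" "x \<in> T i" "f x = r i" "j \<in> I" "y \<in> T j" "f y = r j"
          using sel x y by blast
        then have "i = j" using eq rinj by (auto dest: inj_onD)
        then show False using T(2)[of i] ij a by (auto simp: indep_def)
      qed
    qed
    have 2: "\<not> adj u y" if u: "u \<in> A" and y: "y \<in> L" for u y
    proof
      assume a: "adj u y"
      have "u \<in> J" using u AR by auto
      then have "y \<in> R" using subsetD[OF R(4), of u y] a by simp
      then have "y \<in> UT \<or> y \<in> J" using y S0V AR by (auto simp: L_def)
      then show False
      proof
        assume "y \<in> UT"
        then show False using u a by (fastforce simp: A_def UT_def)
      next
        assume "y \<in> J"
        then show False using J(2) u AR a by (auto simp: indep_def)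
      qed
    qed
    fix x y assume "x \<in> L" "y \<in> L" "adj x y"
    then show False using 1[of x y] 2[of x y] 2[of y x] adj_sym by (auto simp: L_def)
  qed
  moreover have "L \<subseteq> V" using S0V UTR AR R(1) by (auto simp: L_def)
  ultimately have "13 * card L < 3 * card V" using indep_imp_bound by blast
  then show False using cL S(2) cimg cV count by simp
qed

end

section \<open>Separators\<close>

text \<open>The number of vertices is minimised first. Edges on that vertex set are then bounded in
  number by \<open>card (Pow V)\<close>, so a counterexample with the most edges exists.\<close>

lemma exists_min_counterexample:
  fixes V0 :: "'v set"
  assumes "infinite (UNIV :: 'v set)" "finite_simple_graph V0 E0" "maclane E0" "\<not> good V0 E0"
  obtains V E where "min_counterexample (V :: 'v set) E"
proof -
  define cex :: "'v set \<Rightarrow> 'v set set \<Rightarrow> bool"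
    where "cex = (\<lambda>V E. finite_simple_graph V E \<and> maclane E \<and> \<not> good V E)"
  have "\<exists>V. \<exists>E. cex (V :: 'v set) E" using assms by (auto simp: cex_def)
  then obtain V where V: "\<exists>E. cex (V :: 'v set) E"
    and Vmin: "\<And>V'. \<exists>E'. cex (V' :: 'v set) E' \<Longrightarrow> card V \<le> card V'"
    using ex_has_least_nat[of "\<lambda>V. \<exists>E. cex V E" _ card] by metis
  have bound: "card E \<le> card (Pow V)" if "cex V E" for E
    using that by (intro card_mono) (auto simp: cex_def finite_simple_graph_def)
  obtain E where E: "cex V E" and Emax: "\<And>E'. cex V E' \<Longrightarrow> card E' \<le> card E"
    using ex_has_greatest_nat[of "cex V" _ card "Suc (card (Pow V))"] V bound
    by (metis le_imp_less_Suc)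
  have "min_counterexample V E"
  proof
    show "good V' E'" if "finite_simple_graph V' E'" "maclane E'" "card V' < card V" for V' :: "'v set" and E'
      using Vmin[of V'] that by (force simp: cex_def)
    show "\<not> maclane (insert e E)" if e: "e \<subseteq> V" "card e = 2" "e \<notin> E" for e
    proof
      assume m: "maclane (insert e E)"
      have "\<not> good V (insert e E)"
        using E by (auto simp: cex_def good_def independent_set_def)
      then have "cex V (insert e E)" using m E e by (auto simp: cex_def finite_simple_graph_def)
      then have "card (insert e E) \<le> card E" by (rule Emax)
      moreover have "finite E" using E simple_imp_sgraph sgraph_finite by (auto simp: cex_def)
      ultimately show False using e by simp
    qed
  qed (use assms E in \<open>auto simp: cex_def\<close>)
  then show ?thesis by (rule that)
qed

context min_counterexample begin

section \<open>Gluing independent sets along a separator\<close>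

definition alpha :: "'v set \<Rightarrow> nat" where
  "alpha W = Max {card S | S. S \<subseteq> W \<and> indep S}"

lemma finite_alpha: "W \<subseteq> V \<Longrightarrow> finite {card S | S. S \<subseteq> W \<and> indep S}"
proof -
  assume W: "W \<subseteq> V"
  have "{card S | S. S \<subseteq> W \<and> indep S} \<subseteq> card ` Pow W" by auto
  moreover have "finite (card ` Pow W)" using finite_subset[OF W] by simp
  ultimately show ?thesis by (rule finite_subset)
qed

lemma alpha_ge: "W \<subseteq> V \<Longrightarrow> S \<subseteq> W \<Longrightarrow> indep S \<Longrightarrow> card S \<le> alpha W"
  unfolding alpha_def using finite_alpha by (intro Max_ge) auto

lemma alpha_ex:
  assumes "W \<subseteq> V"
  obtains S where "S \<subseteq> W" "indep S" "card S = alpha W"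
proof -
  have "card {} \<in> {card S | S. S \<subseteq> W \<and> indep S}" by (intro CollectI exI[of _ "{}"]) (auto simp: indep_def)
  then have "alpha W \<in> {card S | S. S \<subseteq> W \<and> indep S}"
    unfolding alpha_def using finite_alpha[OF assms] by (intro Max_in) auto
  with that show ?thesis by auto
qed

text \<open>For \<open>t\<close> outside \<open>W\<close> this says that adding \<open>t\<close> to
  \<open>W\<close> raises the independence number.\<close>

definition full :: "'v set \<Rightarrow> 'v \<Rightarrow> bool" where
  "full W t \<longleftrightarrow> (\<exists>S\<subseteq>W. indep (insert t S) \<and> alpha W \<le> card S)"

text \<open>An independent set larger than \<open>alpha W\<close> must use \<open>Y\<close>; as it
  uses a single vertex there, removing that vertex leaves a maximum set of \<open>W\<close>.\<close>

lemma full_if_one: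
  assumes "W \<subseteq> V" "S \<subseteq> W \<union> Y" "indep S" "alpha W < card S" "finite Y"
    and "\<And>x y. \<lbrakk>x \<in> S; y \<in> S; x \<in> Y; y \<in> Y\<rbrakk> \<Longrightarrow> x = y"
  shows "\<exists>t\<in>Y. full W t"
proof -
  have "\<not> S \<subseteq> W" using alpha_ge[OF assms(1) _ assms(3)] assms(4) by auto
  then obtain t where t: "t \<in> S" "t \<in> Y" using assms(2) by auto
  have "S - {t} \<subseteq> W" using assms(2,6) t by auto
  moreover have "indep (insert t (S - {t}))" using assms(3) t by (simp add: insert_absorb)
  moreover have "alpha W \<le> card (S - {t})"
    using assms(4) t finite_subset[OF assms(2)] finite_subset[OF assms(1)] assms(5) by simp
  ultimately show ?thesis using t(2) unfolding full_def by blast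
qed

definition separation :: "'v set \<Rightarrow> 'v set \<Rightarrow> 'v set \<Rightarrow> bool" where
  "separation V1 V2 X \<longleftrightarrow> V = V1 \<union> V2 \<union> X \<and> V1 \<inter> V2 = {} \<and> V1 \<inter> X = {} \<and> V2 \<inter> X = {}
     \<and> V1 \<noteq> {} \<and> V2 \<noteq> {} \<and> (\<forall>x\<in>V1. \<forall>y\<in>V2. \<not> adj x y)"

lemma separation_sym: "separation V1 V2 X \<Longrightarrow> separation V2 V1 X"
  unfolding separation_def using adj_commute by blast

lemma separation_facts:
  assumes "separation V1 V2 X"
  shows "V1 \<subseteq> V" "V2 \<subseteq> V" "X \<subseteq> V" "finite V1" "finite V2" "finite X"
    "card V = card V1 + card V2 + card X" "alpha V1 + alpha V2 \<le> alpha V"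
    "3 * card V1 \<le> 13 * alpha V1" "3 * card V2 \<le> 13 * alpha V2" "13 * alpha V < 3 * card V"
proof -
  show sub: "V1 \<subseteq> V" "V2 \<subseteq> V" "X \<subseteq> V" using assms by (auto simp: separation_def)
  show fin: "finite V1" "finite V2" "finite X"
    using sub[THEN finite_subset[OF _ finite_V]] by auto
  show "card V = card V1 + card V2 + card X"
    using assms fin by (simp add: separation_def card_Un_disjoint Int_Un_distrib2)
  obtain S1 where S1: "S1 \<subseteq> V1" "indep S1" "card S1 = alpha V1" using alpha_ex[OF sub(1)] .
  obtain S2 where S2: "S2 \<subseteq> V2" "indep S2" "card S2 = alpha V2" using alpha_ex[OF sub(2)] .
  have cross: "\<not> adj x y \<and> \<not> adj y x" if "x \<in> S1" "y \<in> S2" for x y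
    using assms that S1(1) S2(1) adj_commute[of x y] unfolding separation_def by blast
  have "indep (S1 \<union> S2)"
    using S1(2) S2(2) cross unfolding indep_def by blast
  moreover have "card (S1 \<union> S2) = card S1 + card S2"
    using S1(1) S2(1) assms finite_subset[OF S1(1) fin(1)] finite_subset[OF S2(1) fin(2)]
    by (intro card_Un_disjoint) (auto simp: separation_def)
  moreover have "S1 \<union> S2 \<subseteq> V" using S1 S2 sub by auto
  ultimately show "alpha V1 + alpha V2 \<le> alpha V" using alpha_ge[of V "S1 \<union> S2"] S1 S2 by simp
  have sg: "3 * card W \<le> 13 * alpha W" if W: "W \<subseteq> V" "W \<noteq> V" for W
  proof -
    obtain S where "S \<subseteq> W" "indep S" "3 * card W \<le> 13 * card S" using subgraph_good[OF W] .
    then show ?thesis using alpha_ge[OF W(1)] by (meson le_trans mult_le_mono2)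
  qed
  show "3 * card V1 \<le> 13 * alpha V1" using sg[OF sub(1)] assms by (auto simp: separation_def)
  show "3 * card V2 \<le> 13 * alpha V2" using sg[OF sub(2)] assms by (auto simp: separation_def)
  obtain S where "S \<subseteq> V" "indep S" "card S = alpha V" using alpha_ex[of V] by blast
  then show "13 * alpha V < 3 * card V" using indep_imp_bound by metis
qed

lemma separation_join:
  assumes "separation V1 V2 X" "S1 \<subseteq> V1" "S2 \<subseteq> V2" "Z \<subseteq> X" "indep (Z \<union> S1)" "indep (Z \<union> S2)"
  shows "card S1 + card S2 + card Z \<le> alpha V"
proof -
  note f = separation_facts[OF assms(1)]
  have fin: "finite S1" "finite S2" "finite Z"
    using finite_subset[OF assms(2) f(4)] finite_subset[OF assms(3) f(5)] finite_subset[OF assms(4) f(6)] by auto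
  have cross: "\<not> adj x y \<and> \<not> adj y x" if "x \<in> S1" "y \<in> S2" for x y
    using assms(1-3) that adj_commute[of x y] unfolding separation_def by blast
  have "indep (S1 \<union> S2 \<union> Z)"
    using assms(5,6) cross unfolding indep_def by blast
  moreover have "card (S1 \<union> S2 \<union> Z) = card S1 + card S2 + card Z"
  proof -
    have "S1 \<inter> S2 = {}" "(S1 \<union> S2) \<inter> Z = {}" using assms unfolding separation_def by blast+
    then show ?thesis using fin by (simp add: card_Un_disjoint)
  qed
  moreover have "S1 \<union> S2 \<union> Z \<subseteq> V" using assms f by blast
  ultimately show ?thesis using alpha_ge[of V "S1 \<union> S2 \<union> Z"] by simp
qed

text \<open>A vertex full on both sides would give one independent vertex more than the two sides
  alone. It is worth 13, whereas a separator of at most four vertices costs at most 12.\<close>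

lemma no_common_full:
  assumes "separation V1 V2 X" "card X \<le> 4" "t \<in> X" "full V1 t" "full V2 t"
  shows False
proof -
  obtain S1 where S1: "S1 \<subseteq> V1" "indep (insert t S1)" "alpha V1 \<le> card S1" using assms by (auto simp: full_def)
  obtain S2 where S2: "S2 \<subseteq> V2" "indep (insert t S2)" "alpha V2 \<le> card S2" using assms by (auto simp: full_def)
  have "card S1 + card S2 + card {t} \<le> alpha V"
    using assms(3) S1 S2 by (intro separation_join[OF assms(1)]) auto
  then have "alpha V1 + alpha V2 + 1 \<le> alpha V" using S1 S2 by simp
  then show False using separation_facts[OF assms(1)] assms(2) by linarith
qed

text \<open>An independent set meets the clique at most once, so as soon as the ratio bound for
  \<open>V1 \<union> Y\<close> exceeds \<open>alpha V1\<close>, a vertex of \<open>Y\<close> is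
  full. It is applied to sets without full vertices, where it bounds \<open>alpha V1\<close> from
  below.\<close>

lemma clique_hit:
  assumes "separation V1 V2 X" "Y \<subseteq> X" "Y \<noteq> {}" "\<And>x y. x \<in> Y \<Longrightarrow> y \<in> Y \<Longrightarrow> x \<noteq> y \<Longrightarrow> adj x y"
    and "13 * alpha V1 < 3 * card V1 + 3 * card Y"
  shows "\<exists>t\<in>Y. full V1 t"
proof -
  note f = separation_facts[OF assms(1)]
  have W: "V1 \<union> Y \<subseteq> V" "V1 \<union> Y \<noteq> V" using assms(1,2) f unfolding separation_def by blast+
  obtain S where S: "S \<subseteq> V1 \<union> Y" "indep S" "3 * card (V1 \<union> Y) \<le> 13 * card S" using subgraph_good[OF W] .
  have fY: "finite Y" using f(6) assms(2) finite_subset by blast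
  have "card (V1 \<union> Y) = card V1 + card Y"
    using f(4) fY assms(1,2) by (intro card_Un_disjoint) (auto simp: separation_def)
  then have "alpha V1 < card S" using S assms(5) by linarith
  then show ?thesis
  proof (rule full_if_one[OF f(1) S(1,2) _ fY])
    fix x y assume "x \<in> S" "y \<in> S" "x \<in> Y" "y \<in> Y"
    then show "x = y" using assms(4)[of x y] S(2) by (auto simp: indep_def)
  qed
qed

text \<open>Every vertex of \<open>X\<close> fails to be full on some side. Each failure raises the
  lower bound for that side by 3/13, so the two sides together already reach the ratio for all of
  \<open>V\<close>.\<close>

lemma no_clique_separator:
  assumes "separation V1 V2 X" "card X \<le> 4" "\<And>x y. x \<in> X \<Longrightarrow> y \<in> X \<Longrightarrow> x \<noteq> y \<Longrightarrow> adj x y"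
  shows False
proof -
  note f = separation_facts[OF assms(1)]
  define Y1 where "Y1 = {t \<in> X. \<not> full V1 t}"
  define Y2 where "Y2 = {t \<in> X. \<not> full V2 t}"
  have fin: "finite Y1" "finite Y2" using f by (auto simp: Y1_def Y2_def)
  have "3 * card V1 + 3 * card Y1 \<le> 13 * alpha V1"
    using clique_hit[OF assms(1), of Y1] assms(3) f(9) by (cases "Y1 = {}") (force simp: Y1_def)+
  moreover have "3 * card V2 + 3 * card Y2 \<le> 13 * alpha V2"
    using clique_hit[OF separation_sym[OF assms(1)], of Y2] assms(3) f(10) by (cases "Y2 = {}") (force simp: Y2_def)+
  moreover have "X = Y1 \<union> Y2"
    using no_common_full[OF assms(1,2)] by (auto simp: Y1_def Y2_def)
  then have "card X \<le> card Y1 + card Y2" using fin card_Un_le by auto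
  ultimately show False using f(7,8,11) by linarith
qed

lemma reach_last:
  assumes "reach E (insert c W) a c" "a \<in> W" "c \<notin> W"
  obtains k where "reach E W a k" "k \<in> W" "adj k c"
proof -
  have "c \<in> W \<or> (\<exists>k\<in>W. reach E W a k \<and> adj k c) "
  proof (rule ccontr)
    assume *: "\<not> ?thesis"
    have "c \<in> {x. x \<in> W \<and> reach E W a x}"
    proof (rule reach_closed[OF assms(1)])
      fix x y assume x: "x \<in> {x. x \<in> W \<and> reach E W a x}" and y: "y \<in> insert c W" "{x, y} \<in> E"
      then have "y \<noteq> c" using * by (auto simp: adj_def)
      then show "y \<in> {x. x \<in> W \<and> reach E W a x}"
        using x y reach_trans[OF _ reach_step[of x W y E]] by auto
    qed (use assms in auto)
    then show False using assms by simp
  qed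
  with that assms show ?thesis by auto
qed

lemma reach_set_connected:
  assumes "a \<in> W"
  shows "connected_set {x. reach E W a x}"
proof -
  let ?K = "{x. reach E W a x}"
  have "reach E ?K a x" if "reach E W a x" for x
  proof -
    have "x \<in> {x. reach E W a x \<and> reach E ?K a x}"
    proof (rule reach_closed[OF that])
      fix x y assume x: "x \<in> {x. reach E W a x \<and> reach E ?K a x}" "x \<in> W" and y: "y \<in> W" "{x, y} \<in> E"
      then have 1: "reach E W a y" using reach_trans[OF _ reach_step[of x W y E]] by auto
      then have "reach E ?K x y" using x y by (intro reach_step) auto
      then have "reach E ?K a y" using x reach_trans[of E ?K a x y] by simp
      then show "y \<in> {x. reach E W a x \<and> reach E ?K a x}" using 1 by simp
    qed auto
    then show ?thesis by simp
  qed
  then have *: "reach E ?K a x" if "x \<in> ?K" for x using that by simp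
  show ?thesis unfolding connected_set_def
  proof (intro ballI)
    fix x y assume "x \<in> ?K" "y \<in> ?K"
    then show "reach E ?K x y" by (intro reach_trans[OF reach_sym[OF *] *])
  qed
qed

text \<open>Contracting a path through \<open>V2\<close> into one of its ends adds the chord \<open>ac\<close> to the
  subgraph on \<open>V1 \<union> Y\<close>; contracting it together with both ends identifies \<open>a\<close> with \<open>c\<close>.\<close>

lemma chord_good:
  assumes sep: "separation V1 V2 X" and Y: "Y \<subseteq> X" "a \<in> Y" "c \<in> Y" "a \<noteq> c"
    and path: "reach E (V2 \<union> {a, c}) a c"
  obtains S where "S \<subseteq> V1 \<union> Y" "indep S" "3 * card (V1 \<union> Y) \<le> 13 * card S" "\<not> (a \<in> S \<and> c \<in> S)"
proof -
  note sf = separation_facts[OF sep]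
  have aX: "a \<notin> V2" "c \<notin> V2" "a \<notin> V1" "c \<notin> V1" using Y sep by (auto simp: separation_def)
  \<comment> \<open>\<open>K\<close> omits \<open>c\<close>; the edge from its vertex
    \<open>k\<close> to \<open>c\<close> turns into the chord when \<open>K\<close> is contracted to
    \<open>a\<close>.\<close>
  define K where "K = {x. reach E (insert a V2) a x}"
  have KW: "K \<subseteq> insert a V2" using reach_in by (force simp: K_def)
  have aK: "a \<in> K" by (simp add: K_def)
  have "reach E (insert c (insert a V2)) a c" using path by (simp add: insert_commute)
  then obtain k where k: "k \<in> K" "adj k c"
    using reach_last[of c "insert a V2" a] aX Y by (auto simp: K_def)
  have conK: "connected_set K" unfolding K_def by (rule reach_set_connected) simp
  define f where "f x = (if x \<in> K then a else x)" for x
  define V0 where "V0 = V1 \<union> Y \<union> K"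
  have V0V: "V0 \<subseteq> V" using sf(1-3) Y(1,2) KW unfolding V0_def by blast
  have Kd: "K \<inter> (V1 \<union> Y) = {a}" using KW sep Y aK by (auto simp: separation_def)
  have img: "f ` V0 = V1 \<union> Y"
  proof
    show "f ` V0 \<subseteq> V1 \<union> Y" using Y by (auto simp: f_def V0_def)
    show "V1 \<union> Y \<subseteq> f ` V0"
    proof
      fix x assume x: "x \<in> V1 \<union> Y"
      then have "f x = x" using Kd by (auto simp: f_def)
      then show "x \<in> f ` V0" using x by (metis UnI1 V0_def imageI)
    qed
  qed
  have "V1 \<union> Y \<subset> V" using sf Y sep unfolding separation_def by blast
  then have lt: "card (f ` V0) < card V" unfolding img by (intro psubset_card_mono) auto
  have fib: "reach E {v \<in> V0. f v = f x} x y" if xy: "x \<in> V0" "y \<in> V0" "f x = f y" for x y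
  proof (cases "x \<in> K \<and> y \<in> K")
    case True
    then have "reach E K x y" using conK by (auto simp: connected_set_def)
    moreover have "K \<subseteq> {v \<in> V0. f v = f x}" using True by (auto simp: f_def V0_def)
    ultimately show ?thesis by (rule reach_mono)
  next
    case False
    then have "x = y" using xy aK by (auto simp: f_def split: if_splits)
    then show ?thesis by simp
  qed
  obtain S where S: "S \<subseteq> f ` V0" "3 * card (f ` V0) \<le> 13 * card S"
    and ind: "\<And>x y. \<lbrakk>x \<in> V0; y \<in> V0; f x \<in> S; f y \<in> S; adj x y\<rbrakk> \<Longrightarrow> f x = f y"
    using minor_good[OF V0V lt fib] by blast
  have fS: "f x = x \<and> x \<in> V0" if "x \<in> S" for x using that S(1) img Kd by (auto simp: f_def V0_def)
  have "indep S" unfolding indep_def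
  proof (intro ballI notI)
    fix x y assume xy: "x \<in> S" "y \<in> S" "adj x y"
    then have "x = y" using ind[of x y] fS[of x] fS[of y] by auto
    then show False using xy by simp
  qed
  moreover have "\<not> (a \<in> S \<and> c \<in> S)"
  proof
    assume ac: "a \<in> S \<and> c \<in> S"
    then have "f k = f c" using ind[of k c] k fS[of c] by (auto simp: f_def V0_def)
    then show False using ac k fS[of c] Y by (auto simp: f_def)
  qed
  ultimately show ?thesis using that[of S] S img by simp
qed

lemma identify_good:
  assumes sep: "separation V1 V2 X" and Y: "b \<in> X" "d \<in> X" "b \<noteq> d" "\<not> adj b d"
    and path: "reach E (V2 \<union> {b, d}) b d"
  obtains S where "S \<subseteq> V1 \<union> {b}" "indep S" "3 * card V1 + 3 \<le> 13 * card S"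
    "b \<in> S \<Longrightarrow> indep (insert d S)"
proof -
  note sf = separation_facts[OF sep]
  have aX: "b \<notin> V2" "d \<notin> V2" "b \<notin> V1" "d \<notin> V1" using Y sep by (auto simp: separation_def)
  define W where "W = V2 \<union> {b, d}"
  define K where "K = {x. reach E W b x}"
  have KW: "K \<subseteq> W" using reach_in[of E W b] by (auto simp: K_def W_def)
  have bK: "b \<in> K" "d \<in> K" using path by (auto simp: K_def W_def)
  have conK: "connected_set K" unfolding K_def by (rule reach_set_connected) (simp add: W_def)
  define f where "f x = (if x \<in> K then b else x)" for x
  define V0 where "V0 = V1 \<union> K"
  have V0V: "V0 \<subseteq> V" using sf(1-3) Y(1,2) KW unfolding V0_def W_def by blast
  have Kd: "K \<inter> V1 = {}" using KW sep aX by (auto simp: separation_def W_def)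
  have img: "f ` V0 = V1 \<union> {b}"
  proof
    show "f ` V0 \<subseteq> V1 \<union> {b}" by (auto simp: f_def V0_def)
    show "V1 \<union> {b} \<subseteq> f ` V0"
    proof
      fix x assume x: "x \<in> V1 \<union> {b}"
      then have "f x = x" using Kd by (auto simp: f_def)
      then show "x \<in> f ` V0" using x bK by (metis UnE UnI1 UnI2 V0_def imageI singletonD)
    qed
  qed
  have "V1 \<union> {b} \<subset> V" using sf Y sep unfolding separation_def by blast
  then have lt: "card (f ` V0) < card V" unfolding img by (intro psubset_card_mono) auto
  have fib: "reach E {v \<in> V0. f v = f x} x y" if xy: "x \<in> V0" "y \<in> V0" "f x = f y" for x y
  proof (cases "x \<in> K \<and> y \<in> K")
    case True
    then have "reach E K x y" using conK by (auto simp: connected_set_def)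
    moreover have "K \<subseteq> {v \<in> V0. f v = f x}" using True by (auto simp: f_def V0_def)
    ultimately show ?thesis by (rule reach_mono)
  next
    case False
    then have "x = y" using xy bK aX by (auto simp: f_def V0_def split: if_splits)
    then show ?thesis by simp
  qed
  obtain S where S: "S \<subseteq> f ` V0" "3 * card (f ` V0) \<le> 13 * card S"
    and ind: "\<And>x y. \<lbrakk>x \<in> V0; y \<in> V0; f x \<in> S; f y \<in> S; adj x y\<rbrakk> \<Longrightarrow> f x = f y"
    using minor_good[OF V0V lt fib] by blast
  have fS: "f x = x \<and> x \<in> V0" if "x \<in> S" for x using that S(1) img Kd bK by (auto simp: f_def V0_def)
  have iS: "indep S" unfolding indep_def
  proof (intro ballI notI)
    fix x y assume xy: "x \<in> S" "y \<in> S" "adj x y"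
    then have "x = y" using ind[of x y] fS[of x] fS[of y] by auto
    then show False using xy by simp
  qed
  moreover have "indep (insert d S)" if b: "b \<in> S"
  proof -
    have "\<not> adj d x" if x: "x \<in> S" for x
    proof
      assume a: "adj d x"
      have "f d = b" "d \<in> V0" using bK by (auto simp: f_def V0_def)
      then have "b = x" using ind[of d x] a x fS[of x] b by auto
      then show False using a Y(4) adj_sym by blast
    qed
    then show ?thesis using iS adj_commute by (auto simp: indep_def)
  qed
  moreover have "card (V1 \<union> {b}) = card V1 + 1" using aX sf by simp
  ultimately show ?thesis using that[of S] S img by simp
qed

section \<open>Separating 4-cycles\<close>

lemma quad_nonadjacent:
  assumes "adj a b" "adj b c" "adj c d" "adj d a" "x \<in> {a, b, c, d}" "y \<in> {a, b, c, d}" "indep S" "x \<in> S" "y \<in> S"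
  shows "x = y \<or> {x, y} = {a, c} \<or> {x, y} = {b, d}"
proof -
  have "\<not> adj x y" "\<not> adj y x" using assms(7-9) by (auto simp: indep_def)
  then show ?thesis using assms(1-6) by (elim insertE emptyE) (simp_all add: insert_commute)
qed

text \<open>As for a clique, except that a 4-cycle has two nonadjacent pairs. At most three corners
  contain at most one of them, and a chord through the other side makes that pair adjacent.\<close>

lemma quad_hit:
  assumes sep: "separation V1 V2 {a, b, c, d}"
    and cyc: "adj a b" "adj b c" "adj c d" "adj d a" and dist: "distinct [a, b, c, d]"
    and p2: "reach E (V2 \<union> {a, c}) a c" "reach E (V2 \<union> {b, d}) b d"
    and Y: "Y \<subseteq> {a, b, c, d}" "Y \<noteq> {}" "card Y \<le> 3"
    and lt: "13 * alpha V1 < 3 * card V1 + 3 * card Y"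
  shows "\<exists>t\<in>Y. full V1 t"
proof -
  note sf = separation_facts[OF sep]
  have fY: "finite Y" using Y finite_subset by auto
  have cY: "card (V1 \<union> Y) = card V1 + card Y"
    using sf(4) fY sep Y by (intro card_Un_disjoint) (auto simp: separation_def)
  have not4: "Y \<noteq> {a, b, c, d}" using Y(3) dist by auto
  have "\<exists>S. S \<subseteq> V1 \<union> Y \<and> indep S \<and> 3 * card (V1 \<union> Y) \<le> 13 * card S \<and>
      (\<forall>x\<in>S \<inter> Y. \<forall>y\<in>S \<inter> Y. x = y)"
  proof (cases "{a, c} \<subseteq> Y \<or> {b, d} \<subseteq> Y")
    case False
    have "Y \<subseteq> V" using Y(1) sf(3) by (rule subset_trans)
    moreover obtain v where "v \<in> V2" using sep by (auto simp: separation_def)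
    then have "v \<in> V" "v \<notin> V1 \<union> Y" using sf(2) sep Y(1) by (auto simp: separation_def)
    ultimately have W: "V1 \<union> Y \<subseteq> V" "V1 \<union> Y \<noteq> V" using sf(1) by auto
    obtain S where S: "S \<subseteq> V1 \<union> Y" "indep S" "3 * card (V1 \<union> Y) \<le> 13 * card S" using subgraph_good[OF W] .
    have "x = y" if xy: "x \<in> S \<inter> Y" "y \<in> S \<inter> Y" for x y
    proof -
      have "x = y \<or> {x, y} = {a, c} \<or> {x, y} = {b, d}"
        using xy Y(1) by (intro quad_nonadjacent[OF cyc _ _ S(2)]) auto
      then show ?thesis using xy False by (auto simp: doubleton_eq_iff)
    qed
    then show ?thesis using S by blast
  next
    case True
    then show ?thesis
    proof
      assume ac: "{a, c} \<subseteq> Y"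
      then have nbd: "\<not> (b \<in> Y \<and> d \<in> Y)" using not4 Y(1) by auto
      obtain S where S: "S \<subseteq> V1 \<union> Y" "indep S" "3 * card (V1 \<union> Y) \<le> 13 * card S" "\<not> (a \<in> S \<and> c \<in> S)"
        using chord_good[OF sep Y(1) _ _ _ p2(1)] ac dist by auto
      have "x = y" if xy: "x \<in> S \<inter> Y" "y \<in> S \<inter> Y" for x y
      proof -
        have "x = y \<or> {x, y} = {a, c} \<or> {x, y} = {b, d}"
          using xy Y(1) by (intro quad_nonadjacent[OF cyc _ _ S(2)]) auto
        then show ?thesis using xy nbd S(4) by (auto simp: doubleton_eq_iff)
      qed
      then show ?thesis using S by blast
    next
      assume bd: "{b, d} \<subseteq> Y"
      then have nac: "\<not> (a \<in> Y \<and> c \<in> Y)" using not4 Y(1) by auto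
      obtain S where S: "S \<subseteq> V1 \<union> Y" "indep S" "3 * card (V1 \<union> Y) \<le> 13 * card S" "\<not> (b \<in> S \<and> d \<in> S)"
        using chord_good[OF sep Y(1) _ _ _ p2(2)] bd dist by auto
      have "x = y" if xy: "x \<in> S \<inter> Y" "y \<in> S \<inter> Y" for x y
      proof -
        have "x = y \<or> {x, y} = {a, c} \<or> {x, y} = {b, d}"
          using xy Y(1) by (intro quad_nonadjacent[OF cyc _ _ S(2)]) auto
        then show ?thesis using xy nac S(4) by (auto simp: doubleton_eq_iff)
      qed
      then show ?thesis using S by blast
    qed
  qed
  then obtain S where S: "S \<subseteq> V1 \<union> Y" "indep S" "3 * card (V1 \<union> Y) \<le> 13 * card S"
    "\<forall>x\<in>S \<inter> Y. \<forall>y\<in>S \<inter> Y. x = y" by blast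
  have "alpha V1 < card S" using S(3) lt cY by linarith
  then show ?thesis using full_if_one[OF sf(1) S(1,2) _ fY] S(4) by blast
qed

text \<open>As no corner is full for \<open>V2\<close>, the large set obtained with the chord
  \<open>ac\<close> must contain both \<open>b\<close> and \<open>d\<close>. On the other side
  \<open>b\<close> and \<open>d\<close> are identified, so the two sets agree on the corners. Their
  union beats both sides by one vertex, worth 13 against the cost 12 of the corners.\<close>

lemma quad_separation_half:
  assumes sep: "separation V1 V2 {a, b, c, d}"
    and cyc: "adj a b" "adj b c" "adj c d" "adj d a" and dist: "distinct [a, b, c, d]"
    and non: "\<not> adj a c" "\<not> adj b d"
    and p1: "reach E (V1 \<union> {a, c}) a c" "reach E (V1 \<union> {b, d}) b d"
    and p2: "reach E (V2 \<union> {a, c}) a c" "reach E (V2 \<union> {b, d}) b d"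
    and none: "\<And>t. t \<in> {a, b, c, d} \<Longrightarrow> \<not> full V2 t"
    and r2: "3 * card V2 + 9 \<le> 13 * alpha V2"
  shows False
proof -
  let ?X = "{a, b, c, d}"
  note sf = separation_facts[OF sep]
  note sep' = separation_sym[OF sep]
  have cX: "card ?X = 4" using dist by auto
  \<comment> \<open>The surplus of 9 on the side \<open>V2\<close> leaves less than 12 - 9 = 3 for
    \<open>V1\<close>.\<close>
  have r1: "13 * alpha V1 < 3 * card V1 + 3" using sf(7,8,11) cX r2 by linarith
  have r2': "13 * alpha V2 < 3 * card V2 + 12" using sf(7-9,11) cX by linarith
  obtain S where S: "S \<subseteq> V2 \<union> ?X" "indep S" "3 * card (V2 \<union> ?X) \<le> 13 * card S" "\<not> (a \<in> S \<and> c \<in> S)"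
    using chord_good[OF sep' subset_refl _ _ _ p1(1)] dist by auto
  have "card (V2 \<union> ?X) = card V2 + 4"
    using sf cX sep by (subst card_Un_disjoint) (auto simp: separation_def)
  then have aS: "alpha V2 < card S" using S(3) r2' by linarith
  have bdS: "b \<in> S" "d \<in> S"
  proof -
    have "b \<in> S \<and> d \<in> S"
    proof (rule ccontr)
      assume n: "\<not> ?thesis"
      have "x = y" if xy: "x \<in> S" "y \<in> S" "x \<in> ?X" "y \<in> ?X" for x y
      proof -
        have "x = y \<or> {x, y} = {a, c} \<or> {x, y} = {b, d}"
          using xy by (intro quad_nonadjacent[OF cyc _ _ S(2)]) auto
        then show ?thesis using xy n S(4) by (auto simp: doubleton_eq_iff)
      qed
      then have "\<exists>t\<in>?X. full V2 t" by (intro full_if_one[OF sf(2) S(1,2) aS]) auto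
      then show False using none by blast
    qed
    then show "b \<in> S" "d \<in> S" by auto
  qed
  have "a \<notin> S" "c \<notin> S" using bdS S(2) cyc by (auto simp: indep_def)
  then have SX: "S \<inter> ?X = {b, d}" using bdS by auto
  obtain U where U: "U \<subseteq> V1 \<union> {b}" "indep U" "3 * card V1 + 3 \<le> 13 * card U" "b \<in> U \<Longrightarrow> indep (insert d U)"
    using identify_good[OF sep _ _ _ non(2) p2(2)] dist by auto
  have aU: "alpha V1 < card U" using U(3) r1 by linarith
  have bU: "b \<in> U"
  proof (rule ccontr)
    assume "b \<notin> U"
    then have "U \<subseteq> V1" using U by auto
    then show False using alpha_ge[OF sf(1) _ U(2)] aU by simp
  qed
  have fin: "finite S" "finite U" using finite_subset[OF S(1)] finite_subset[OF U(1)] sf by auto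
  have "{b, d} \<union> (U - {b}) = insert d U" using bU by auto
  moreover have "{b, d} \<union> (S - {b, d}) = S" using bdS by auto
  ultimately have "card (U - {b}) + card (S - {b, d}) + card {b, d} \<le> alpha V"
    using U S SX bU by (intro separation_join[OF sep]) auto
  moreover have "card (U - {b}) = card U - 1" using bU fin by simp
  moreover have "card (S - {b, d}) = card S - 2" using bdS fin dist by (subst card_Diff_subset) auto
  moreover have "card {b, d} = 2" using dist by auto
  ultimately have "alpha V1 + alpha V2 + 1 \<le> alpha V" using aU aS by linarith
  then show False using sf(7,9-11) cX by linarith
qed

text \<open>The non-full corners of the two sides cover all four. If each side has at most three,
  the bounds add up as for cliques; if a side has all four, three of them give its surplus of
  9.\<close>

lemma no_quad_separation:
  assumes sep: "separation V1 V2 {a, b, c, d}"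
    and cyc: "adj a b" "adj b c" "adj c d" "adj d a" and dist: "distinct [a, b, c, d]"
    and non: "\<not> adj a c" "\<not> adj b d"
    and p1: "reach E (V1 \<union> {a, c}) a c" "reach E (V1 \<union> {b, d}) b d"
    and p2: "reach E (V2 \<union> {a, c}) a c" "reach E (V2 \<union> {b, d}) b d"
  shows False
proof -
  let ?X = "{a, b, c, d}"
  note sf = separation_facts[OF sep]
  note sep' = separation_sym[OF sep]
  have cX: "card ?X = 4" using dist by auto
  define Y1 where "Y1 = {t \<in> ?X. \<not> full V1 t}"
  define Y2 where "Y2 = {t \<in> ?X. \<not> full V2 t}"
  have fin: "finite Y1" "finite Y2" by (auto simp: Y1_def Y2_def)
  have "?X = Y1 \<union> Y2"
    using no_common_full[OF sep] cX by (auto simp: Y1_def Y2_def)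
  then have c4: "4 \<le> card Y1 + card Y2" using cX card_Un_le[of Y1 Y2] by simp
  have le: "card Y1 \<le> 4" "card Y2 \<le> 4" using card_mono[of ?X Y1] card_mono[of ?X Y2] cX by (auto simp: Y1_def Y2_def)
  have h1: "3 * card V1 + 3 * card Y \<le> 13 * alpha V1" if "Y \<subseteq> Y1" "card Y \<le> 3" for Y
    using quad_hit[OF sep cyc dist p2, of Y] that sf(9) by (cases "Y = {}") (force simp: Y1_def)+
  have h2: "3 * card V2 + 3 * card Y \<le> 13 * alpha V2" if "Y \<subseteq> Y2" "card Y \<le> 3" for Y
    using quad_hit[OF sep' cyc dist p1, of Y] that sf(10) by (cases "Y = {}") (force simp: Y2_def)+
  consider "card Y1 \<le> 3" "card Y2 \<le> 3" | "card Y1 = 4" | "card Y2 = 4" using le by linarith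
  then show False
  proof cases
    case 1
    then show False using h1[of Y1] h2[of Y2] c4 sf(7,8,11) cX by simp
  next
    case 2
    then have "Y1 = ?X" using cX card_subset_eq[of ?X Y1] by (auto simp: Y1_def)
    moreover have "3 * card V1 + 9 \<le> 13 * alpha V1"
      using h1[of "{a, b, c}"] \<open>Y1 = ?X\<close> dist by auto
    ultimately show False
      using quad_separation_half[OF sep' cyc dist non p2 p1] by (auto simp: Y1_def)
  next
    case 3
    then have "Y2 = ?X" using cX card_subset_eq[of ?X Y2] by (auto simp: Y2_def)
    moreover have "3 * card V2 + 9 \<le> 13 * alpha V2"
      using h2[of "{a, b, c}"] \<open>Y2 = ?X\<close> dist by auto
    ultimately show False
      using quad_separation_half[OF sep cyc dist non p1 p2] by (auto simp: Y2_def)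
  qed
qed

section \<open>Faces of a minimal counterexample\<close>

lemma incident: "{e \<in> E. v \<in> e} = (\<lambda>w. {v, w}) ` N v"
proof
  show "{e \<in> E. v \<in> e} \<subseteq> (\<lambda>w. {v, w}) ` N v"
  proof
    fix e assume e: "e \<in> {e \<in> E. v \<in> e}"
    then obtain x y where xy: "e = {x, y}" using sgraph_edge[OF sgraph_E] by blast
    then have "e = {v, x} \<or> e = {v, y}" using e by auto
    then obtain w where w: "e = {v, w}" by blast
    then have "w \<in> N v" using e by (simp add: adj_def)
    then show "e \<in> (\<lambda>w. {v, w}) ` N v" using w by blast
  qed
qed (auto simp: adj_def)

lemma card_incident: "card {e \<in> E. v \<in> e} = card (N v)"
  unfolding incident by (rule card_image) (auto simp: inj_on_def doubleton_eq_iff)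

lemma V_nonempty: "V \<noteq> {}"
proof
  assume "V = {}"
  then show False using indep_imp_bound[of "{}"] by (simp add: indep_def)
qed

text \<open>With degree at most 3, deleting the vertex and its neighbours costs at most 12 against
  13, without any contraction.\<close>

lemma card_N_ge_4:
  assumes "v \<in> V"
  shows "4 \<le> card (N v)"
proof (rule ccontr)
  assume "\<not> ?thesis"
  then have c: "card (insert v (N v)) \<le> 4" by (simp add: card_insert_if)
  show False
    by (rule reducible[of "{v}" "insert v (N v)" "{}" "\<lambda>_. {}" "\<lambda>_. {}"])
       (use assms N_V c in \<open>auto simp: indep_def\<close>)
qed

lemma E_subset: "\<Union>E \<subseteq> V"
  using simple by (auto simp: finite_simple_graph_def)

lemma sum_card_N: "(\<Sum>v\<in>V. card (N v)) = 2 * card E"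
proof -
  have "(\<Sum>v\<in>V. card (N v)) = (\<Sum>v\<in>V. \<Sum>e\<in>E. of_bool (v \<in> e))"
    by (simp add: card_incident[symmetric] Int_def)
  also have "\<dots> = (\<Sum>e\<in>E. \<Sum>v\<in>V. of_bool (v \<in> e))" by (rule sum.swap)
  also have "\<dots> = (\<Sum>e\<in>E. 2)"
  proof (rule sum.cong[OF refl])
    fix e assume e: "e \<in> E"
    then have "V \<inter> {v. v \<in> e} = e" "card e = 2" using E_subset sgraph_E by (auto simp: sgraph_def)
    then show "(\<Sum>v\<in>V. of_bool (v \<in> e)) = (2::nat)" by simp
  qed
  finally show ?thesis by simp
qed

lemma card_V_less_E: "card V < card E"
proof -
  have "4 * card V \<le> (\<Sum>v\<in>V. card (N v))"
    using sum_bounded_below[of V 4 "\<lambda>v. card (N v)"] card_N_ge_4 by (simp add: mult.commute)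
  moreover have "0 < card V" using V_nonempty by (simp add: card_gt_0_iff)
  ultimately show ?thesis using sum_card_N by simp
qed

lemma card_V_ge_5: "5 \<le> card V"
proof -
  obtain v where v: "v \<in> V" using V_nonempty by auto
  have "insert v (N v) \<subseteq> V" using v N_V by auto
  then have "card (insert v (N v)) \<le> card V" by (intro card_mono) auto
  then show ?thesis using card_N_ge_4[OF v] by simp
qed

lemma sum_card_N_less: "(\<Sum>v\<in>V. card (N v)) + 12 \<le> 6 * card V"
proof -
  have "card E + 6 \<le> 3 * card V"
    using euler_bound[OF sgraph_E finite_V E_subset _ maclane] card_V_ge_5 by simp
  then show ?thesis using sum_card_N by simp
qed

text \<open>A vertex not reached would make \<open>X\<close> a separator, and a set of at most one
  vertex is a clique. Empty \<open>X\<close> gives connectedness, a single vertex gives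
  2-connectedness.\<close>

lemma reach_avoiding:
  assumes "card X \<le> 1" "X \<subseteq> V" "a \<in> V - X" "b \<in> V - X"
  shows "reach E (V - X) a b"
proof (rule ccontr)
  assume n: "\<not> ?thesis"
  let ?K = "{x. reach E (V - X) a x}"
  have K: "?K \<subseteq> V - X"
  proof
    fix x assume "x \<in> ?K"
    then show "x \<in> V - X" using reach_in[of E "V - X" a x] assms(3) by simp
  qed
  have sep: "separation ?K (V - X - ?K) X"
    unfolding separation_def
  proof (intro conjI ballI)
    fix x y assume xy: "x \<in> ?K" "y \<in> V - X - ?K"
    show "\<not> adj x y"
    proof
      assume "adj x y"
      then have "reach E (V - X) x y" using xy K by (intro reach_step) (auto simp: adj_def)
      then show False using xy reach_trans[of E "V - X" a x y] by auto
    qed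
  next
    show "?K \<noteq> {}" using reach_refl[of E "V - X" a] by blast
    show "V - X - ?K \<noteq> {}" using assms n by auto
    show "V = ?K \<union> (V - X - ?K) \<union> X" "?K \<inter> X = {}" using K assms(2) by blast+
  qed auto
  have eq: "x = y" if "x \<in> X" "y \<in> X" for x y
  proof -
    have "finite X" using finite_subset[OF assms(2)] by simp
    then have "card {x, y} \<le> 1" using assms(1) that card_mono[of X "{x, y}"] by simp
    then show ?thesis by (cases "x = y") auto
  qed
  show False
  proof (rule no_clique_separator[OF sep])
    show "card X \<le> 4" using assms(1) by simp
  qed (use eq in blast)
qed

text \<open>Supplies cycles through \<open>v\<close> along two prescribed edges; they are the test
  vectors that detect parity failures at \<open>v\<close>.\<close>

lemma cycle_through:
  assumes "adj v a" "adj v b" "a \<noteq> b"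
  obtains z where "z \<in> cyc E" "{e \<in> z. v \<in> e} = {{v, a}, {v, b}}"
proof -
  have vab: "v \<in> V" "a \<in> V" "b \<in> V" "a \<noteq> v" "b \<noteq> v" using assms adj_V by auto
  have "reach E (V - {v}) a b" using vab by (intro reach_avoiding) auto
  then obtain y where y: "y \<subseteq> {e \<in> E. e \<subseteq> V - {v}}" "bd y = sd {a} {b}"
    using reach_join[OF sgraph_E] by metis
  have fy: "finite y" using finite_subset[OF y(1)] by simp
  have n: "{v, a} \<noteq> {v, b}" using assms(3) by (auto simp: doubleton_eq_iff)
  have "bd {{v, a}, {v, b}} = sd {v, a} {v, b}" using bd_insert[of "{{v, b}}" "{v, a}"] n by simp
  also have "\<dots> = sd {a} {b}" using vab by (auto simp: sd_def)
  finally have "bd {{v, a}, {v, b}} = sd {a} {b}" .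
  moreover have "y \<inter> {{v, a}, {v, b}} = {}" using y by auto
  ultimately have "bd (y \<union> {{v, a}, {v, b}}) = {}"
    using bd_Un_disjoint[OF fy, of "{{v, a}, {v, b}}"] y(2) by (simp only: sd_empty finite.intros)
  then have "y \<union> {{v, a}, {v, b}} \<in> cyc E" using y assms by (auto simp: cyc_def adj_def)
  moreover have "{e \<in> y \<union> {{v, a}, {v, b}}. v \<in> e} = {{v, a}, {v, b}}" using y by auto
  ultimately show ?thesis by (rule that)
qed

text \<open>The faces of the triangulation, including the outer one.\<close>

definition Psi :: "'v set set set" where
  "Psi = (SOME P. mac E P \<and> xsum P = {} \<and> {} \<notin> P \<and> (\<forall>S\<subseteq>P. xsum S = {} \<longrightarrow> S = {} \<or> S = P))"

lemma Psi: "mac E Psi" "xsum Psi = {}" "{} \<notin> Psi"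
  "\<And>S. S \<subseteq> Psi \<Longrightarrow> xsum S = {} \<Longrightarrow> S = {} \<or> S = Psi"
proof -
  obtain P where "mac E P" "xsum P = {}" "{} \<notin> P" "\<And>S. S \<subseteq> P \<Longrightarrow> xsum S = {} \<Longrightarrow> S = {} \<or> S = P"
    using mac_double_basis[OF sgraph_E maclane finite_V E_subset V_nonempty card_V_less_E] by blast
  then have "\<exists>P. mac E P \<and> xsum P = {} \<and> {} \<notin> P \<and> (\<forall>S\<subseteq>P. xsum S = {} \<longrightarrow> S = {} \<or> S = P)"
    by blast
  then have "mac E Psi \<and> xsum Psi = {} \<and> {} \<notin> Psi \<and> (\<forall>S\<subseteq>Psi. xsum S = {} \<longrightarrow> S = {} \<or> S = Psi)"
    unfolding Psi_def by (rule someI_ex)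
  then show "mac E Psi" "xsum Psi = {}" "{} \<notin> Psi"
    "\<And>S. S \<subseteq> Psi \<Longrightarrow> xsum S = {} \<Longrightarrow> S = {} \<or> S = Psi" by simp_all
qed

lemma finite_Psi [simp]: "finite Psi"
  using mac_finite[OF sgraph_E Psi(1)] .

lemma Psi_cyc: "F \<in> Psi \<Longrightarrow> F \<subseteq> E" "F \<in> Psi \<Longrightarrow> bd F = {}"
  using Psi(1) by (auto simp: mac_def cyc_def)

lemma zspan_Psi: "z \<in> cyc E \<Longrightarrow> z \<in> zspan Psi"
  using Psi(1) by (auto simp: mac_def)

lemma Psi_le_2: "card {F \<in> Psi. e \<in> F} \<le> 2"
  using Psi(1) by (auto simp: mac_def cover2_def)

lemma Psi_third:
  assumes "A \<in> Psi" "B \<in> Psi" "C \<in> Psi" "e \<in> A" "e \<in> B" "e \<in> C" "A \<noteq> B"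
  shows "C = A \<or> C = B"
  using card_le_2_third[OF Psi_le_2[of e], of A B C] assms by auto

lemma xsum_complement:
  assumes "S \<subseteq> Psi"
  shows "xsum (Psi - S) = xsum S"
proof -
  have "Psi - S = sd S Psi" using assms by (auto simp: sd_def)
  then show ?thesis using xsum_sd[of S Psi] finite_subset[OF assms] Psi(2) by simp
qed

lemma cyc_xsum:
  assumes "z \<in> cyc E"
  obtains S where "S \<subseteq> Psi" "z = xsum S"
  using zspan_imp_xsum[OF zspan_Psi[OF assms]] that by metis

text \<open>Suppose \<open>F\<close> properly contains a cycle \<open>C\<close>, the sum of a set
  \<open>S\<close> of faces without \<open>F\<close>. Then \<open>A = \<Union>S\<close> meets every
  face in a cycle, and by linearity every cycle in a cycle. But some vertex \<open>v\<close> has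
  edges both in \<open>A\<close> and outside, and a cycle through one of each meets \<open>A\<close>
  in a set of odd degree at \<open>v\<close>.\<close>

lemma Psi_circuit:
  assumes F: "F \<in> Psi"
  shows "circuit F"
proof (rule ccontr)
  assume "\<not> circuit F"
  then obtain C where C: "C \<subseteq> F" "bd C = {}" "C \<noteq> {}" "C \<noteq> F"
    using Psi(3) F Psi_cyc(2)[OF F] by (auto simp: circuit_def)
  have "C \<in> cyc E" using C Psi_cyc(1)[OF F] by (auto simp: cyc_def)
  then obtain S0 where S0: "S0 \<subseteq> Psi" "C = xsum S0" using cyc_xsum by metis
  define S where "S = (if F \<in> S0 then Psi - S0 else S0)"
  have S: "S \<subseteq> Psi" "C = xsum S" "F \<notin> S" using S0 xsum_complement[OF S0(1)] F by (auto simp: S_def)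
  have oddC: "e \<in> C \<longleftrightarrow> odd (card {H \<in> S. e \<in> H})" for e using S(2) by (simp add: xsum_def)
  define A where "A = \<Union>S"
  have one: "e \<in> C" if e: "e \<in> H" "H \<in> S" "e \<in> G" "G \<in> Psi - S" for e H G
  proof -
    have "{H' \<in> S. e \<in> H'} = {H}" using Psi_third[of H G _ e] e S(1) by blast
    then show ?thesis using oddC by simp
  qed
  have FA: "F \<inter> A = C"
  proof
    show "F \<inter> A \<subseteq> C" using one F S(3) by (auto simp: A_def)
    show "C \<subseteq> F \<inter> A"
    proof
      fix e assume e: "e \<in> C"
      have "{H \<in> S. e \<in> H} \<noteq> {}"
      proof
        assume "{H \<in> S. e \<in> H} = {}"
        from oddC[of e, unfolded this] show False using e by simp
      qed
      then show "e \<in> F \<inter> A" using e C by (auto simp: A_def)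
    qed
  qed
  have HA: "bd (H \<inter> A) = {}" if H: "H \<in> Psi" for H
  proof -
    \<comment> \<open>A face in \<open>S\<close> lies in \<open>A\<close>, \<open>F\<close> meets
      \<open>A\<close> in \<open>C\<close>, and any other face misses \<open>A\<close>: a common
      edge would lie in \<open>C\<close>, hence in three faces.\<close>
    consider "H \<in> S" | "H = F" | "H \<notin> S" "H \<noteq> F" by auto
    then show ?thesis
    proof cases
      case 1
      then have "H \<inter> A = H" by (auto simp: A_def)
      then show ?thesis using Psi_cyc(2)[OF H] by simp
    next
      case 2
      then show ?thesis using FA C by simp
    next
      case 3
      have "H \<inter> A = {}"
      proof (rule ccontr)
        assume "H \<inter> A \<noteq> {}"
        then obtain e G where e: "e \<in> H" "e \<in> G" "G \<in> S" by (auto simp: A_def)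
        then have "e \<in> C" using one[of e G H] H 3 by auto
        then have "e \<in> F" using C by auto
        then have "F = G \<or> F = H" using Psi_third[of G H F e] e H F S 3 by blast
        then show False using e 3 S by auto
      qed
      then show ?thesis by simp
    qed
  qed
  have zA: "bd (z \<inter> A) = {}" if "z \<in> cyc E" for z
  proof -
    have "z \<subseteq> E \<and> bd (z \<inter> A) = {}" using zspan_Psi[OF that]
    proof (induction rule: zspan.induct)
      case (zspan_step H z)
      have "finite (H \<inter> A)" "finite (z \<inter> A)"
        using finite_subset[of H E] finite_subset[of z E] Psi_cyc(1) zspan_step by auto
      then have "bd (sd H z \<inter> A) = {}" using zspan_step(3) HA[OF zspan_step(1)] by (simp add: Int_sd bd_sd)
      moreover have "sd H z \<subseteq> E" using zspan_step(3) Psi_cyc(1)[OF zspan_step(1)] by (auto simp: sd_def)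
      ultimately show ?case by simp
    qed auto
    then show ?thesis by simp
  qed
  obtain e1 where e1: "e1 \<in> A" "e1 \<in> E" using C FA Psi_cyc(1)[OF F] by blast
  obtain e2 where e2: "e2 \<in> E" "e2 \<notin> A" using C FA Psi_cyc(1)[OF F] by blast
  have AE: "A \<subseteq> E" using S(1) Psi_cyc(1) by (auto simp: A_def)
  \<comment> \<open>Otherwise \<open>A\<close> would be closed under adjacency of edges and, by
    connectedness, would contain all of \<open>E\<close>.\<close>
  have "\<exists>v a b. {v, a} \<in> A \<and> {v, b} \<in> E \<and> {v, b} \<notin> A"
  proof (rule ccontr)
    assume n: "\<not> ?thesis"
    obtain x y where xy: "e1 = {x, y}" using sgraph_edge[OF sgraph_E e1(2)] by blast
    obtain u w where uw: "e2 = {u, w}" using sgraph_edge[OF sgraph_E e2(1)] by blast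
    have xV: "x \<in> V" "u \<in> V" using e1 e2 xy uw E_subset by auto
    have "u \<in> \<Union>A"
    proof (rule reach_closed[of E "V - {}" x])
      show "reach E (V - {}) x u" using xV by (intro reach_avoiding) auto
      show "b \<in> \<Union>A" if ab: "a \<in> \<Union>A" "{a, b} \<in> E" for a b
      proof -
        obtain e where e: "e \<in> A" "a \<in> e" using ab by auto
        then obtain p q where "e = {p, q}" using sgraph_edge[OF sgraph_E] AE by blast
        then obtain c where "e = {a, c}" using e by auto
        then have "{a, b} \<in> A" using n e ab by blast
        then show ?thesis by auto
      qed
    qed (use e1 xy in auto)
    then obtain e where e: "e \<in> A" "u \<in> e" by auto
    then obtain p q where "e = {p, q}" using sgraph_edge[OF sgraph_E] AE by blast
    then have "e = {u, p} \<or> e = {u, q}" using e by auto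
    then obtain c where "{u, c} \<in> A" using e by blast
    then show False using n uw e2 by blast
  qed
  then obtain v a b where vab: "{v, a} \<in> A" "{v, b} \<in> E" "{v, b} \<notin> A" by blast
  have "adj v a" "adj v b" "a \<noteq> b" using vab AE by (auto simp: adj_def)
  then obtain z where z: "z \<in> cyc E" "{e \<in> z. v \<in> e} = {{v, a}, {v, b}}" using cycle_through by blast
  have "{e \<in> z \<inter> A. v \<in> e} = {e \<in> z. v \<in> e} \<inter> A" by auto
  also have "\<dots> = {{v, a}}" using z vab by auto
  finally have "v \<in> bd (z \<inter> A)" by (simp add: bd_def)
  then show False using zA[OF z(1)] by simp
qed

text \<open>Two nonadjacent vertices on a face could be joined inside it, against the maximality of
  the edge set.\<close>

lemma Psi_clique:
  assumes "F \<in> Psi" "a \<in> \<Union>F" "b \<in> \<Union>F" "a \<noteq> b"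
  shows "adj a b"
proof (rule ccontr)
  assume "\<not> adj a b"
  then have n: "{a, b} \<notin> E" by (simp add: adj_def)
  obtain A B where "mac (insert {a, b} E) (Psi - {F} \<union> {A, B})"
    using mac_add_edge[OF sgraph_E Psi(1) assms(1) Psi_circuit[OF assms(1)] assms(2-4) n] by metis
  then have "maclane (insert {a, b} E)" by (auto simp: maclane_def)
  moreover have "{a, b} \<subseteq> V" using assms Psi_cyc(1)[OF assms(1)] E_subset by auto
  ultimately show False using maximal[of "{a, b}"] n assms(4) by auto
qed

definition tri :: "'v \<Rightarrow> 'v \<Rightarrow> 'v \<Rightarrow> 'v set set" where
  "tri a b c = {{a, b}, {b, c}, {c, a}}"

text \<open>Vertices on a face are pairwise adjacent, and \<open>no_clique4_on_face\<close> excludes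
  four of them; a nonzero cycle has at least three edges, so all three possible ones occur.\<close>

lemma Psi_tri:
  assumes F: "F \<in> Psi"
  obtains a b c where "F = tri a b c" "a \<noteq> b" "b \<noteq> c" "c \<noteq> a"
proof -
  have FE: "F \<subseteq> E" and bF: "bd F = {}" using Psi_cyc[OF F] by auto
  have c3: "3 \<le> card F"
    using card_cyc_ge_3[OF sgraph_E, of F] F FE bF Psi(3) by (auto simp: cyc_def)
  have fU: "finite (\<Union>F)" using FE E_subset by (intro finite_subset[of "\<Union>F" V]) auto
  have pairs: "\<exists>x y. e = {x, y} \<and> x \<noteq> y \<and> x \<in> \<Union>F \<and> y \<in> \<Union>F" if e: "e \<in> F" for e
  proof -
    have "e \<in> E" using e FE by auto
    then obtain x y where "e = {x, y}" "x \<noteq> y" using sgraph_edge[OF sgraph_E] by blast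
    then show ?thesis using e by blast
  qed
  have U3: "3 \<le> card (\<Union>F)"
  proof (rule ccontr)
    assume "\<not> ?thesis"
    then have "card (\<Union>F) \<le> 2" by simp
    obtain e where e: "e \<in> F" using c3 by fastforce
    have "f = e" if f: "f \<in> F" for f
    proof -
      have ce: "g = \<Union>F" if g: "g \<in> F" for g
      proof (rule card_seteq[OF fU])
        have "card g = 2" using g FE sgraph_E by (auto simp: sgraph_def)
        then show "card (\<Union>F) \<le> card g" using \<open>card (\<Union>F) \<le> 2\<close> by simp
      qed (use g in blast)
      show ?thesis using ce[OF e] ce[OF f] by (rule trans[OF _ sym, rotated])
    qed
    then have "F = {e}" using e by blast
    then show False using c3 by simp
  qed
  have "card (\<Union>F) < 4"
  proof (rule ccontr)
    assume "\<not> ?thesis"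
    then obtain Q where Q: "Q \<subseteq> \<Union>F" "card Q = 4" using obtain_subset_with_card_n[of 4 "\<Union>F"] by auto
    have "card Q = Suc 3" using Q(2) by simp
    then obtain a Q' where a: "Q = insert a Q'" "a \<notin> Q'" "card Q' = 3" unfolding card_Suc_eq by blast
    then obtain b c d where bcd: "Q' = {b, c, d}" "b \<noteq> c" "b \<noteq> d" "c \<noteq> d" by (auto simp: card_3_iff)
    have abcd: "a \<in> \<Union>F" "b \<in> \<Union>F" "c \<in> \<Union>F" "d \<in> \<Union>F" using Q a bcd by auto
    have dis: "distinct [a, b, c, d]" using a bcd by auto
    have "{a, b} \<in> E" "{a, c} \<in> E" "{a, d} \<in> E" "{b, c} \<in> E" "{b, d} \<in> E" "{c, d} \<in> E"
      using Psi_clique[OF F] abcd dis by (auto simp: adj_def)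
    then show False
      using no_clique4_on_face[OF infinite_type sgraph_E Psi(1) F Psi_circuit[OF F] abcd dis] by blast
  qed
  then have "card (\<Union>F) = 3" using U3 by simp
  then obtain a b c where abc: "\<Union>F = {a, b, c}" "a \<noteq> b" "b \<noteq> c" "a \<noteq> c" by (auto simp: card_3_iff)
  have "F \<subseteq> tri a b c"
  proof
    fix e assume "e \<in> F"
    then obtain x y where xy: "e = {x, y}" "x \<noteq> y" "x \<in> \<Union>F" "y \<in> \<Union>F" using pairs by blast
    then show "e \<in> tri a b c" unfolding abc(1) tri_def by (auto simp: insert_commute)
  qed
  moreover have "card (tri a b c) \<le> 3" unfolding tri_def by (simp add: card_insert_if)
  ultimately have "F = tri a b c" using c3 by (intro card_seteq) (auto simp: tri_def)
  then show ?thesis using that abc by metis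
qed

lemma edge_in_face:
  assumes "{v, a} \<in> E"
  shows "\<exists>F\<in>Psi. {v, a} \<in> F"
proof -
  have va: "adj v a" using assms by (simp add: adj_def)
  then have "\<not> N v \<subseteq> {a}" using card_N_ge_4[of v] adj_V card_mono[of "{a}" "N v"] by auto
  then obtain b where b: "adj v b" "a \<noteq> b" by (auto simp: N_def)
  obtain z where z: "z \<in> cyc E" "{e \<in> z. v \<in> e} = {{v, a}, {v, b}}" using cycle_through[OF va b] .
  obtain S where S: "S \<subseteq> Psi" "z = xsum S" using cyc_xsum[OF z(1)] .
  have "{v, a} \<in> z" using z(2) by auto
  then have odd: "odd (card {F \<in> S. {v, a} \<in> F})" using S(2) by (simp add: xsum_def)
  have "{F \<in> S. {v, a} \<in> F} \<noteq> {}"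
  proof
    assume "{F \<in> S. {v, a} \<in> F} = {}"
    from odd[unfolded this] show False by simp
  qed
  then show ?thesis using S by auto
qed

text \<open>The vanishing full sum makes the cover count even, the covering condition bounds it by
  2, and a cycle through the edge shows that it is not 0.\<close>

lemma edge_in_2_faces:
  assumes "e \<in> E"
  shows "card {F \<in> Psi. e \<in> F} = 2"
proof -
  obtain v a where "e = {v, a}" using sgraph_edge[OF sgraph_E assms] by blast
  then have "{F \<in> Psi. e \<in> F} \<noteq> {}" using edge_in_face assms by blast
  then have "card {F \<in> Psi. e \<in> F} \<noteq> 0" by simp
  moreover have "even (card {F \<in> Psi. e \<in> F})" using Psi(2) by (auto simp: xsum_def)
  ultimately show ?thesis using Psi_le_2[of e] by presburger
qed

text \<open>Adjacency in the link of \<open>v\<close>, which turns out to be a single cycle.\<close>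

definition link :: "'v \<Rightarrow> 'v \<Rightarrow> 'v \<Rightarrow> bool" where
  "link v x y \<longleftrightarrow> tri v x y \<in> Psi \<and> x \<noteq> y"

lemma tri_rotate: "tri a b c = tri b c a"
  by (auto simp: tri_def)

lemma tri_flip: "tri a b c = tri a c b"
  by (auto simp: tri_def insert_commute)

lemma link_sym: "link v x y \<Longrightarrow> link v y x"
  by (auto simp: link_def tri_flip[of v x y])

lemma link_adj:
  assumes "link v x y"
  shows "adj v x" "adj v y" "adj x y"
  using assms Psi_cyc(1)[of "tri v x y"] by (auto simp: link_def tri_def adj_def insert_commute)

lemma face_at_edge:
  assumes "F \<in> Psi" "{v, x} \<in> F"
  obtains y where "F = tri v x y" "link v x y"
proof -
  obtain a b c where abc: "F = tri a b c" "a \<noteq> b" "b \<noteq> c" "c \<noteq> a" using Psi_tri[OF assms(1)] .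
  have "\<exists>y. F = tri v x y \<and> y \<noteq> x"
  proof -
    have "{v, x} = {a, b} \<or> {v, x} = {b, c} \<or> {v, x} = {c, a}" using assms(2) abc(1) by (simp add: tri_def)
    then have "(v = a \<and> x = b) \<or> (v = b \<and> x = a) \<or> (v = b \<and> x = c) \<or> (v = c \<and> x = b)
        \<or> (v = c \<and> x = a) \<or> (v = a \<and> x = c)"
      by (auto simp: doubleton_eq_iff)
    then show ?thesis
      using abc tri_rotate[of a b c] tri_rotate[of b c a] tri_flip[of a b c] tri_flip[of b c a] tri_flip[of c a b]
      by metis
  qed
  then obtain y where "F = tri v x y" "y \<noteq> x" by auto
  then show ?thesis using that assms(1) by (auto simp: link_def)
qed

lemma tri_inj: "v \<noteq> y \<Longrightarrow> v \<noteq> x \<Longrightarrow> x \<noteq> y \<Longrightarrow> tri v x y = tri v x z \<Longrightarrow> y = z"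
proof -
  assume *: "v \<noteq> y" "v \<noteq> x" "x \<noteq> y" "tri v x y = tri v x z"
  have "{x, y} \<in> tri v x y" by (simp add: tri_def)
  then have "{x, y} \<in> tri v x z" using *(4) by simp
  then have "{x, y} = {v, x} \<or> {x, y} = {x, z} \<or> {x, y} = {z, v}" by (simp add: tri_def)
  then show ?thesis using *(1-3) by (auto simp: doubleton_eq_iff)
qed

lemma card_link:
  assumes "adj v x"
  shows "card {y. link v x y} = 2"
proof -
  have "{F \<in> Psi. {v, x} \<in> F} = tri v x ` {y. link v x y}"
  proof
    show "{F \<in> Psi. {v, x} \<in> F} \<subseteq> tri v x ` {y. link v x y}"
      using face_at_edge by blast
    show "tri v x ` {y. link v x y} \<subseteq> {F \<in> Psi. {v, x} \<in> F}"
      by (auto simp: link_def tri_def)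
  qed
  moreover have "inj_on (tri v x) {y. link v x y}"
  proof (rule inj_onI)
    fix y z assume yz: "y \<in> {y. link v x y}" "z \<in> {y. link v x y}" "tri v x y = tri v x z"
    then have "adj v y" "adj x y" using link_adj[of v x y] by auto
    then have "v \<noteq> y" "x \<noteq> y" "v \<noteq> x" using assms by auto
    then show "y = z" using tri_inj yz(3) by metis
  qed
  ultimately have "card {F \<in> Psi. {v, x} \<in> F} = card {y. link v x y}" using card_image by metis
  then show ?thesis using edge_in_2_faces[of "{v, x}"] assms by (simp add: adj_def)
qed

lemma star_Int_tri:
  assumes "F \<in> Psi" "\<And>x y. link v x y \<Longrightarrow> tri v x y = F \<Longrightarrow> x \<in> X \<longleftrightarrow> y \<in> X"
  shows "even (card (F \<inter> (\<lambda>x. {v, x}) ` X))"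
proof (cases "F \<inter> (\<lambda>x. {v, x}) ` X = {}")
  case False
  then obtain x where x: "x \<in> X" "{v, x} \<in> F" by auto
  obtain y where y: "F = tri v x y" "link v x y" using face_at_edge[OF assms(1) x(2)] .
  have yX: "y \<in> X" using assms(2)[of x y] y x by simp
  have n: "v \<noteq> x" "v \<noteq> y" "x \<noteq> y" using link_adj[OF y(2)] by auto
  have "F \<inter> (\<lambda>x. {v, x}) ` X = {{v, x}, {v, y}}"
    using y(1) x yX n by (auto simp: tri_def doubleton_eq_iff)
  moreover have "{v, x} \<noteq> {v, y}" using n by (auto simp: doubleton_eq_iff)
  ultimately show ?thesis by simp
qed simp

text \<open>If the link split, the edges from \<open>v\<close> to \<open>X\<close> would meet every
  face, and so every cycle, evenly; but a cycle that passes \<open>v\<close> from a neighbour in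
  \<open>X\<close> to one outside meets them once.\<close>

lemma link_connected:
  assumes "X \<subseteq> N v" "X \<noteq> {}" "\<And>x y. x \<in> X \<Longrightarrow> link v x y \<Longrightarrow> y \<in> X"
  shows "X = N v"
proof (rule ccontr)
  assume "X \<noteq> N v"
  then obtain y where y: "y \<notin> X" "adj v y" using assms(1) by (auto simp: N_def)
  obtain x where "x \<in> X" using assms(2) by auto
  then have xy: "x \<in> X" "adj v x" "y \<notin> X" "adj v y" using y assms(1) by auto
  obtain z where z: "z \<in> cyc E" "{e \<in> z. v \<in> e} = {{v, x}, {v, y}}"
    using cycle_through[OF xy(2,4)] xy by metis
  have "{v, y} \<notin> (\<lambda>x. {v, x}) ` X"
  proof
    assume "{v, y} \<in> (\<lambda>x. {v, x}) ` X"
    then obtain x' where "x' \<in> X" "{v, y} = {v, x'}" by auto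
    then show False using xy by (auto simp: doubleton_eq_iff)
  qed
  moreover have "{v, x} \<in> (\<lambda>x. {v, x}) ` X" using xy by auto
  moreover have "z \<inter> (\<lambda>x. {v, x}) ` X = {e \<in> z. v \<in> e} \<inter> (\<lambda>x. {v, x}) ` X" by auto
  moreover have "{{v, x}, {v, y}} \<inter> Y = {{v, x}}" if "{v, y} \<notin> Y" "{v, x} \<in> Y" for Y
    using that by auto
  ultimately have "z \<inter> (\<lambda>x. {v, x}) ` X = {{v, x}}" by (simp only: z(2))
  then have "odd (card (z \<inter> (\<lambda>x. {v, x}) ` X))" by simp
  moreover have "even (card (z \<inter> (\<lambda>x. {v, x}) ` X))"
  proof (rule zspan_even[OF zspan_Psi[OF z(1)] finite_E])
    show "\<Union>Psi \<subseteq> E" using Psi_cyc(1) by auto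
    fix F assume "F \<in> Psi"
    then show "even (card (F \<inter> (\<lambda>x. {v, x}) ` X))"
      using assms(3) link_sym by (intro star_Int_tri) blast+
  qed
  ultimately show False by simp
qed

text \<open>A cycle \<open>z\<close> is the sum of a set \<open>S\<close> of faces, and also of the complementary set; the
  vertices off \<open>z\<close> are thereby divided into two sides.\<close>

definition side :: "'v set set \<Rightarrow> 'v set set set \<Rightarrow> 'v set" where
  "side z S = {w \<in> V - \<Union>z. \<exists>F\<in>S. w \<in> \<Union>F}"

text \<open>An edge at a vertex \<open>w\<close> off the cycle lies in an even number of faces of
  \<open>S\<close>, hence in none of them or with both of its faces; so membership in
  \<open>S\<close> is constant along the connected link of \<open>w\<close>.\<close>

lemma side_closed:
  assumes "S \<subseteq> Psi" "z = xsum S" "w \<in> V - \<Union>z" "F \<in> S" "w \<in> \<Union>F" "G \<in> Psi" "w \<in> \<Union>G"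
  shows "G \<in> S"
proof -
  define X where "X = {x. \<exists>H\<in>S. {w, x} \<in> H}"
  have both: "H \<in> S" if H: "H \<in> Psi" "{w, x} \<in> H" "x \<in> X" for H x
  proof -
    obtain H0 where H0: "H0 \<in> S" "{w, x} \<in> H0" using H by (auto simp: X_def)
    have "{w, x} \<notin> z" using assms(3) by auto
    then have even: "even (card {H \<in> S. {w, x} \<in> H})" using assms(2) by (simp add: xsum_def)
    have "{H \<in> S. {w, x} \<in> H} \<noteq> {H0}"
    proof
      assume eq: "{H \<in> S. {w, x} \<in> H} = {H0}"
      from even[unfolded eq] show False by simp
    qed
    then obtain H1 where H1: "H1 \<in> S" "{w, x} \<in> H1" "H1 \<noteq> H0" using H0 by blast
    have "H = H0 \<or> H = H1" using Psi_third[of H0 H1 H "{w, x}"] H H0 H1 assms(1) by blast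
    then show ?thesis using H0 H1 by auto
  qed
  have at: "\<exists>x. {w, x} \<in> H" if H: "H \<in> Psi" "w \<in> \<Union>H" for H
  proof -
    obtain e where e: "e \<in> H" "w \<in> e" using H by auto
    then obtain p q where "e = {p, q}" using sgraph_edge[OF sgraph_E] Psi_cyc(1)[OF H(1)] by blast
    then have "e = {w, p} \<or> e = {w, q}" using e by auto
    then show ?thesis using e by auto
  qed
  have "X = N w"
  proof (rule link_connected)
    show "X \<subseteq> N w"
    proof
      fix x assume "x \<in> X"
      then obtain H where H: "H \<in> S" "{w, x} \<in> H" by (auto simp: X_def)
      then have "H \<subseteq> E" using Psi_cyc(1) assms(1) by auto
      then show "x \<in> N w" using H by (auto simp: adj_def)
    qed
    have "F \<in> Psi" using assms(1,4) by auto
    then obtain x where "{w, x} \<in> F" using at[of F] assms(5) by auto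
    then show "X \<noteq> {}" using assms(4) by (auto simp: X_def)
    fix x y assume x: "x \<in> X" and l: "link w x y"
    have "tri w x y \<in> S" using both[of "tri w x y" x] l x by (auto simp: link_def tri_def)
    moreover have "{w, y} \<in> tri w x y" by (auto simp: tri_def insert_commute)
    ultimately show "y \<in> X" by (auto simp: X_def)
  qed
  moreover obtain x where x: "{w, x} \<in> G" using at[OF assms(6,7)] by auto
  then have "x \<in> N w" using Psi_cyc(1)[OF assms(6)] by (auto simp: adj_def)
  ultimately show ?thesis using both[OF assms(6) x] by simp
qed

text \<open>An edge between the sides would lie in a face with a vertex on each, although all faces
  at a vertex off \<open>z\<close> belong to the same side. The two given faces with a vertex off
  \<open>z\<close> make both sides nonempty.\<close>

lemma side_separation:
  assumes S: "S \<subseteq> Psi" "z = xsum S" and "\<Union>z \<subseteq> V"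
    and F: "F \<in> S" "\<not> \<Union>F \<subseteq> \<Union>z" and G: "G \<in> Psi - S" "\<not> \<Union>G \<subseteq> \<Union>z"
  shows "separation (side z S) (side z (Psi - S)) (\<Union>z)"
proof -
  have UV: "\<Union>H \<subseteq> V" if "H \<in> Psi" for H using Psi_cyc(1)[OF that] E_subset by auto
  have cover: "\<exists>F\<in>Psi. w \<in> \<Union>F" if w: "w \<in> V" for w
  proof -
    have "N w \<noteq> {}" using card_N_ge_4[OF w] by auto
    then obtain x where "{w, x} \<in> E" by (auto simp: adj_def)
    then obtain F where "F \<in> Psi" "{w, x} \<in> F" using edge_in_face by blast
    then show ?thesis by blast
  qed
  have disj: "side z S \<inter> side z (Psi - S) = {}"
    using side_closed[OF S] by (auto simp: side_def)
  have "V = side z S \<union> side z (Psi - S) \<union> \<Union>z"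
  proof (intro equalityI subsetI)
    fix x assume x: "x \<in> V"
    then obtain F where "F \<in> Psi" "x \<in> \<Union>F" using cover by blast
    then show "x \<in> side z S \<union> side z (Psi - S) \<union> \<Union>z"
      using x by (cases "F \<in> S") (auto simp: side_def)
  qed (use assms(3) in \<open>auto simp: side_def\<close>)
  moreover have nonempty: "side z U \<noteq> {}" if H: "H \<in> U" "U \<subseteq> Psi" "\<not> \<Union>H \<subseteq> \<Union>z" for H U
  proof -
    obtain w where "w \<in> \<Union>H" "w \<notin> \<Union>z" using H by blast
    moreover then have "w \<in> V" using UV[of H] H by auto
    ultimately have "w \<in> side z U" using H unfolding side_def by blast
    then show ?thesis by auto
  qed
  have "side z S \<noteq> {}" "side z (Psi - S) \<noteq> {}"
    using nonempty[OF F(1) S(1) F(2)] nonempty[OF G(1) _ G(2)] by auto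
  moreover have "\<not> adj x y" if xy: "x \<in> side z S" "y \<in> side z (Psi - S)" for x y
  proof
    assume "adj x y"
    then obtain H where H: "H \<in> Psi" "{x, y} \<in> H" using edge_in_face by (auto simp: adj_def)
    obtain F' where F': "F' \<in> S" "x \<in> \<Union>F'" using xy by (auto simp: side_def)
    have "H \<in> S" using side_closed[OF S _ F' H(1)] H xy by (auto simp: side_def)
    moreover have "y \<in> \<Union>H" using H by auto
    ultimately have "y \<in> side z S" using xy(2) unfolding side_def by blast
    then show False using xy disj by auto
  qed
  ultimately show ?thesis using disj by (auto simp: separation_def side_def)
qed

lemma bd_tri:
  assumes "a \<noteq> b" "b \<noteq> c" "c \<noteq> a"
  shows "bd (tri a b c) = {}"
proof -
  have n: "{a, b} \<noteq> {b, c}" "{b, c} \<noteq> {c, a}" "{a, b} \<noteq> {c, a}" using assms by (auto simp: doubleton_eq_iff)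
  show ?thesis unfolding tri_def using n assms by (auto simp: bd_insert sd_iff)
qed

text \<open>A triangle that is no face has faces with further vertices on both sides, so it would be
  a separating clique.\<close>

lemma triangle_is_face:
  assumes "adj a b" "adj b c" "adj c a"
  shows "link a b c"
proof (rule ccontr)
  assume n: "\<not> ?thesis"
  have d: "a \<noteq> b" "b \<noteq> c" "c \<noteq> a" using assms by auto
  define z where "z = tri a b c"
  have Uz: "\<Union>z = {a, b, c}" by (auto simp: z_def tri_def)
  have zP: "z \<notin> Psi" using n d by (auto simp: link_def z_def)
  have zc: "z \<in> cyc E" using assms bd_tri[OF d] by (auto simp: cyc_def z_def tri_def adj_def)
  obtain S where S: "S \<subseteq> Psi" "z = xsum S" using cyc_xsum[OF zc] .
  have zne: "z \<noteq> {}" by (simp add: z_def tri_def)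
  have out: "\<not> \<Union>F \<subseteq> \<Union>z" if F: "F \<in> Psi" for F
  proof
    assume sub: "\<Union>F \<subseteq> \<Union>z"
    obtain p q r where pqr: "F = tri p q r" "p \<noteq> q" "q \<noteq> r" "r \<noteq> p" using Psi_tri[OF F] .
    then have "{p, q, r} \<subseteq> {a, b, c}" using sub Uz by (auto simp: tri_def)
    then have "F = z" using pqr d unfolding z_def tri_def by (auto simp: insert_commute)
    then show False using F zP by simp
  qed
  obtain F where F: "F \<in> S" using S zne by (cases "S = {}") auto
  have "S \<noteq> Psi" using S zne Psi(2) by auto
  then obtain G where G: "G \<in> Psi - S" using S by auto
  have "separation (side z S) (side z (Psi - S)) (\<Union>z)"
  proof (rule side_separation[OF S _ F _ G])
    show "\<Union>z \<subseteq> V" using zc E_subset by (auto simp: cyc_def)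
    show "\<not> \<Union>F \<subseteq> \<Union>z" by (rule out) (use F S(1) in auto)
    show "\<not> \<Union>G \<subseteq> \<Union>z" by (rule out) (use G in auto)
  qed
  then show False
    using no_clique_separator[of "side z S" "side z (Psi - S)" "\<Union>z"] Uz d assms adj_sym by auto
qed

text \<open>Walking around \<open>b\<close> from \<open>a\<close>, the triangles on the side
  \<open>S\<close> lead to \<open>c\<close>. If they did not, the edges from \<open>b\<close> to the
  neighbours reached would meet every face of \<open>S\<close> evenly, yet meet \<open>z\<close>
  only in the edge \<open>ba\<close>.\<close>

lemma side_path:
  assumes S: "S \<subseteq> Psi" "z = xsum S" and z: "z = {{a, b}, {b, c}, {c, d}, {d, a}}"
    and cyc: "adj a b" "adj b c" "adj c d" "adj d a" and dist: "distinct [a, b, c, d]"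
    and non: "\<not> adj a c" "\<not> adj b d"
  shows "reach E (side z S \<union> {a, c}) a c"
proof (rule ccontr)
  assume n: "\<not> ?thesis"
  let ?W = "side z S \<union> {a, c}"
  define X where "X = {x \<in> N b. reach E ?W a x}"
  have aX: "a \<in> X" using cyc by (auto simp: X_def adj_commute)
  have cX: "c \<notin> X" using n by (auto simp: X_def)
  have XW: "X \<subseteq> ?W" using reach_in[of E ?W a] by (auto simp: X_def)
  have step: "y \<in> X" if l: "link b x y" "tri b x y \<in> S" "x \<in> X" for x y
  proof -
    have y: "adj b y" "adj x y" using link_adj[OF l(1)] by auto
    have "y \<noteq> d" "y \<noteq> b" using y non by auto
    have "y \<in> \<Union>(tri b x y)" by (auto simp: tri_def)
    then have "y \<in> ?W" using l(2) y adj_V[of b y] \<open>y \<noteq> d\<close> \<open>y \<noteq> b\<close> z by (auto simp: side_def)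
    then have "reach E ?W x y" using XW l(3) y by (intro reach_step) (auto simp: adj_def)
    then show ?thesis using y l(3) reach_trans[of E ?W a x y] by (auto simp: X_def)
  qed
  have "even (card (z \<inter> (\<lambda>x. {b, x}) ` X))"
  proof (rule zspan_even[of _ S, OF _ finite_E])
    show "z \<in> zspan S" using xsum_in_zspan[of S S] S finite_subset[OF S(1)] by simp
    show "\<Union>S \<subseteq> E" using Psi_cyc(1) S(1) by auto
    fix F assume F: "F \<in> S"
    show "even (card (F \<inter> (\<lambda>x. {b, x}) ` X))"
    proof (rule star_Int_tri)
      show "F \<in> Psi" using F S by auto
      fix x y assume l: "link b x y" "tri b x y = F"
      then show "x \<in> X \<longleftrightarrow> y \<in> X"
        using step[of x y] step[of y x] link_sym[OF l(1)] F tri_flip[of b x y] by auto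
    qed
  qed
  moreover have "z \<inter> (\<lambda>x. {b, x}) ` X = {{b, a}}"
    unfolding z using aX cX dist XW non by (auto simp: doubleton_eq_iff X_def)
  ultimately show False by simp
qed

text \<open>Both diagonals of an induced 4-cycle are realised by paths on either side, so
  \<open>no_quad_separation\<close> applies. No face lies within the four corners, since it would
  contain a diagonal pair, which is nonadjacent.\<close>

lemma no_induced_quad:
  assumes cyc: "adj a b" "adj b c" "adj c d" "adj d a" and ne: "a \<noteq> c" "b \<noteq> d"
  shows "adj a c \<or> adj b d"
proof (rule ccontr)
  assume "\<not> ?thesis"
  then have non: "\<not> adj a c" "\<not> adj b d" by auto
  have dist: "distinct [a, b, c, d]" using cyc ne by auto
  define z where "z = {{a, b}, {b, c}, {c, d}, {d, a}}"
  have Uz: "\<Union>z = {a, b, c, d}" by (auto simp: z_def)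
  have n: "{a, b} \<notin> {{b, c}, {c, d}, {d, a}}" "{b, c} \<notin> {{c, d}, {d, a}}" "{c, d} \<noteq> {d, a}"
    using dist by (auto simp: doubleton_eq_iff)
  have "bd z = sd {a, b} (sd {b, c} (sd {c, d} {d, a}))"
    unfolding z_def using n by (simp add: bd_insert)
  also have "\<dots> = {}" using dist by (auto simp: sd_def)
  finally have "bd z = {}" .
  then have zc: "z \<in> cyc E" using cyc by (auto simp: cyc_def z_def adj_def)
  obtain S where S: "S \<subseteq> Psi" "z = xsum S" using cyc_xsum[OF zc] .
  define T where "T = Psi - S"
  have T: "T \<subseteq> Psi" "z = xsum T" using xsum_complement[OF S(1)] S(2) by (auto simp: T_def)
  have zne: "z \<noteq> {}" by (simp add: z_def)
  have out: "\<not> \<Union>F \<subseteq> \<Union>z" if F: "F \<in> Psi" for F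
  proof
    assume sub: "\<Union>F \<subseteq> \<Union>z"
    obtain p q r where pqr: "F = tri p q r" "p \<noteq> q" "q \<noteq> r" "r \<noteq> p" using Psi_tri[OF F] .
    have UF: "\<Union>F = {p, q, r}" using pqr(1) by (auto simp: tri_def)
    have "\<not> (a \<in> \<Union>F \<and> c \<in> \<Union>F)" "\<not> (b \<in> \<Union>F \<and> d \<in> \<Union>F)"
      using Psi_clique[OF F] non ne by auto
    moreover define x y where "x = (if a \<in> \<Union>F then a else c)" and "y = (if b \<in> \<Union>F then b else d)"
    ultimately have "\<Union>F \<subseteq> {x, y}" using sub unfolding Uz by (auto split: if_splits)
    then have "card {p, q, r} \<le> card {x, y}" unfolding UF by (intro card_mono) auto
    also have "\<dots> \<le> 2" by (simp add: card_insert_if)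
    finally show False using pqr by simp
  qed
  obtain F where F: "F \<in> S" using S zne by (cases "S = {}") auto
  obtain G where G: "G \<in> T" using T zne by (cases "T = {}") auto
  have "separation (side z S) (side z (Psi - S)) (\<Union>z)"
  proof (rule side_separation[OF S _ F _ G[unfolded T_def]])
    show "\<Union>z \<subseteq> V" using zc E_subset by (auto simp: cyc_def)
    show "\<not> \<Union>F \<subseteq> \<Union>z" by (rule out) (use F S(1) in auto)
    show "\<not> \<Union>G \<subseteq> \<Union>z" by (rule out) (use G T(1) in auto)
  qed
  then have sep: "separation (side z S) (side z T) {a, b, c, d}" by (simp add: Uz T_def)
  have z': "z = {{b, c}, {c, d}, {d, a}, {a, b}}" by (auto simp: z_def)
  have dist': "distinct [b, c, d, a]" using dist by auto
  have non': "\<not> adj b d" "\<not> adj c a" using non adj_commute by auto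
  show False
    by (rule no_quad_separation[OF sep cyc dist non
          side_path[OF S z_def cyc dist non] side_path[OF S z' cyc(2-4,1) dist' non']
          side_path[OF T z_def cyc dist non] side_path[OF T z' cyc(2-4,1) dist' non']])
qed

section \<open>The neighbourhood of a vertex\<close>

lemma link_iff: "link v x y \<longleftrightarrow> adj v x \<and> adj v y \<and> adj x y"
  using link_adj[of v x y] triangle_is_face[of v x y] adj_sym by blast

lemma card_common_adj:
  assumes "adj x y"
  shows "card (N x \<inter> N y) = 2"
proof -
  have "{z. link x y z} = N x \<inter> N y" using assms by (auto simp: link_iff)
  then show ?thesis using card_link[OF assms] by simp
qed

text \<open>Every neighbour has exactly two link neighbours, so a set that contains two for each
  element is closed. This reads off the whole neighbourhood, and so the degree, from a known
  cycle.\<close>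

lemma cycle_is_link:
  assumes "X \<subseteq> N v" "X \<noteq> {}" "\<And>x. x \<in> X \<Longrightarrow> \<exists>y\<in>X. \<exists>z\<in>X. y \<noteq> z \<and> adj x y \<and> adj x z"
  shows "X = N v"
proof (rule link_connected[OF assms(1,2)])
  fix x w assume x: "x \<in> X" and w: "link v x w"
  obtain y z where yz: "y \<in> X" "z \<in> X" "y \<noteq> z" "adj x y" "adj x z" using assms(3)[OF x] by blast
  have c: "card {w. link v x w} = 2" using card_link[of v x] x assms(1) by auto
  then have fin: "finite {w. link v x w}" by (simp add: card_ge_0_finite)
  have "{y, z} \<subseteq> {w. link v x w}" using yz x assms(1) by (auto simp: link_iff)
  then have "{y, z} = {w. link v x w}" using c fin yz by (intro card_seteq) auto
  then show "w \<in> X" using w yz by auto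
qed

text \<open>The triangle \<open>bcd\<close> would be the whole link of \<open>a\<close>, giving
  degree 3.\<close>

lemma no_K4:
  assumes "adj a b" "adj a c" "adj a d" "adj b c" "adj b d" "adj c d"
  shows False
proof -
  have d: "b \<noteq> c" "b \<noteq> d" "c \<noteq> d" using assms by auto
  have "{b, c, d} = N a"
    by (rule cycle_is_link) (use assms d adj_sym in auto)
  then have "card (N a) = card {b, c, d}" by simp
  also have "\<dots> = 3" using d by simp
  finally show False using card_N_ge_4[of a] adj_V[OF assms(1)] by simp
qed

lemma common_adj:
  assumes "u \<noteq> v" "\<not> adj u v" "adj u x" "adj v x" "adj u y" "adj v y" "x \<noteq> y"
  shows "adj x y"
  using no_induced_quad[of u x v y] assms adj_commute by blast

lemma common_eq:
  assumes "u \<noteq> v" "\<not> adj u v" "adj u x" "adj v x" "adj u y" "adj v y" "x \<noteq> y"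
  shows "N u \<inter> N v = {x, y}"
proof -
  have "w = x \<or> w = y" if w: "adj u w" "adj v w" for w
  proof (rule ccontr)
    assume "\<not> ?thesis"
    then have "adj x w" "adj y w" using common_adj[OF assms(1-2)] assms w by blast+
    then show False using no_K4[of u x y w] common_adj[OF assms] assms w by blast
  qed
  then show ?thesis using assms(3-6) unfolding N_def by blast
qed

lemma card_common_le_2:
  assumes "u \<noteq> v" "\<not> adj u v"
  shows "card (N u \<inter> N v) \<le> 2"
proof (cases "\<exists>x y. x \<in> N u \<inter> N v \<and> y \<in> N u \<inter> N v \<and> x \<noteq> y")
  case True
  then obtain x y where "x \<in> N u \<inter> N v" "y \<in> N u \<inter> N v" "x \<noteq> y" by blast
  then have "N u \<inter> N v = {x, y}" using common_eq[OF assms, of x y] by auto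
  then show ?thesis by (simp add: card_insert_if)
next
  case False
  then have "N u \<inter> N v = {} \<or> (\<exists>x. N u \<inter> N v = {x})" by blast
  then show ?thesis by auto
qed

lemma opposite_vertex:
  assumes "adj v x" "adj v y" "adj x y"
  obtains w where "w \<noteq> v" "\<not> adj v w" "N x \<inter> N y = {v, w}" "N v \<inter> N w = {x, y}"
proof -
  have "card (N x \<inter> N y) = 2" "v \<in> N x \<inter> N y" using card_common_adj[OF assms(3)] assms adj_sym by auto
  then obtain p q where pq: "N x \<inter> N y = {p, q}" "p \<noteq> q" "v \<in> {p, q}" unfolding card_2_iff by metis
  define w where "w = (if v = p then q else p)"
  have w: "N x \<inter> N y = {v, w}" "v \<noteq> w" using pq by (auto simp: w_def)
  have "w \<in> N x \<inter> N y" unfolding w(1) by simp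
  then have wxy: "adj x w" "adj y w" by auto
  have n: "\<not> adj v w" using no_K4[of v x y w] assms wxy by blast
  have "x \<noteq> y" using assms by auto
  then have "N v \<inter> N w = {x, y}" using common_eq[OF w(2) n, of x y] assms wxy adj_sym by blast
  then show ?thesis using that[OF w(2)[symmetric] n w(1)] by simp
qed

lemma three_not_clique:
  assumes "P \<subseteq> N u" "3 \<le> card P"
  shows "\<exists>x\<in>P. \<exists>y\<in>P. x \<noteq> y \<and> \<not> adj x y"
proof (rule ccontr)
  assume n: "\<not> ?thesis"
  obtain Q where "Q \<subseteq> P" "card Q = 3" using obtain_subset_with_card_n[OF assms(2)] by auto
  then obtain x y z where "{x, y, z} \<subseteq> P" "x \<noteq> y" "y \<noteq> z" "x \<noteq> z" by (auto simp: card_3_iff)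
  then have "adj u x" "adj u y" "adj u z" "adj x y" "adj x z" "adj y z" using n assms(1) by auto
  then show False using no_K4 by blast
qed

section \<open>Packets and private neighbours\<close>

lemma connected_set_singleton [simp]: "connected_set {x}"
  by (auto simp: connected_set_def)

lemma connected_set_insert:
  assumes "connected_set K" "k \<in> K" "adj k x"
  shows "connected_set (insert x K)"
proof -
  have K: "reach E (insert x K) a b" if "a \<in> K" "b \<in> K" for a b
    using assms(1) that reach_mono[of E K a b "insert x K"] unfolding connected_set_def by blast
  have kx: "reach E (insert x K) k x" using assms by (intro reach_step) (auto simp: adj_def)
  have "reach E (insert x K) k a" if "a \<in> insert x K" for a using that K[OF assms(2)] kx by auto
  then show ?thesis unfolding connected_set_def using reach_sym reach_trans by metis
qed

text \<open>The conditions that \<open>reducible\<close> puts on one contracted part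
  \<open>F\<close> and its replacement \<open>T\<close>, so that concrete parts can be given in a
  list.\<close>

definition packet :: "'v set \<Rightarrow> 'v set \<Rightarrow> 'v set \<Rightarrow> 'v set \<Rightarrow> bool" where
  "packet J R T F \<longleftrightarrow> F \<subseteq> R \<and> connected_set F \<and> T \<subseteq> F \<and> indep T \<and> T \<inter> J = {} \<and> 2 \<le> card T
     \<and> card {u \<in> J. N u \<inter> T \<noteq> {}} < card T"

lemma reducible_packets:
  assumes "J \<subseteq> V" "indep J" "R \<subseteq> V" "R \<noteq> {}" "J \<subseteq> R" "\<And>u. u \<in> J \<Longrightarrow> N u \<subseteq> R"
    and ps: "\<And>T F. (T, F) \<in> set ps \<Longrightarrow> packet J R T F"
    and dis: "sorted_wrt (\<lambda>p q. snd p \<inter> snd q = {}) ps"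
    and count: "3 * card R \<le> 13 * card J + 3 * length ps"
  shows False
proof -
  have pk: "packet J R (fst (ps ! i)) (snd (ps ! i))" if "i \<in> {..<length ps}" for i
    using ps[of "fst (ps ! i)" "snd (ps ! i)"] nth_mem[of i ps] that by simp
  have disj: "snd (ps ! i) \<inter> snd (ps ! j) = {}" if "i \<in> {..<length ps}" "j \<in> {..<length ps}" "i \<noteq> j" for i j
    using that dis unfolding sorted_wrt_iff_nth_less by (metis Int_commute lessThan_iff nat_neq_iff)
  show False
    by (rule reducible[of J R "{..<length ps}" "\<lambda>i. snd (ps ! i)" "\<lambda>i. fst (ps ! i)"])
       (use assms(1-6) pk disj count in \<open>auto simp: packet_def\<close>)
qed

text \<open>Private neighbours of \<open>u\<close>: a pair of them blocks no element of
  \<open>J\<close> but \<open>u\<close>, so two nonadjacent ones are enough for a packet.\<close>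

definition own :: "'v set \<Rightarrow> 'v \<Rightarrow> 'v set" where
  "own J u = N u - (\<Union>w\<in>J - {u}. N w)"

lemma own_packet:
  assumes "u \<in> J" "indep J" "J \<subseteq> R" "N u \<subseteq> R" "x \<in> own J u" "y \<in> own J u" "x \<noteq> y" "\<not> adj x y"
    and "connected_set F" "{x, y} \<subseteq> F" "F \<subseteq> R"
  shows "packet J R {x, y} F"
proof -
  have ux: "adj u x" "adj u y" using assms(5,6) by (auto simp: own_def)
  have "{u \<in> J. N u \<inter> {x, y} \<noteq> {}} \<subseteq> {u}" using assms(5,6) by (auto simp: own_def)
  then have "card {u \<in> J. N u \<inter> {x, y} \<noteq> {}} \<le> card {u}" by (intro card_mono) auto
  then show ?thesis using assms ux adj_sym unfolding packet_def indep_def by auto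
qed

lemma connected_via: "adj m x \<Longrightarrow> adj m y \<Longrightarrow> connected_set {x, m, y}"
  using connected_set_insert[OF connected_set_insert[of "{m}" m y], of m x] by (simp add: insert_commute[of m])

lemma own_pair:
  assumes "u \<in> J" "indep J" "J \<subseteq> R" "N u \<subseteq> R" "3 \<le> card (own J u)"
  obtains T where "packet J R T (insert u T)" "T \<subseteq> own J u"
proof -
  obtain x y where xy: "x \<in> own J u" "y \<in> own J u" "x \<noteq> y" "\<not> adj x y"
    using three_not_clique[of "own J u" u] assms(5) by (auto simp: own_def)
  have a: "adj u x" "adj u y" using xy by (auto simp: own_def)
  have "connected_set (insert u {x, y})" using connected_via[OF a] by (simp add: insert_commute)
  then have "packet J R {x, y} (insert u {x, y})"
    using a assms by (intro own_packet[OF assms(1-4) xy]) auto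
  then show ?thesis using that[of "{x, y}"] xy by auto
qed

text \<open>Each \<open>u\<close> in \<open>K\<close> is contracted with two nonadjacent private
  neighbours. The parts are disjoint because private neighbourhoods of distinct elements
  are.\<close>

lemma reducible_own:
  assumes J: "J \<subseteq> V" "indep J" "J \<noteq> {}" and K: "K \<subseteq> J"
    and pr: "\<And>u. u \<in> K \<Longrightarrow> \<exists>x\<in>own J u. \<exists>y\<in>own J u. x \<noteq> y \<and> \<not> adj x y"
    and count: "3 * card (J \<union> \<Union>(N ` J)) \<le> 13 * card J + 3 * card K"
  shows False
proof -
  let ?R = "J \<union> \<Union>(N ` J)"
  have finK: "finite K" using finite_subset[OF K finite_subset[OF J(1)]] by simp
  obtain us where us: "distinct us" "set us = K" using finite_distinct_list[OF finK] by auto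
  have "\<forall>u\<in>K. \<exists>p. fst p \<in> own J u \<and> snd p \<in> own J u \<and> fst p \<noteq> snd p \<and> \<not> adj (fst p) (snd p)"
    using pr by fastforce
  then obtain p where p: "\<And>u. u \<in> K \<Longrightarrow> fst (p u) \<in> own J u \<and> snd (p u) \<in> own J u
      \<and> fst (p u) \<noteq> snd (p u) \<and> \<not> adj (fst (p u)) (snd (p u))" by metis
  define T where "T u = {fst (p u), snd (p u)}" for u
  define F where "F u = {fst (p u), u, snd (p u)}" for u
  have pk: "packet J ?R (T u) (F u)" if u: "u \<in> K" for u
  proof -
    have a: "adj u (fst (p u))" "adj u (snd (p u))" using p[OF u] by (auto simp: own_def)
    have uJ: "u \<in> J" using u K by auto
    have "N u \<subseteq> ?R" using uJ by auto
    then show ?thesis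
      unfolding T_def F_def using p[OF u] uJ J a connected_via[OF a]
      by (intro own_packet[of u]) auto
  qed
  have dis: "F u \<inter> F w = {}" if uw: "u \<in> K" "w \<in> K" "u \<noteq> w" for u w
  proof -
    have J': "u \<in> J" "w \<in> J" using uw K by auto
    have sub: "F u \<subseteq> insert u (own J u)" "F w \<subseteq> insert w (own J w)"
      using p[OF uw(1)] p[OF uw(2)] by (auto simp: F_def)
    have "u \<notin> N w" "w \<notin> N u" using J(2) J' by (auto simp: indep_def)
    moreover have "own J u \<inter> own J w = {}" using J' uw(3) by (auto simp: own_def)
    ultimately have "insert u (own J u) \<inter> insert w (own J w) = {}"
      using uw(3) by (auto simp: own_def)
    then show ?thesis using sub by blast
  qed
  let ?ps = "map (\<lambda>u. (T u, F u)) us"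
  have 1: "packet J ?R T' F'" if "(T', F') \<in> set ?ps" for T' F' using that pk us by auto
  have 2: "sorted_wrt (\<lambda>p q. snd p \<inter> snd q = {}) ?ps"
    unfolding sorted_wrt_iff_nth_less
  proof (intro allI impI)
    fix i j assume "i < j" "j < length ?ps"
    then show "snd (?ps ! i) \<inter> snd (?ps ! j) = {}"
      using dis[of "us ! i" "us ! j"] us nth_eq_iff_index_eq[OF us(1), of i j] by auto
  qed
  have 3: "3 * card ?R \<le> 13 * card J + 3 * length ?ps"
    using count us distinct_card[OF us(1)] by simp
  have 4: "?R \<subseteq> V" "?R \<noteq> {}" "J \<subseteq> ?R" using J N_V by auto
  have 5: "N u \<subseteq> ?R" if "u \<in> J" for u using that by auto
  show False using reducible_packets[OF J(1,2) 4 5 1 2 3] .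
qed

text \<open>For degree 4, one packet around \<open>v\<close> balances the deletion of five vertices:
  15 against 13 + 3.\<close>

lemma card_N_ge_5:
  assumes v: "v \<in> V"
  shows "5 \<le> card (N v)"
proof (rule ccontr)
  assume "\<not> ?thesis"
  then have c: "card (N v) = 4" using card_N_ge_4[OF v] by simp
  have "own {v} v = N v" by (simp add: own_def)
  then have "\<exists>x\<in>own {v} v. \<exists>y\<in>own {v} v. x \<noteq> y \<and> \<not> adj x y"
    using three_not_clique[of "N v" v] c by simp
  then show False
    using v c by (intro reducible_own[of "{v}" "{v}"]) (auto simp: indep_def)
qed

text \<open>With two common neighbours only ten vertices are deleted, and each of \<open>u\<close>
  and \<open>v\<close> keeps three private neighbours: 30 against 26 + 6.\<close>

lemma five_five:
  assumes "card (N u) = 5" "card (N v) = 5" "u \<noteq> v" "\<not> adj u v"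
  shows "card (N u \<inter> N v) \<le> 1"
proof (rule ccontr)
  assume "\<not> ?thesis"
  then have c: "card (N u \<inter> N v) = 2" using card_common_le_2[OF assms(3,4)] by simp
  have V: "u \<in> V" "v \<in> V" using assms(1,2) adj_V card.empty by (metis N_iff ex_in_conv zero_neq_numeral)+
  have "card (own {u, v} u) = 3" "card (own {u, v} v) = 3"
  proof -
    have "own {u, v} u = N u - (N u \<inter> N v)" "own {u, v} v = N v - (N u \<inter> N v)"
      using assms(3) by (auto simp: own_def)
    then show "card (own {u, v} u) = 3" "card (own {u, v} v) = 3"
      using assms(1,2) c by (simp_all add: card_Diff_subset)
  qed
  then have pr: "\<exists>x\<in>own {u, v} w. \<exists>y\<in>own {u, v} w. x \<noteq> y \<and> \<not> adj x y" if "w \<in> {u, v}" for w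
    using three_not_clique[of "own {u, v} w" w] that by (auto simp: own_def)
  have "card (N u) + card (N v) = card (N u \<union> N v) + card (N u \<inter> N v)" by (rule card_Un_Int) auto
  then have "card (N u \<union> N v) = 8" using assms c by simp
  moreover have "{u, v} \<inter> (N u \<union> N v) = {}" using assms(4) adj_commute by auto
  ultimately have "card ({u, v} \<union> (N u \<union> N v)) = 10"
    using assms(3) by (subst card_Un_disjoint) auto
  then have cR: "card ({u, v} \<union> \<Union>(N ` {u, v})) = 10" by simp
  show False
    by (rule reducible_own[of "{u, v}" "{u, v}"])
       (use V assms pr cR adj_commute in \<open>auto simp: indep_def\<close>)
qed

definition consecutive :: "nat \<Rightarrow> nat \<Rightarrow> nat \<Rightarrow> bool" where
  "consecutive d i j \<longleftrightarrow> j = Suc i mod d \<or> i = Suc j mod d"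

definition rotation :: "'v \<Rightarrow> 'v list \<Rightarrow> bool" where
  "rotation v xs \<longleftrightarrow> distinct xs \<and> set xs = N v
     \<and> (\<forall>i<length xs. \<forall>j<length xs. adj (xs ! i) (xs ! j) \<longleftrightarrow> consecutive (length xs) i j)"

text \<open>Walk around the link, always leaving a vertex towards the neighbour from which it was
  not entered. The first repeated vertex is the start, as any other one already has both link
  neighbours on the walk; connectedness of the link makes the tour exhaustive.\<close>

lemma rotation_exists:
  assumes ab: "adj v a" "adj v b" "adj a b"
  obtains xs where "rotation v xs" "length xs = card (N v)" "xs ! 0 = a" "xs ! 1 = b"
proof -
  define nxt where "nxt p c = (SOME y. link v c y \<and> y \<noteq> p)" for p c
  have nbrs: "\<exists>y z. {w. link v c w} = {y, z} \<and> y \<noteq> z" if "adj v c" for c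
    using card_link[OF that] unfolding card_2_iff by blast
  have nxt: "link v c (nxt p c) \<and> nxt p c \<noteq> p" if c: "adj v c" for p c
  proof -
    obtain y z where "{w. link v c w} = {y, z}" "y \<noteq> z" using nbrs[OF c] by blast
    then have "\<exists>y. link v c y \<and> y \<noteq> p" by blast
    then show ?thesis unfolding nxt_def by (rule someI_ex)
  qed
  \<comment> \<open>The state of the walk is the pair of previous and current vertex.\<close>
  define s where "s = (\<lambda>(p, c). (c, nxt p c))"
  define f where "f i = fst ((s ^^ i) (a, b))" for i
  have sf: "(s ^^ i) (a, b) = (f i, f (Suc i))" for i
    by (simp add: f_def s_def case_prod_beta)
  have f0: "f 0 = a" "f 1 = b" by (auto simp: f_def s_def)
  have fS: "f (Suc (Suc i)) = nxt (f i) (f (Suc i))" for i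
    using sf[of "Suc i"] sf[of i] by (simp add: s_def)
  have step: "link v (f i) (f (Suc i))" for i
  proof (induction i)
    case 0
    then show ?case using ab f0 by (simp add: link_iff)
  next
    case (Suc i)
    then have "adj v (f (Suc i))" by (simp add: link_iff)
    then show ?case using nxt fS by metis
  qed
  have advf: "adj v (f i)" for i using step[of i] by (simp add: link_iff)
  have no_return: "f (Suc (Suc i)) \<noteq> f i" for i using nxt[OF advf] fS by metis
  have only: "w = f i \<or> w = f (Suc (Suc i))" if w: "link v (f (Suc i)) w" for i w
  proof -
    obtain y z where yz: "{w. link v (f (Suc i)) w} = {y, z}" using nbrs[OF advf[of "Suc i"]] by blast
    have "f i \<in> {y, z}" "f (Suc (Suc i)) \<in> {y, z}" "w \<in> {y, z}"
      using step[of "Suc i"] link_sym[OF step[of i]] w yz by blast+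
    then show ?thesis using no_return[of i] by auto
  qed
  have "\<not> inj_on f {..card (N v)}"
  proof
    assume "inj_on f {..card (N v)}"
    then have "card {..card (N v)} \<le> card (N v)" using advf by (intro card_inj_on_le[of f]) auto
    then show False by simp
  qed
  then obtain i j where "f i = f j" "i \<noteq> j" by (auto simp: inj_on_def)
  then have "\<exists>m. \<exists>j<m. f m = f j" by (cases "i < j") (metis linorder_neqE_nat)+
  then obtain m where m: "\<exists>j<m. f m = f j" and least: "\<And>m'. m' < m \<Longrightarrow> \<not> (\<exists>j<m'. f m' = f j)"
    using exists_least_iff[of "\<lambda>m. \<exists>j<m. f m = f j"] by blast
  have inj: "i = j" if "f i = f j" "i < m" "j < m" for i j
    using least[of i] least[of j] that by (metis nat_neq_iff)
  obtain j where j: "j < m" "f m = f j" using m by auto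
  have fne: "f (Suc i) \<noteq> f i" for i using step[of i] by (auto simp: link_iff)
  \<comment> \<open>A return to an inner vertex would make the last vertex one of its two link
    neighbours on the walk, and each choice contradicts minimality of \<open>m\<close> or the rule
    against turning back.\<close>
  have "j = 0"
  proof (rule ccontr)
    assume "j \<noteq> 0"
    then obtain j' where j': "j = Suc j'" by (cases j) auto
    obtain m' where m': "m = Suc m'" using j by (cases m) auto
    have "link v (f (Suc j')) (f m')" using link_sym[OF step[of m']] j j' m' by simp
    then have "f m' = f j' \<or> f m' = f (Suc (Suc j'))" using only by blast
    then show False
    proof
      assume "f m' = f j'"
      then show False using inj[of m' j'] j j' m' by simp
    next
      assume eq: "f m' = f (Suc (Suc j'))"
      show False
      proof (cases "Suc (Suc j') < m")
        case True
        then have "m' = Suc (Suc j')" using inj[OF eq] m' by simp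
        then show False using no_return[of "Suc j'"] j j' m' by simp
      next
        case False
        then have "m' = j" using j j' m' by simp
        then show False using fne[of m'] j m' by simp
      qed
    qed
  qed
  then have fm: "f m = f 0" "0 < m" using j by auto
  have m3: "3 \<le> m"
  proof -
    have "m \<noteq> 1" using fne[of 0] fm by auto
    moreover have "m \<noteq> 2" using no_return[of 0] fm by (auto simp: numeral_2_eq_2)
    ultimately show ?thesis using fm by linarith
  qed
  obtain m' where m': "m = Suc m'" using fm by (cases m) auto
  have only0: "w = f 1 \<or> w = f m'" if w: "link v (f 0) w" for w
  proof -
    obtain y z where yz: "{w. link v (f 0) w} = {y, z}" using nbrs[OF advf[of 0]] by blast
    have "link v (f 0) (f m')" using link_sym[OF step[of m']] fm m' by simp
    then have "f 1 \<in> {y, z}" "f m' \<in> {y, z}" "w \<in> {y, z}" using step[of 0] w yz by auto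
    moreover have "f 1 \<noteq> f m'" using inj[of 1 m'] m3 m' by auto
    ultimately show ?thesis by auto
  qed
  have N: "f ` {..<m} = N v"
  proof (rule link_connected)
    show "f ` {..<m} \<subseteq> N v" using advf by auto
    show "f ` {..<m} \<noteq> {}" using fm by auto
    fix x y assume "x \<in> f ` {..<m}" and l: "link v x y"
    then obtain i where i: "i < m" "x = f i" by auto
    show "y \<in> f ` {..<m}"
    proof (cases i)
      case 0
      then have "y = f 1 \<or> y = f m'" using only0 l i by auto
      then show ?thesis using m3 m' by auto
    next
      case (Suc k)
      then have "y = f k \<or> y = f (Suc i)" using only[of k y] l i by auto
      moreover have "f (Suc i) \<in> f ` {..<m}" using i fm by (cases "Suc i = m") auto
      ultimately show ?thesis using i Suc by auto
    qed
  qed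
  have injf: "inj_on f {..<m}" using inj by (auto simp: inj_on_def)
  have cm: "m = card (N v)" using card_image[OF injf] N by simp
  define xs where "xs = map f [0..<m]"
  have len: "length xs = m" by (simp add: xs_def)
  have nth: "xs ! i = f i" if "i < m" for i using that by (simp add: xs_def)
  have adjf: "adj (f i) (f j) \<longleftrightarrow> consecutive m i j" if ij: "i < m" "j < m" for i j
  proof
    assume "adj (f i) (f j)"
    then have l: "link v (f i) (f j)" using advf by (simp add: link_iff)
    show "consecutive m i j"
    proof (cases i)
      case 0
      then have "f j = f 1 \<or> f j = f m'" using only0 l by auto
      then have "j = 1 \<or> j = m'" using inj[of j 1] inj[of j m'] ij m3 m' by auto
      then show ?thesis using 0 m3 m' by (auto simp: consecutive_def)
    next
      case (Suc k)
      then have "f j = f k \<or> f j = f (Suc i)" using only[of k "f j"] l by auto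
      then show ?thesis
      proof
        assume "f j = f k"
        then have "j = k" using inj[of j k] ij Suc by auto
        then show ?thesis using Suc ij by (auto simp: consecutive_def)
      next
        assume eq: "f j = f (Suc i)"
        show ?thesis
        proof (cases "Suc i = m")
          case True
          then have "j = 0" using inj[of j 0] eq ij fm by auto
          then show ?thesis using True by (auto simp: consecutive_def)
        next
          case False
          then have "j = Suc i" using inj[of j "Suc i"] eq ij by auto
          then show ?thesis using False ij by (auto simp: consecutive_def)
        qed
      qed
    qed
  next
    have one: "adj (f i) (f j)" if "j = Suc i mod m" "i < m" for i j
    proof (cases "Suc i = m")
      case True
      then show ?thesis using step[of i] fm that by (simp add: link_iff)
    next
      case False
      then show ?thesis using step[of i] that by (simp add: link_iff)
    qed
    assume "consecutive m i j"
    then show "adj (f i) (f j)" using one[of j i] one[of i j] ij adj_sym by (auto simp: consecutive_def)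
  qed
  have "rotation v xs"
    unfolding rotation_def len
  proof (intro conjI allI impI)
    show "distinct xs" using injf by (simp add: xs_def distinct_map atLeast0LessThan)
    show "set xs = N v" using N by (simp add: xs_def atLeast0LessThan)
    fix i j assume "i < m" "j < m"
    then show "adj (xs ! i) (xs ! j) = consecutive m i j" using nth adjf by simp
  qed
  moreover have "xs ! 0 = a" "xs ! 1 = b" using nth[of 0] nth[of 1] f0 m3 by auto
  moreover have "length xs = card (N v)" using len cm by simp
  ultimately show ?thesis using that[of xs] by simp
qed

lemma consecutive_simps [simp]:
  "consecutive 5 i j \<longleftrightarrow> j = Suc i mod 5 \<or> i = Suc j mod 5"
  "consecutive 6 i j \<longleftrightarrow> j = Suc i mod 6 \<or> i = Suc j mod 6"
  "consecutive 8 i j \<longleftrightarrow> j = Suc i mod 8 \<or> i = Suc j mod 8"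
  by (simp_all add: consecutive_def)

section \<open>Opposite vertices and discharging\<close>

definition opp :: "'v \<Rightarrow> 'v \<Rightarrow> 'v \<Rightarrow> 'v \<Rightarrow> bool" where
  "opp v x y w \<longleftrightarrow> w \<noteq> v \<and> \<not> adj v w \<and> N v \<inter> N w = {x, y} \<and> x \<noteq> y"

lemma rotation_nth_adj:
  "rotation v xs \<Longrightarrow> length xs = n \<Longrightarrow> i < n \<Longrightarrow> j < n \<Longrightarrow> adj (xs ! i) (xs ! j) \<longleftrightarrow> consecutive n i j"
  by (auto simp: rotation_def)

lemma oppD:
  assumes "opp v x y w"
  shows "w \<noteq> v" "\<not> adj v w" "\<not> adj w v" "N v \<inter> N w = {x, y}" "x \<noteq> y" "adj v x" "adj v y" "adj w x" "adj w y"
    "adj x v" "adj y v" "adj x w" "adj y w" "adj x y" "card (N v \<inter> N w) = 2"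
proof -
  show 1: "w \<noteq> v" "\<not> adj v w" "\<not> adj w v" "N v \<inter> N w = {x, y}" "x \<noteq> y"
    using assms adj_commute by (auto simp: opp_def)
  have "x \<in> N v \<inter> N w" "y \<in> N v \<inter> N w" unfolding 1(4) by simp_all
  then show 2: "adj v x" "adj v y" "adj w x" "adj w y" by auto
  then show "adj x v" "adj y v" "adj x w" "adj y w" using adj_sym by auto
  show "adj x y" using common_adj[of v w x y] 1 2 by auto
  show "card (N v \<inter> N w) = 2" using 1 by simp
qed

lemma opp_not_adj:
  assumes "opp v x y w" "adj v z" "z \<noteq> x" "z \<noteq> y"
  shows "\<not> adj w z \<and> \<not> adj z w"
proof -
  have "z \<notin> N v \<inter> N w" unfolding oppD(4)[OF assms(1)] using assms by simp
  then have "\<not> adj w z" using assms(2) by simp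
  then show ?thesis using adj_commute[of w z] by simp
qed

lemma opp_swap: "opp v x y w \<Longrightarrow> opp v y x w"
  by (auto simp: opp_def)

lemma opp_unique:
  assumes "opp v x y w" "opp v x y w'"
  shows "w = w'"
proof (rule ccontr)
  assume "w \<noteq> w'"
  then have "card {v, w, w'} = 3" using oppD(1)[OF assms(1)] oppD(1)[OF assms(2)] by auto
  moreover have "{v, w, w'} \<subseteq> N x \<inter> N y" using oppD[OF assms(1)] oppD[OF assms(2)] by auto
  then have "card {v, w, w'} \<le> card (N x \<inter> N y)" by (intro card_mono) auto
  ultimately show False using card_common_adj[OF oppD(14)[OF assms(1)]] by simp
qed

lemma opp_exists:
  assumes "adj v x" "adj v y" "adj x y"
  obtains w where "opp v x y w"
proof -
  obtain w where "w \<noteq> v" "\<not> adj v w" "N x \<inter> N y = {v, w}" "N v \<inter> N w = {x, y}"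
    using opposite_vertex[OF assms] .
  moreover have "x \<noteq> y" using assms by auto
  ultimately show ?thesis using that[of w] by (simp add: opp_def)
qed

lemma deg_V: "card (N v) \<noteq> 0 \<Longrightarrow> v \<in> V"
  using adj_V by (metis N_iff card.empty ex_in_conv)

lemma five_opp_five: "opp u x y v \<Longrightarrow> card (N u) = 5 \<Longrightarrow> card (N v) \<noteq> 5"
  using five_five[of u v] oppD[of u x y v] by auto

text \<open>The vertices \<open>v, a, w, m, t\<close> close up to a cycle in the link of
  \<open>s\<close>, so they are all its neighbours.\<close>

lemma shared_corner_degree:
  assumes "opp v a s w" "adj m s" "adj m w" "\<not> adj v m" "m \<noteq> v" "adj v t" "adj m t" "adj s t" "t \<noteq> a"
  shows "card (N s) = 5"
proof -
  note o = oppD[OF assms(1)]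
  have "{v, a, w, m, t} = N s"
  proof (rule cycle_is_link)
    show "{v, a, w, m, t} \<subseteq> N s" using o assms adj_sym by auto
    have "a \<noteq> m" "w \<noteq> t" using o assms by auto
    then show "\<exists>y\<in>{v, a, w, m, t}. \<exists>z\<in>{v, a, w, m, t}. y \<noteq> z \<and> adj x y \<and> adj x z"
      if "x \<in> {v, a, w, m, t}" for x
      using that o(1-9) o(10-13) assms(3,5-7,9) adj_sym[OF assms(3)] adj_sym[OF assms(6)] adj_sym[OF assms(7)]
      by auto
  qed auto
  then have "card (N s) = card {v, a, w, m, t}" by simp
  also have "\<dots> \<le> 5" by (simp add: card_insert_if)
  finally show ?thesis using card_N_ge_5[of s] adj_V[OF o(10)] adj_V[OF assms(2)] by auto
qed

text \<open>Deleting \<open>{v, p, q}\<close> with all neighbours removes at most 16 vertices and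
  allows three packets: 48 against 39 + 9. A common neighbour of \<open>p\<close> and
  \<open>q\<close> away from \<open>v\<close> saves a vertex but may spoil a packet: 45 against 39 +
  6. If the packets at \<open>p\<close> and at \<open>q\<close> both failed, a corner would have
  degree 5, contrary to \<open>five_five\<close>.\<close>

lemma seven_neighbours_adjacent:
  assumes v: "card (N v) = 7" and deg: "card (N p) = 5" "card (N q) = 5"
    and op: "opp v a b p" and oq: "opp v c d q" and "p \<noteq> q"
  shows "adj p q"
proof (rule ccontr)
  assume n: "\<not> adj p q"
  note P = oppD[OF op] and Q = oppD[OF oq]
  have nq: "\<not> adj q p" using n adj_commute by blast
  let ?J = "{v, p, q}"
  have "v \<in> V" "p \<in> V" "q \<in> V" using deg_V[of v] deg_V[of p] deg_V[of q] unfolding v deg by simp_all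
  then have JV: "?J \<subseteq> V" by simp
  have J: "indep ?J" using P Q n nq by (auto simp: indep_def)
  have cJ: "card ?J = 3" using P Q assms(6) by auto
  define C where "C = N p \<inter> N q"
  have cC: "card C \<le> 1" using five_five[OF deg assms(6) n] by (simp add: C_def)
  have fC: "finite C" by (simp add: C_def)
  have own_v: "own ?J v = N v - ({a, b} \<union> {c, d})"
    using P(1,4) Q(1,4) by (auto simp: own_def)
  have "card ({a, b} \<union> {c, d}) \<le> 4" by (simp add: card_insert_if)
  then have "3 \<le> card (own ?J v)"
    unfolding own_v using v P Q by (subst card_Diff_subset) auto
  then have pv: "\<exists>x\<in>own ?J v. \<exists>y\<in>own ?J v. x \<noteq> y \<and> \<not> adj x y"
    by (intro three_not_clique[of _ v]) (auto simp: own_def)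
  have own_p: "own ?J p = N p - {a, b} - C"
    using P(1,4) assms(6) by (auto simp: own_def C_def)
  have own_q: "own ?J q = N q - {c, d} - C"
    using Q(1,4) assms(6) by (auto simp: own_def C_def)
  have c3: "card (N p - {a, b}) = 3" "card (N q - {c, d}) = 3"
    using deg P Q by (simp_all add: card_Diff_subset)
  have U: "?J \<union> \<Union>(N ` ?J) = ?J \<union> (N v \<union> (N p - {a, b}) \<union> (N q - {c, d} - C))"
    using P Q by (auto simp: C_def)
  have "card (?J \<union> \<Union>(N ` ?J)) \<le> card ?J + card (N v \<union> (N p - {a, b}) \<union> (N q - {c, d} - C))"
    unfolding U by (rule card_Un_le)
  also have "\<dots> \<le> 3 + (card (N v) + card (N p - {a, b}) + card (N q - {c, d} - C))"
    using card_Un_le[of "N v \<union> (N p - {a, b})" "N q - {c, d} - C"] card_Un_le[of "N v" "N p - {a, b}"] cJ by linarith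
  finally have cR: "card (?J \<union> \<Union>(N ` ?J)) \<le> 13 + card (N q - {c, d} - C)" using v c3 by simp
  show False
  proof (cases "C \<subseteq> N v")
    case True
    then have "C \<subseteq> {a, b}" "C \<subseteq> {c, d}" using P(4) Q(4) by (auto simp: C_def)
    then have own: "own ?J p = N p - {a, b}" "own ?J q = N q - {c, d}" using own_p own_q by auto
    have pp: "\<exists>x\<in>own ?J p. \<exists>y\<in>own ?J p. x \<noteq> y \<and> \<not> adj x y"
      using own c3 by (intro three_not_clique[of _ p]) auto
    have pq: "\<exists>x\<in>own ?J q. \<exists>y\<in>own ?J q. x \<noteq> y \<and> \<not> adj x y"
      using own c3 by (intro three_not_clique[of _ q]) auto
    have "card (N q - {c, d} - C) \<le> 3" using c3(2) card_mono[of "N q - {c, d}" "N q - {c, d} - C"] by auto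
    then have "3 * card (?J \<union> \<Union>(N ` ?J)) \<le> 13 * card ?J + 3 * card ?J" using cR cJ by simp
    then show False
      by (intro reducible_own[OF JV J _ subset_refl]) (use pv pp pq in auto)
  next
    case False
    then obtain m where m: "m \<in> C" "\<not> adj v m" unfolding N_def by blast
    have Cm: "C = {m}" using m cC fC card_le_Suc0_iff_eq[OF fC] by auto
    have am: "adj p m" "adj q m" "adj m p" "adj m q" using m adj_sym by (auto simp: C_def)
    have mv: "m \<noteq> v" using P(3) am by auto
    have mnot: "m \<in> N q - {c, d}" "m \<in> N p - {a, b}" using am m P Q by auto
    then have "card (N q - {c, d} - C) = 2" unfolding Cm using c3 by simp
    then have cR': "3 * card (?J \<union> \<Union>(N ` ?J)) \<le> 45" using cR by simp
    \<comment> \<open>\<open>w\<close> and \<open>m\<close> have exactly two common neighbours. If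
      \<open>m\<close> is adjacent to neither corner, these are the two remaining private neighbours
      of \<open>w\<close>; were they adjacent, a complete graph on four vertices would
      arise.\<close>
    have corner: "\<exists>s. (s = x \<or> s = y) \<and> adj m s"
      if o: "opp v x y w" "adj w m" "card (N w - {x, y}) = 3" "m \<in> N w - {x, y}"
        and cl: "\<not> (\<exists>x'\<in>N w - {x, y} - C. \<exists>y'\<in>N w - {x, y} - C. x' \<noteq> y' \<and> \<not> adj x' y')" for w x y
    proof (rule ccontr)
      assume ns: "\<not> ?thesis"
      have "card (N w - {x, y} - C) = 2" unfolding Cm using o by simp
      have two: "card (N w \<inter> N m) = 2" using card_common_adj[OF o(2)] .
      have "N w \<inter> N m \<subseteq> N w - {x, y} - C" using ns Cm by auto
      then have eq: "N w \<inter> N m = N w - {x, y} - C"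
        using two \<open>card (N w - {x, y} - C) = 2\<close> by (intro card_seteq) auto
      obtain y1 y2 where y: "N w \<inter> N m = {y1, y2}" "y1 \<noteq> y2" using two unfolding card_2_iff by blast
      then have yy: "y1 \<in> N w \<inter> N m" "y2 \<in> N w \<inter> N m" by auto
      then have "adj y1 y2" using cl y(2) unfolding eq by blast
      moreover have "adj w y1" "adj w y2" "adj m y1" "adj m y2" using yy by auto
      ultimately have "adj w y1" "adj w y2" "adj m y1" "adj m y2" "adj y1 y2" by auto
      then show False using no_K4[of w m y1 y2] o(2) by blast
    qed
    have "(\<exists>x\<in>own ?J p. \<exists>y\<in>own ?J p. x \<noteq> y \<and> \<not> adj x y) \<or>
      (\<exists>x\<in>own ?J q. \<exists>y\<in>own ?J q. x \<noteq> y \<and> \<not> adj x y)"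
    proof (rule ccontr)
      assume nn: "\<not> ?thesis"
      obtain s where s: "s = a \<or> s = b" "adj m s"
        using corner[OF op am(1) c3(1) mnot(2)] nn own_p by auto
      obtain t where t: "t = c \<or> t = d" "adj m t"
        using corner[OF oq am(2) c3(2) mnot(1)] nn own_q by auto
      have sC: "s \<notin> C" "t \<notin> C" using Cm s t by auto
      have vs: "adj v s" "adj p s" "adj v t" "adj q t" using s t P Q by auto
      have st: "s \<noteq> t" using sC vs by (auto simp: C_def)
      have adj_st: "adj s t" using common_adj[OF mv _ s(2) vs(1) t(2) vs(3) st] m adj_commute by blast
      have "\<not> adj p t" "\<not> adj q s" using sC vs by (auto simp: C_def)
      obtain t' where ot: "opp v t' t q" using t oq opp_swap by blast
      have "s \<noteq> t'" using \<open>\<not> adj q s\<close> oppD[OF ot] by auto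
      \<comment> \<open>Now \<open>p\<close> and \<open>t\<close> are nonadjacent vertices of degree
        5 with the common neighbours \<open>s\<close> and \<open>m\<close>.\<close>
      have "card (N t) = 5"
        by (rule shared_corner_degree[OF ot t(2) am(4) m(2) mv vs(1) s(2) adj_sym[OF adj_st] \<open>s \<noteq> t'\<close>])
      moreover have "p \<noteq> t" using vs P(2) by auto
      ultimately have "card (N p \<inter> N t) \<le> 1" using five_five[of p t] deg \<open>\<not> adj p t\<close> by simp
      moreover have "{s, m} \<subseteq> N p \<inter> N t" using vs am t adj_st adj_sym by auto
      moreover have "s \<noteq> m" using vs m by auto
      ultimately show False using card_mono[of "N p \<inter> N t" "{s, m}"] by auto
    qed
    then obtain r where r: "r = p \<or> r = q" "\<exists>x\<in>own ?J r. \<exists>y\<in>own ?J r. x \<noteq> y \<and> \<not> adj x y" by auto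
    have "card {v, r} = 2" using r(1) P(1) Q(1) by auto
    then have "3 * card (?J \<union> \<Union>(N ` ?J)) \<le> 13 * card ?J + 3 * card {v, r}" using cR' cJ by simp
    then show False
      by (intro reducible_own[OF JV J, of "{v, r}"]) (use pv r in auto)
  qed
qed

text \<open>Here \<open>p\<close> and \<open>q\<close> share \<open>v2\<close>, at most 17 vertices
  are deleted, and four packets balance exactly: 51 against 39 + 12. Two packets use up the five
  private neighbours of \<open>v\<close>: \<open>v4, v8\<close> are joined through \<open>v\<close>,
  and \<open>v5, v7\<close> through \<open>v6\<close>.\<close>

lemma eight_consecutive_adjacent:
  assumes rot: "rotation v [v1, v2, v3, v4, v5, v6, v7, v8]"
    and deg: "card (N p) = 5" "card (N q) = 5"
    and op: "opp v v1 v2 p" and oq: "opp v v2 v3 q"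
  shows "adj p q"
proof (rule ccontr)
  assume n: "\<not> adj p q"
  note P = oppD[OF op] and Q = oppD[OF oq]
  have nq: "\<not> adj q p" using n adj_commute by blast
  let ?xs = "[v1, v2, v3, v4, v5, v6, v7, v8]"
  have dist: "distinct ?xs" and Nv: "N v = set ?xs" using rot by (auto simp: rotation_def)
  have r: "adj (?xs ! i) (?xs ! j) \<longleftrightarrow> consecutive 8 i j" if "i < 8" "j < 8" for i j
    by (rule rotation_nth_adj[OF rot _ that]) simp
  have a: "\<not> adj v4 v8" "\<not> adj v5 v7" "adj v6 v5" "adj v6 v7"
    using r[of 3 7] r[of 4 6] r[of 5 4] r[of 5 6] by simp_all
  have va: "adj v v4" "adj v v5" "adj v v6" "adj v v7" "adj v v8" using Nv by auto
  have "p \<noteq> q" using P(4) Q(4) dist by auto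
  let ?J = "{v, p, q}"
  let ?R = "?J \<union> \<Union>(N ` ?J)"
  have "v \<in> V" "p \<in> V" "q \<in> V" using Nv deg_V[of v] deg_V[of p] deg_V[of q] unfolding deg by simp_all
  then have JV: "?J \<subseteq> V" by simp
  have J: "indep ?J" using P Q n nq by (auto simp: indep_def)
  have cJ: "card ?J = 3" using P Q \<open>p \<noteq> q\<close> by auto
  have "card (N p \<inter> N q) \<le> 1" using five_five[OF deg \<open>p \<noteq> q\<close> n] .
  moreover have "v2 \<in> N p \<inter> N q" using P Q by auto
  ultimately have C: "N p \<inter> N q = {v2}" using card_le_Suc0_iff_eq[of "N p \<inter> N q"] by auto
  have own_p: "own ?J p = N p - {v1, v2}" using P(1,4) C \<open>p \<noteq> q\<close> by (auto simp: own_def)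
  have own_q: "own ?J q = N q - {v2, v3}" using Q(1,4) C \<open>p \<noteq> q\<close> by (auto simp: own_def)
  have own_v: "own ?J v = N v - {v1, v2, v3}" using P(1,4) Q(1,4) by (auto simp: own_def)
  have c3: "card (own ?J p) = 3" "card (own ?J q) = 3"
    unfolding own_p own_q using deg P Q by (simp_all add: card_Diff_subset)
  have R: "?R = ?J \<union> (N v \<union> own ?J p \<union> own ?J q)" unfolding own_p own_q using P Q by auto
  have "card ?R \<le> card ?J + card (N v \<union> own ?J p \<union> own ?J q)" by (subst R) (rule card_Un_le)
  also have "\<dots> \<le> 3 + (8 + 3 + 3)"
    using card_Un_le[of "N v \<union> own ?J p" "own ?J q"] card_Un_le[of "N v" "own ?J p"] cJ c3 Nv distinct_card[OF dist]
    by simp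
  finally have cR: "card ?R \<le> 17" by simp
  have NR: "N u \<subseteq> ?R" if "u \<in> ?J" for u using that by auto
  have JR: "?J \<subseteq> ?R" by auto
  obtain Tp where Tp: "packet ?J ?R Tp (insert p Tp)" "Tp \<subseteq> own ?J p"
    using own_pair[of p ?J ?R] J JR NR c3 by auto
  obtain Tq where Tq: "packet ?J ?R Tq (insert q Tq)" "Tq \<subseteq> own ?J q"
    using own_pair[of q ?J ?R] J JR NR c3 by auto
  have vs: "v4 \<in> own ?J v" "v5 \<in> own ?J v" "v6 \<in> own ?J v" "v7 \<in> own ?J v" "v8 \<in> own ?J v"
    unfolding own_v using va dist by auto
  have vR: "N v \<subseteq> ?R" "v \<in> ?J" by auto
  have T1: "packet ?J ?R {v4, v8} {v4, v, v8}"
    by (rule own_packet[OF vR(2) J JR vR(1) vs(1,5) _ a(1) connected_via]) (use va dist in auto)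
  have T2: "packet ?J ?R {v5, v7} {v5, v6, v7}"
    by (rule own_packet[OF vR(2) J JR vR(1) vs(2,4) _ a(2) connected_via]) (use va dist a in auto)
  have d: "own ?J p \<inter> own ?J q = {}" "own ?J p \<inter> own ?J v = {}" "own ?J q \<inter> own ?J v = {}"
    using P(1) Q(1) \<open>p \<noteq> q\<close> by (auto simp: own_def)
  have d2: "p \<notin> own ?J u" "q \<notin> own ?J u" "v \<notin> own ?J u" if "u \<in> ?J" for u
    using J that by (auto simp: own_def indep_def)
  have 1: "(T, F) \<in> set [(Tp, insert p Tp), (Tq, insert q Tq), ({v4, v8}, {v4, v, v8}), ({v5, v7}, {v5, v6, v7})]
      \<Longrightarrow> packet ?J ?R T F" for T F
    using Tp(1) Tq(1) T1 T2 by auto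
  have e: "insert p Tp \<inter> insert q Tq = {}" "insert p Tp \<inter> {v4, v, v8} = {}" "insert p Tp \<inter> {v5, v6, v7} = {}"
    "insert q Tq \<inter> {v4, v, v8} = {}" "insert q Tq \<inter> {v5, v6, v7} = {}" "{v4, v, v8} \<inter> {v5, v6, v7} = {}"
  proof -
    let ?A = "insert p (own ?J p)" and ?B = "insert q (own ?J q)" and ?C = "insert v (own ?J v)"
    have ABC: "?A \<inter> ?B = {}" "?A \<inter> ?C = {}" "?B \<inter> ?C = {}"
      using d d2[of p] d2[of q] d2[of v] P(1) Q(1) \<open>p \<noteq> q\<close> by auto
    have sub: "insert p Tp \<subseteq> ?A" "insert q Tq \<subseteq> ?B" "{v4, v, v8} \<subseteq> ?C" "{v5, v6, v7} \<subseteq> ?C"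
      using Tp(2) Tq(2) vs by auto
    show "insert p Tp \<inter> insert q Tq = {}" using ABC(1) sub(1,2) by blast
    show "insert p Tp \<inter> {v4, v, v8} = {}" using ABC(2) sub(1,3) by blast
    show "insert p Tp \<inter> {v5, v6, v7} = {}" using ABC(2) sub(1,4) by blast
    show "insert q Tq \<inter> {v4, v, v8} = {}" using ABC(3) sub(2,3) by blast
    show "insert q Tq \<inter> {v5, v6, v7} = {}" using ABC(3) sub(2,4) by blast
    show "{v4, v, v8} \<inter> {v5, v6, v7} = {}" using dist va by auto
  qed
  have 2: "sorted_wrt (\<lambda>p q. snd p \<inter> snd q = {})
     [(Tp, insert p Tp), (Tq, insert q Tq), ({v4, v8}, {v4, v, v8}), ({v5, v7}, {v5, v6, v7})]"
    using e by auto
  show False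
    by (rule reducible_packets[OF JV J _ _ JR NR 1 2]) (use cR cJ JV N_V in auto)
qed

text \<open>All ten pairs are listed, adjacent or not, so that rotated and reflected copies follow
  from symmetry of adjacency alone.\<close>

definition pent :: "'v \<Rightarrow> 'v \<Rightarrow> 'v \<Rightarrow> 'v \<Rightarrow> 'v \<Rightarrow> 'v \<Rightarrow> bool" where
  "pent u a b c d e \<longleftrightarrow> N u = {a, b, c, d, e} \<and> distinct [a, b, c, d, e] \<and>
     adj a b \<and> adj b c \<and> adj c d \<and> adj d e \<and> adj e a \<and>
     \<not> adj a c \<and> \<not> adj a d \<and> \<not> adj b d \<and> \<not> adj b e \<and> \<not> adj c e"

lemma pent_rotate: "pent u a b c d e \<Longrightarrow> pent u b c d e a"
  unfolding pent_def using adj_commute by auto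

lemma pent_mirror: "pent u a b c d e \<Longrightarrow> pent u d c b a e"
  unfolding pent_def using adj_commute by auto

lemma pent_exists:
  assumes "card (N u) = 5"
  obtains a b c d e where "pent u a b c d e"
proof -
  obtain x where x: "adj u x" using assms by (metis N_iff card.empty ex_in_conv zero_neq_numeral)
  have "card {y. link u x y} = 2" using card_link[OF x] .
  then obtain y where "link u x y" by fastforce
  then have xy: "adj u x" "adj u y" "adj x y" by (auto simp: link_iff)
  obtain xs where xs: "rotation u xs" "length xs = card (N u)" using rotation_exists[OF xy] by metis
  then obtain a b c d e where l: "xs = [a, b, c, d, e]"
    using assms by (auto simp: length_Suc_conv eval_nat_numeral)
  have r: "adj ([a, b, c, d, e] ! i) ([a, b, c, d, e] ! j) \<longleftrightarrow> consecutive 5 i j" if "i < 5" "j < 5" for i j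
    by (rule rotation_nth_adj[OF xs(1)[unfolded l] _ that]) simp
  have "pent u a b c d e"
    unfolding pent_def using xs(1) l r[of 0 1] r[of 1 2] r[of 2 3] r[of 3 4] r[of 4 0]
      r[of 0 2] r[of 0 3] r[of 1 3] r[of 1 4] r[of 2 4]
    by (simp add: rotation_def)
  then show ?thesis by (rule that)
qed

lemma hexagon:
  assumes "card (N w) = 6" "adj w a" "adj w b" "adj a b"
  obtains p q r s where "N w = {a, b, p, q, r, s}" "distinct [a, b, p, q, r, s]"
    "adj p q" "adj q r" "adj r s" "adj s a"
    "\<not> adj p r" "\<not> adj p s" "\<not> adj b q" "\<not> adj b r" "\<not> adj b s" "\<not> adj a q" "\<not> adj a r"
proof -
  obtain xs where xs: "rotation w xs" "length xs = card (N w)" "xs ! 0 = a" "xs ! 1 = b"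
    using rotation_exists[OF assms(2-4)] .
  then obtain a' b' p q r s where l': "xs = [a', b', p, q, r, s]"
    using assms(1) by (auto simp: length_Suc_conv eval_nat_numeral)
  then have l: "xs = [a, b, p, q, r, s]" using xs(3,4) by simp
  have r: "adj ([a, b, p, q, r, s] ! i) ([a, b, p, q, r, s] ! j) \<longleftrightarrow> consecutive 6 i j" if "i < 6" "j < 6" for i j
    by (rule rotation_nth_adj[OF xs(1)[unfolded l] _ that]) simp
  show ?thesis
    by (rule that[of p q r s])
       (use xs(1) l r[of 2 3] r[of 3 4] r[of 4 5] r[of 5 0] r[of 2 4] r[of 2 5] r[of 1 3] r[of 1 4]
          r[of 1 5] r[of 0 3] r[of 0 4] in \<open>simp_all add: rotation_def\<close>)
qed

text \<open>With \<open>J = {u, w, w'}\<close> and \<open>M\<close> the common neighbours of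
  \<open>w\<close> and \<open>w'\<close>, at most \<open>16 - card M\<close> vertices are deleted
  and \<open>3 - card M\<close> packets are needed; the balance is exact in all three cases. One
  kind of packet replaces its part by three vertices, so it may block both \<open>u\<close> and
  \<open>w\<close>. For empty \<open>M\<close>, the degree of \<open>x1\<close> ensures that such a
  packet leaves \<open>p1, p2, p3\<close> free.\<close>

lemma six_five_six_aux:
  assumes u: "pent u x1 x2 x3 x4 x5" and deg: "card (N w) = 6" "card (N w') = 6"
    and ow: "opp u x1 x2 w" and ow': "opp u x3 x4 w'" and x1: "card (N x1) \<noteq> 5"
  shows False
proof -
  note W = oppD[OF ow] and W' = oppD[OF ow']
  have Nu: "N u = {x1, x2, x3, x4, x5}" and du: "distinct [x1, x2, x3, x4, x5]"
    and ua: "adj x1 x2" "adj x2 x3" "adj x3 x4" "adj x4 x5" "adj x5 x1" "\<not> adj x2 x5" "\<not> adj x5 x2"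
    using u adj_commute by (auto simp: pent_def)
  have cu: "card (N u) = 5" unfolding Nu using du by simp
  have ux: "adj u x1" "adj u x2" "adj u x3" "adj u x4" "adj u x5" using Nu by auto
  have nw: "\<not> adj w x3" "\<not> adj w x4" "\<not> adj w x5" "\<not> adj x3 w" "\<not> adj x4 w" "\<not> adj x5 w"
    and nw': "\<not> adj w' x1" "\<not> adj w' x2" "\<not> adj w' x5" "\<not> adj x1 w'" "\<not> adj x2 w'" "\<not> adj x5 w'"
    using opp_not_adj[OF ow] opp_not_adj[OF ow'] ux du by auto
  have wne: "w \<noteq> w'" using W nw' by auto
  have ww: "\<not> adj w w'"
  proof
    assume "adj w w'"
    then have "adj x2 w' \<or> adj w x3"
      using no_induced_quad[of x2 w w' x3] W W' ua(2) adj_sym du nw by blast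
    then show False using nw nw' by blast
  qed
  obtain p1 p2 p3 p4 where p: "N w = {x1, x2, p1, p2, p3, p4}" "distinct [x1, x2, p1, p2, p3, p4]"
    "adj p1 p2" "adj p2 p3" "adj p3 p4" "adj p4 x1"
    "\<not> adj p1 p3" "\<not> adj p1 p4" "\<not> adj x2 p2" "\<not> adj x2 p3" "\<not> adj x2 p4" "\<not> adj x1 p2" "\<not> adj x1 p3"
    using hexagon[OF deg(1) W(8,9,14)] .
  have wp: "adj w p1" "adj w p2" "adj w p3" "adj w p4" using p(1) by auto
  define M where "M = N w \<inter> N w'"
  have cM: "card M \<le> 2" using card_common_le_2[OF wne ww] by (simp add: M_def)
  have fM: "finite M" by (simp add: M_def)
  let ?J = "{u, w, w'}"
  let ?R = "?J \<union> \<Union>(N ` ?J)"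
  have "u \<in> V" "w \<in> V" "w' \<in> V" using deg_V[of u] deg_V[of w] deg_V[of w'] unfolding deg cu by simp_all
  then have JV: "?J \<subseteq> V" by simp
  have J: "indep ?J" using W W' ww adj_commute by (auto simp: indep_def)
  have cJ: "card ?J = 3" using W W' wne by auto
  have NR: "N y \<subseteq> ?R" if "y \<in> ?J" for y using that by auto
  have JR: "?J \<subseteq> ?R" "?R \<subseteq> V" "?R \<noteq> {}" using JV N_V by auto
  have own_w: "own ?J w = N w - {x1, x2} - M" using W(1,4) wne by (auto simp: own_def M_def)
  have own_w': "own ?J w' = N w' - {x3, x4} - M" using W'(1,4) wne by (auto simp: own_def M_def)
  have Msub: "M \<subseteq> N w - {x1, x2}" "M \<subseteq> N w' - {x3, x4}" using nw nw' by (auto simp: M_def)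
  have c4: "card (N w - {x1, x2}) = 4" "card (N w' - {x3, x4}) = 4"
    using deg W W' by (simp_all add: card_Diff_subset)
  have co: "card (own ?J w) = 4 - card M" "card (own ?J w') = 4 - card M"
    unfolding own_w own_w' using Msub c4 fM by (simp_all add: card_Diff_subset)
  have "?R = ?J \<union> (N u \<union> (N w - {x1, x2}) \<union> own ?J w')"
    unfolding own_w' using W W' by (auto simp: M_def)
  then have "card ?R \<le> card ?J + card (N u \<union> (N w - {x1, x2}) \<union> own ?J w')"
    using card_Un_le by metis
  also have "\<dots> \<le> 3 + (5 + 4 + (4 - card M))"
    using card_Un_le[of "N u \<union> (N w - {x1, x2})" "own ?J w'"] card_Un_le[of "N u" "N w - {x1, x2}"]
      cJ cu c4 co by linarith
  finally have cR: "card ?R \<le> 16 - card M" using cM by simp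
  \<comment> \<open>Otherwise \<open>x5, x1, w, y\<close> is a 4-cycle without a chord.\<close>
  have x5p: "\<not> adj x5 y" if y: "adj w y" "\<not> adj x1 y" "y \<noteq> x1" for y
  proof
    assume "adj x5 y"
    then have "adj x5 w \<or> adj x1 y"
      using no_induced_quad[of x5 x1 w y] ua(5) W(12) y adj_sym W nw ux by blast
    then show False using y nw by blast
  qed
  \<comment> \<open>The three vertices touch at most two elements of \<open>J\<close>, one less than
    their number; the path through \<open>w\<close>, \<open>x2\<close> and \<open>u\<close> makes
    the part connected.\<close>
  have big: "packet ?J ?R {x2, x5, y} {y, w, x2, u, x5}"
    if y: "adj w y" "\<not> adj x2 y" "\<not> adj x5 y" "y \<notin> M" "y \<noteq> x2" for y
  proof -
    have ne: "x2 \<noteq> x5" "x5 \<noteq> y" using du y nw by auto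
    have c: "connected_set {y, w, x2, u, x5}"
    proof -
      have "connected_set {x5}" by simp
      then have "connected_set {u, x5}" using connected_set_insert[of "{x5}" x5 u] ux adj_sym by auto
      then have "connected_set {x2, u, x5}" using connected_set_insert[of "{u, x5}" u x2] ux by auto
      then have "connected_set {w, x2, u, x5}" using connected_set_insert[of "{x2, u, x5}" x2 w] W by auto
      then show ?thesis using connected_set_insert[of "{w, x2, u, x5}" w y] y by auto
    qed
    have "\<not> adj w' y" using y by (auto simp: M_def)
    then have "{z \<in> ?J. N z \<inter> {x2, x5, y} \<noteq> {}} \<subseteq> {u, w}" using nw' by auto
    then have "card {z \<in> ?J. N z \<inter> {x2, x5, y} \<noteq> {}} \<le> card {u, w}" by (intro card_mono) auto
    also have "\<dots> \<le> 2" by (simp add: card_insert_if)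
    finally have b: "card {z \<in> ?J. N z \<inter> {x2, x5, y} \<noteq> {}} \<le> 2" .
    have c3: "card {x2, x5, y} = 3" using ne y by auto
    have ind: "indep {x2, x5, y}" using ua y adj_commute by (auto simp: indep_def)
    have disj: "{x2, x5, y} \<inter> ?J = {}" using ux y W W' nw nw' ww by auto
    have "{y, w, x2, u, x5} \<subseteq> ?R" using y ux by auto
    then show ?thesis unfolding packet_def using c b c3 ind disj by auto
  qed
  consider "card M = 0" | "card M = 1" | "card M = 2" using cM by linarith
  then show False
  proof cases
    case 2
    have pw: "\<exists>x\<in>own ?J w. \<exists>y\<in>own ?J w. x \<noteq> y \<and> \<not> adj x y"
      using co 2 by (intro three_not_clique[of _ w]) (auto simp: own_def)
    have pw': "\<exists>x\<in>own ?J w'. \<exists>y\<in>own ?J w'. x \<noteq> y \<and> \<not> adj x y"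
      using co 2 by (intro three_not_clique[of _ w']) (auto simp: own_def)
    have "card {w, w'} = 2" using wne by simp
    then have "3 * card ?R \<le> 13 * card ?J + 3 * card {w, w'}" using cR cJ 2 by linarith
    then show False
      by (intro reducible_own[OF JV J, of "{w, w'}"]) (use pw pw' in auto)
  next
    case 3
    have cnt: "3 * card ?R \<le> 13 * card ?J + 3 * length [X]" for X :: "'v set \<times> 'v set" using cR cJ 3 by simp
    have one: False if pk: "packet ?J ?R T F" for T F
      by (rule reducible_packets[OF JV J JR(2,3,1) NR _ _ cnt[of "(T, F)"]]) (use pk in auto)
    \<comment> \<open>Either \<open>p2\<close> and \<open>p3\<close> are exactly the shared
      vertices, so that \<open>p1\<close> and \<open>p4\<close> are private to \<open>w\<close>, or
      one of \<open>p2\<close>, \<open>p3\<close> is private and serves as \<open>y\<close>.\<close>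
    show False
    proof (cases "p2 \<in> M \<and> p3 \<in> M")
      case True
      then have "{p2, p3} = M" using 3 fM p(2) by (intro card_seteq) auto
      then have "p1 \<in> own ?J w" "p4 \<in> own ?J w" unfolding own_w using p(1,2) by auto
      then have "packet ?J ?R {p1, p4} {p1, w, p4}"
        by (intro own_packet[of w] J JR NR connected_via) (use p wp in auto)
      then show False by (rule one)
    next
      case False
      then obtain y where y: "y = p2 \<or> y = p3" "y \<notin> M" by auto
      then have "adj w y" "\<not> adj x2 y" "\<not> adj x1 y" "y \<noteq> x1" "y \<noteq> x2" using p wp by auto
      then show False using big[of y] x5p[of y] y one by blast
    qed
  next
    case 1
    then have M0: "M = {}" using fM by simp
    \<comment> \<open>Otherwise the link of \<open>x1\<close> closes up as
      \<open>u, x2, w, p4, x5\<close>, so that \<open>x1\<close> has degree 5.\<close>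
    have n54: "\<not> adj x5 p4"
    proof
      assume a: "adj x5 p4"
      have "{u, x2, w, p4, x5} = N x1"
      proof (rule cycle_is_link)
        show "{u, x2, w, p4, x5} \<subseteq> N x1" using W ua p adj_sym by auto
        have ne: "u \<noteq> w" "x2 \<noteq> p4" "w \<noteq> x5" "p4 \<noteq> u" "x2 \<noteq> x5" using W p du ux by auto
        show "\<exists>y\<in>{u, x2, w, p4, x5}. \<exists>z\<in>{u, x2, w, p4, x5}. y \<noteq> z \<and> adj x y \<and> adj x z"
          if "x \<in> {u, x2, w, p4, x5}" for x
          using that ne W(7,9,11,13) ux(5) wp(4) a adj_sym[OF a] adj_sym[OF ux(5)] adj_sym[OF wp(4)] by auto
      qed auto
      then have "card (N x1) = card {u, x2, w, p4, x5}" by simp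
      also have "\<dots> \<le> 5" by (simp add: card_insert_if)
      finally show False using card_N_ge_5[of x1] x1 adj_V[OF ua(1)] by auto
    qed
    have T3: "packet ?J ?R {x2, x5, p4} {p4, w, x2, u, x5}"
      by (rule big) (use wp p n54 M0 in auto)
    have "3 \<le> card (own ?J w')" using co 1 by simp
    then obtain T where T: "packet ?J ?R T (insert w' T)" "T \<subseteq> own ?J w'"
      using own_pair[of w' ?J ?R] J JR NR by auto
    have po: "p1 \<in> own ?J w" "p2 \<in> own ?J w" "p3 \<in> own ?J w" "p4 \<in> own ?J w"
      unfolding own_w M0 using p(1,2) by auto
    have T1: "packet ?J ?R {p1, p3} {p1, p2, p3}"
      by (intro own_packet[of w] J JR NR connected_via) (use p wp po adj_sym in auto)
    have d: "own ?J w \<inter> own ?J w' = {}" using wne by (auto simp: own_def)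
    have d1: "{p1, p2, p3} \<inter> insert w' T = {}"
      using po T(2) d W'(2) wp ww by auto
    have d2: "{p1, p2, p3} \<inter> {p4, w, x2, u, x5} = {}"
      using p(2) wp nw W(3) by auto
    have "x2 \<notin> T" "x5 \<notin> T" "u \<notin> T" "w \<notin> T" "p4 \<notin> T"
      using T(2) nw' W' ww po d adj_commute unfolding own_w' by auto
    moreover have "w' \<noteq> p4" "w' \<noteq> x2" "w' \<noteq> x5" using wp ww ux W' by auto
    ultimately have d3: "insert w' T \<inter> {p4, w, x2, u, x5} = {}" using wne W' by auto
    let ?ps = "[({p1, p3}, {p1, p2, p3}), (T, insert w' T), ({x2, x5, p4}, {p4, w, x2, u, x5})]"
    have 1: "packet ?J ?R T' F'" if "(T', F') \<in> set ?ps" for T' F' using that T1 T(1) T3 by auto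
    have 2: "sorted_wrt (\<lambda>p q. snd p \<inter> snd q = {}) ?ps" using d1 d2 d3 by auto
    show False
      by (rule reducible_packets[OF JV J JR(2,3,1) NR 1 2]) (use cR cJ M0 in simp_all)
  qed
qed

text \<open>If \<open>x1\<close> has degree 5, then \<open>x4\<close> has not, since the two share
  \<open>u\<close> and \<open>x5\<close>; reflecting the pentagon exchanges their roles.\<close>

lemma six_five_six:
  assumes u: "pent u x1 x2 x3 x4 x5" and deg: "card (N w) = 6" "card (N w') = 6"
    and ow: "opp u x1 x2 w" and ow': "opp u x3 x4 w'"
  shows False
proof (cases "card (N x1) = 5")
  case False
  then show False using six_five_six_aux[OF assms] by blast
next
  case True
  have "card (N x4) \<noteq> 5"
  proof
    assume "card (N x4) = 5"
    moreover have "adj u x1" "adj u x4" "adj u x5" using u by (simp_all add: pent_def flip: N_iff)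
    then have "{u, x5} \<subseteq> N x1 \<inter> N x4" "u \<noteq> x5" using u adj_sym by (auto simp: pent_def)
    moreover have "x1 \<noteq> x4" "\<not> adj x1 x4" using u by (auto simp: pent_def)
    ultimately show False
      using five_five[of x1 x4] True card_mono[of "N x1 \<inter> N x4" "{u, x5}"] by simp
  qed
  then show False
    using six_five_six_aux[OF pent_mirror[OF u] deg(2,1) opp_swap[OF ow'] opp_swap[OF ow]] by blast
qed

section \<open>Counting opposite vertices\<close>

definition Opp :: "'v \<Rightarrow> 'v set" where
  "Opp v = {w. \<exists>x y. opp v x y w}"

lemma Opp_sym: "w \<in> Opp v \<Longrightarrow> v \<in> Opp w"
  using adj_commute unfolding Opp_def opp_def by (auto simp: Int_commute)

lemma Opp_V: "Opp v \<subseteq> V"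
  using oppD(8) adj_V unfolding Opp_def by blast

lemma finite_Opp [simp]: "finite (Opp v)"
  by (rule finite_subset[OF Opp_V]) simp

lemma opp_from_rotation:
  assumes "rotation v xs" "length xs = n" "3 \<le> n"
  obtains f where "\<And>i. i < n \<Longrightarrow> opp v (xs ! i) (xs ! (Suc i mod n)) (f i)" "Opp v = f ` {..<n}"
proof -
  have adj_i: "adj v (xs ! i)" if "i < n" for i
    using assms(1,2) that nth_mem[of i xs] by (auto simp: rotation_def)
  have lt: "Suc i mod n < n" for i using assms(3) by simp
  have "\<exists>w. opp v (xs ! i) (xs ! (Suc i mod n)) w" if i: "i < n" for i
  proof -
    have "adj (xs ! i) (xs ! (Suc i mod n))"
      using rotation_nth_adj[OF assms(1,2) i lt] by (simp add: consecutive_def)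
    then show ?thesis using opp_exists[OF adj_i[OF i] adj_i[OF lt]] by metis
  qed
  then obtain f where f: "\<And>i. i < n \<Longrightarrow> opp v (xs ! i) (xs ! (Suc i mod n)) (f i)" by metis
  have "Opp v \<subseteq> f ` {..<n}"
  proof
    fix w assume "w \<in> Opp v"
    then obtain x y where o: "opp v x y w" by (auto simp: Opp_def)
    have "x \<in> set xs" "y \<in> set xs" using oppD(6,7)[OF o] assms(1) by (auto simp: rotation_def)
    then obtain i j where ij: "i < n" "x = xs ! i" "j < n" "y = xs ! j"
      using assms(2) by (metis in_set_conv_nth)
    have "consecutive n i j" using rotation_nth_adj[OF assms(1,2) ij(1,3)] oppD(14)[OF o] ij by simp
    then consider "j = Suc i mod n" | "i = Suc j mod n" by (auto simp: consecutive_def)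
    then show "w \<in> f ` {..<n}"
    proof cases
      case 1
      then have "w = f i" using opp_unique[OF o] f[OF ij(1)] ij by simp
      then show ?thesis using ij by auto
    next
      case 2
      then have "w = f j" using opp_unique[OF opp_swap[OF o]] f[OF ij(3)] ij by simp
      then show ?thesis using ij by auto
    qed
  qed
  moreover have "f ` {..<n} \<subseteq> Opp v" using f by (auto simp: Opp_def)
  ultimately show ?thesis using that f by blast
qed

lemma rotation_at:
  assumes "v \<in> V"
  obtains xs where "rotation v xs" "length xs = card (N v)"
proof -
  have "N v \<noteq> {}" using card_N_ge_5[OF assms] by auto
  then obtain x where x: "adj v x" by (auto simp: N_def)
  have "card {y. link v x y} = 2" using card_link[OF x] .
  then obtain y where "link v x y" by fastforce
  then have "adj v x" "adj v y" "adj x y" by (auto simp: link_iff)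
  then show ?thesis using rotation_exists that by metis
qed

lemma card_Opp_le: "v \<in> V \<Longrightarrow> card (Opp v) \<le> card (N v)"
proof -
  assume v: "v \<in> V"
  obtain xs where xs: "rotation v xs" "length xs = card (N v)" using rotation_at[OF v] .
  have "3 \<le> card (N v)" using card_N_ge_5[OF v] by simp
  then obtain f where "Opp v = f ` {..<card (N v)}" using opp_from_rotation[OF xs] by metis
  then show ?thesis using card_image_le[of "{..<card (N v)}" f] by simp
qed

lemma pent_opp:
  assumes "pent u a b c d e"
  obtains p q r s t where "opp u a b p" "opp u b c q" "opp u c d r" "opp u d e s" "opp u e a t"
    "distinct [p, q, r, s, t]"
proof -
  have N: "adj u a" "adj u b" "adj u c" "adj u d" "adj u e" using assms by (simp_all add: pent_def flip: N_iff)
  have A: "adj a b" "adj b c" "adj c d" "adj d e" "adj e a" and dist: "distinct [a, b, c, d, e]"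
    using assms by (auto simp: pent_def)
  obtain p where p: "opp u a b p" using opp_exists[OF N(1,2) A(1)] .
  obtain q where q: "opp u b c q" using opp_exists[OF N(2,3) A(2)] .
  obtain r where r: "opp u c d r" using opp_exists[OF N(3,4) A(3)] .
  obtain s where s: "opp u d e s" using opp_exists[OF N(4,5) A(4)] .
  obtain t where t: "opp u e a t" using opp_exists[OF N(5,1) A(5)] .
  have "distinct [p, q, r, s, t]"
    using oppD(4)[OF p] oppD(4)[OF q] oppD(4)[OF r] oppD(4)[OF s] oppD(4)[OF t] dist
    by (auto simp: doubleton_eq_iff)
  then show ?thesis using that p q r s t by blast
qed

text \<open>Opposites that are not large have degree 6. The pairs excluded by
  \<open>six_five_six\<close> form a 5-cycle on the five opposites, and an independent set in a
  5-cycle has at most two elements.\<close>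

lemma five_has_three_large_opposites:
  assumes u: "card (N u) = 5"
  shows "3 \<le> card {v \<in> Opp u. 7 \<le> card (N v)}"
proof -
  obtain a b c d e where P: "pent u a b c d e" using pent_exists[OF u] .
  obtain p q r s t where o: "opp u a b p" "opp u b c q" "opp u c d r" "opp u d e s" "opp u e a t"
    and dist: "distinct [p, q, r, s, t]" using pent_opp[OF P] .
  note P1 = pent_rotate[OF P] note P2 = pent_rotate[OF P1] note P3 = pent_rotate[OF P2] note P4 = pent_rotate[OF P3]
  define B where "B w \<longleftrightarrow> 7 \<le> card (N w)" for w
  have six: "card (N w) = 6" if "opp u x y w" "\<not> B w" for x y w
    using five_opp_five[OF that(1) u] that(2) card_N_ge_5[of w] adj_V[OF oppD(8)[OF that(1)]] by (auto simp: B_def)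
  have large: "B w \<or> B w'" if "pent u x1 x2 x3 x4 x5" "opp u x1 x2 w" "opp u x3 x4 w'" for w w' x1 x2 x3 x4 x5
    using six_five_six[OF that(1) _ _ that(2,3)] six[OF that(2)] six[OF that(3)] by blast
  have B: "B p \<or> B r" "B q \<or> B s" "B r \<or> B t" "B s \<or> B p" "B t \<or> B q"
    using large[OF P o(1,3)] large[OF P1 o(2,4)] large[OF P2 o(3,5)] large[OF P3 o(4,1)] large[OF P4 o(5,2)]
    by simp_all
  have sub: "{w \<in> {p, q, r, s, t}. B w} \<subseteq> {v \<in> Opp u. 7 \<le> card (N v)}"
    using o by (auto simp: B_def Opp_def)
  have three: "3 \<le> card {w \<in> {p, q, r, s, t}. B w}"
  proof -
    have "\<exists>x y z. x \<noteq> y \<and> y \<noteq> z \<and> x \<noteq> z \<and> {x, y, z} \<subseteq> {w \<in> {p, q, r, s, t}. B w}"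
    proof (cases "B p")
      case True
      show ?thesis
      proof (cases "B q")
        case True
        then show ?thesis using \<open>B p\<close> B(3) dist by (cases "B r") (rule exI[of _ p], rule exI[of _ q], auto)+
      next
        case False
        then have "B s" "B t" using B by auto
        then show ?thesis using True dist by (intro exI[of _ p] exI[of _ s] exI[of _ t]) auto
      qed
    next
      case False
      then have rs: "B r" "B s" using B by auto
      show ?thesis
      proof (cases "B q")
        case True
        then show ?thesis using rs dist by (intro exI[of _ q] exI[of _ r] exI[of _ s]) auto
      next
        case False
        then have "B t" using B by auto
        then show ?thesis using rs dist by (intro exI[of _ t] exI[of _ r] exI[of _ s]) auto
      qed
    qed
    then obtain x y z where "x \<noteq> y" "y \<noteq> z" "x \<noteq> z" and s: "{x, y, z} \<subseteq> {w \<in> {p, q, r, s, t}. B w}" by blast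
    then have "card {x, y, z} = 3" by simp
    moreover have "card {x, y, z} \<le> card {w \<in> {p, q, r, s, t}. B w}" using s by (intro card_mono) auto
    ultimately show ?thesis by simp
  qed
  have "card {w \<in> {p, q, r, s, t}. B w} \<le> card {v \<in> Opp u. 7 \<le> card (N v)}" using sub by (intro card_mono) auto
  then show ?thesis using three by simp
qed

text \<open>The opposites of degree 5 are pairwise adjacent, and four of them would form a complete
  graph.\<close>

lemma seven_opposites:
  assumes v: "card (N v) = 7"
  shows "card {u \<in> Opp v. card (N u) = 5} \<le> 3"
proof (rule ccontr)
  let ?Q = "{u \<in> Opp v. card (N u) = 5}"
  assume "\<not> ?thesis"
  then have "4 \<le> card ?Q" by simp
  then obtain Q where Q: "Q \<subseteq> ?Q" "card Q = 4" by (meson obtain_subset_with_card_n)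
  have a: "adj p q" if pq: "p \<in> ?Q" "q \<in> ?Q" "p \<noteq> q" for p q
  proof -
    obtain a b c d where "opp v a b p" "opp v c d q" using pq by (auto simp: Opp_def)
    then show ?thesis using seven_neighbours_adjacent[OF v _ _ _ _ pq(3)] pq by blast
  qed
  have "card Q = Suc 3" using Q(2) by simp
  then obtain x Q' where x: "Q = insert x Q'" "x \<notin> Q'" "card Q' = 3" unfolding card_Suc_eq by blast
  then obtain y z w where yzw: "Q' = {y, z, w}" "y \<noteq> z" "y \<noteq> w" "z \<noteq> w" by (auto simp: card_3_iff)
  have "x \<in> ?Q" "y \<in> ?Q" "z \<in> ?Q" "w \<in> ?Q" using Q x yzw by auto
  then show False using no_K4[of x y z w] a x yzw by auto
qed

lemma rotation_rotate8:
  assumes "rotation v [a, b, c, d, e, f, g, h]"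
  shows "rotation v [b, c, d, e, f, g, h, a]"
proof -
  let ?xs = "[a, b, c, d, e, f, g, h]" and ?ys = "[b, c, d, e, f, g, h, a]"
  have nth: "?ys ! i = ?xs ! (Suc i mod 8)" if "i < 8" for i
  proof -
    have "i = 0 \<or> i = 1 \<or> i = 2 \<or> i = 3 \<or> i = 4 \<or> i = 5 \<or> i = 6 \<or> i = 7" using that by linarith
    then show ?thesis by (elim disjE) simp_all
  qed
  have "adj (?ys ! i) (?ys ! j) \<longleftrightarrow> consecutive 8 i j" if ij: "i < 8" "j < 8" for i j
  proof -
    have "adj (?ys ! i) (?ys ! j) \<longleftrightarrow> consecutive 8 (Suc i mod 8) (Suc j mod 8)"
      unfolding nth[OF ij(1)] nth[OF ij(2)] by (rule rotation_nth_adj[OF assms]) auto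
    also have "\<dots> \<longleftrightarrow> consecutive 8 i j"
    proof -
      have "Suc k mod 8 = Suc l mod 8 \<longleftrightarrow> k = l" if "k < 8" "l < 8" for k l :: nat
        using that by (auto simp: mod_Suc split: if_splits)
      from this[OF ij(1), of "Suc j mod 8"] this[OF ij(2), of "Suc i mod 8"] show ?thesis
        unfolding consecutive_def by auto
    qed
    finally show ?thesis .
  qed
  moreover have "length ?ys = 8" by simp
  moreover have "distinct ?ys" "set ?ys = N v" using assms by (auto simp: rotation_def)
  ultimately show ?thesis unfolding rotation_def by (metis (no_types, lifting))
qed

text \<open>Adjacency of \<open>p, q\<close> and of \<open>q, r\<close> closes the link of
  \<open>v3\<close> to five vertices; then \<open>p\<close> and \<open>v3\<close> are nonadjacent of
  degree 5 and share \<open>v2\<close> and \<open>q\<close>.\<close>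

lemma eight_no_three_consecutive:
  assumes rot: "rotation v [v1, v2, v3, v4, v5, v6, v7, v8]"
    and o: "opp v v1 v2 p" "opp v v2 v3 q" "opp v v3 v4 r"
    and deg: "card (N p) = 5" "card (N q) = 5" "card (N r) = 5"
  shows False
proof -
  note P = oppD[OF o(1)] and Q = oppD[OF o(2)] and R = oppD[OF o(3)]
  have dist: "distinct [v1, v2, v3, v4, v5, v6, v7, v8]" using rot by (simp add: rotation_def)
  have pq: "adj p q" by (rule eight_consecutive_adjacent[OF rot deg(1,2) o(1,2)])
  have qr: "adj q r" by (rule eight_consecutive_adjacent[OF rotation_rotate8[OF rot] deg(2,3) o(2,3)])
  have "{v, v2, q, r, v4} = N v3"
  proof (rule cycle_is_link)
    show "{v, v2, q, r, v4} \<subseteq> N v3" using Q R adj_sym[OF Q(14)] by auto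
    have "v2 \<noteq> v4" "v \<noteq> q" "v2 \<noteq> r" "q \<noteq> v4" "r \<noteq> v" using dist P Q R by auto
    then show "\<exists>y\<in>{v, v2, q, r, v4}. \<exists>z\<in>{v, v2, q, r, v4}. y \<noteq> z \<and> adj x y \<and> adj x z"
      if "x \<in> {v, v2, q, r, v4}" for x
      using that Q R qr adj_sym[OF qr] adj_sym[OF Q(14)] by auto
  qed auto
  then have "card (N v3) = card {v, v2, q, r, v4}" by simp
  also have "\<dots> \<le> 5" by (simp add: card_insert_if)
  finally have c3: "card (N v3) = 5" using card_N_ge_5[of v3] adj_V[OF Q(7)] by auto
  have n: "\<not> adj p v3" using opp_not_adj[OF o(1) Q(7)] dist by auto
  have "p \<noteq> v3" using Q(7) P(2) by auto
  then have "card (N p \<inter> N v3) \<le> 1" using five_five[OF deg(1) c3] n by simp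
  moreover have "{v2, q} \<subseteq> N p \<inter> N v3" using P Q pq adj_sym by auto
  moreover have "v2 \<noteq> q" using Q by auto
  ultimately show False using card_mono[of "N p \<inter> N v3" "{v2, q}"] by simp
qed

text \<open>Two disjoint runs of three consecutive opposites each contain one that is not of degree
  5.\<close>

lemma eight_opposites:
  assumes v: "card (N v) = 8"
  shows "card {u \<in> Opp v. card (N u) = 5} \<le> 6"
proof -
  have vV: "v \<in> V" using deg_V[of v] unfolding v by simp
  obtain xs where xs: "rotation v xs" "length xs = 8" using rotation_at[OF vV] v by metis
  obtain f where f: "\<And>i. i < 8 \<Longrightarrow> opp v (xs ! i) (xs ! (Suc i mod 8)) (f i)" "Opp v = f ` {..<8}"
    using opp_from_rotation[OF xs] by auto
  obtain a b c d e a' b' c' where l: "xs = [a, b, c, d, e, a', b', c']"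
    using xs(2) by (auto simp: length_Suc_conv eval_nat_numeral)
  have o: "opp v a b (f 0)" "opp v b c (f 1)" "opp v c d (f 2)" "opp v d e (f 3)" "opp v e a' (f 4)" "opp v a' b' (f 5)"
    using f(1)[of 0] f(1)[of 1] f(1)[of 2] f(1)[of 3] f(1)[of 4] f(1)[of 5] by (simp_all add: l)
  note r0 = xs(1)[unfolded l]
  note r3 = rotation_rotate8[OF rotation_rotate8[OF rotation_rotate8[OF r0]]]
  obtain i where i: "i \<in> {0, 1, 2}" "card (N (f i)) \<noteq> 5"
    using eight_no_three_consecutive[OF r0 o(1-3)] by blast
  obtain j where j: "j \<in> {3, 4, 5}" "card (N (f j)) \<noteq> 5"
    using eight_no_three_consecutive[OF r3 o(4-6)] by blast
  have "{u \<in> Opp v. card (N u) = 5} \<subseteq> f ` ({..<8} - {i, j})" using f(2) i j by auto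
  then have "card {u \<in> Opp v. card (N u) = 5} \<le> card ({..<8} - {i, j} :: nat set)"
    by (intro surj_card_le) auto
  also have "\<dots> = 6"
  proof -
    have "{i, j} \<subseteq> {..<8}" "i \<noteq> j" using i j by auto
    then show ?thesis by (subst card_Diff_subset) auto
  qed
  finally show ?thesis .
qed

text \<open>From degree 9 on the number of opposites is small enough by itself, because
  \<open>d \<le> 3 * (d - 6)\<close>; this is why only degrees 7 and 8 need configurations.\<close>

lemma large_opposites:
  assumes "v \<in> V" "7 \<le> card (N v)"
  shows "card {u \<in> Opp v. card (N u) = 5} \<le> 3 * (card (N v) - 6)"
proof -
  consider "card (N v) = 7" | "card (N v) = 8" | "9 \<le> card (N v)" using assms(2) by linarith
  then show ?thesis
  proof cases
    case 1
    then show ?thesis using seven_opposites[OF 1] by simp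
  next
    case 2
    then show ?thesis using eight_opposites[OF 2] by simp
  next
    case 3
    have "card {u \<in> Opp v. card (N u) = 5} \<le> card (Opp v)" by (intro card_mono) auto
    then show ?thesis using card_Opp_le[OF assms(1)] 3 by linarith
  qed
qed

text \<open>Discharging: with initial charge \<open>card (N v) - 6\<close>, every vertex of degree 5 receives
  \<open>1/3\<close> from each opposite vertex of degree at least 7.\<close>

theorem impossible: False
proof -
  define V5 where "V5 = {u \<in> V. card (N u) = 5}"
  define V7 where "V7 = {v \<in> V. 7 \<le> card (N v)}"
  have fin: "finite V5" "finite V7" by (auto simp: V5_def V7_def)
  have "3 * card V5 = (\<Sum>u\<in>V5. 3)" by simp
  also have "\<dots> \<le> (\<Sum>u\<in>V5. card {v \<in> Opp u. 7 \<le> card (N v)})"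
    by (rule sum_mono) (simp add: V5_def five_has_three_large_opposites)
  also have "\<dots> = (\<Sum>u\<in>V5. \<Sum>v\<in>V7. of_bool (v \<in> Opp u))"
  proof (rule sum.cong[OF refl])
    fix u
    have "{v \<in> Opp u. 7 \<le> card (N v)} = V7 \<inter> {v. v \<in> Opp u}" using Opp_V by (auto simp: V7_def)
    then show "card {v \<in> Opp u. 7 \<le> card (N v)} = (\<Sum>v\<in>V7. of_bool (v \<in> Opp u))" using fin by simp
  qed
  also have "\<dots> = (\<Sum>v\<in>V7. \<Sum>u\<in>V5. of_bool (v \<in> Opp u))" by (rule sum.swap)
  also have "\<dots> \<le> (\<Sum>v\<in>V7. 3 * (card (N v) - 6))"
  proof (rule sum_mono)
    fix v assume v: "v \<in> V7"
    have "V5 \<inter> {u. v \<in> Opp u} = {u \<in> Opp v. card (N u) = 5}" using Opp_V Opp_sym by (auto simp: V5_def)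
    then show "(\<Sum>u\<in>V5. of_bool (v \<in> Opp u)) \<le> 3 * (card (N v) - 6)"
      using fin large_opposites[of v] v by (simp add: V7_def)
  qed
  finally have 1: "card V5 \<le> (\<Sum>v\<in>V7. card (N v) - 6)" by (simp add: sum_distrib_left[symmetric])
  \<comment> \<open>Truncated subtraction makes \<open>6 + (d - 6)\<close> the maximum of 6 and
    \<open>d\<close>, so the sum exceeds the degree sum by 1 for each vertex of degree 5.\<close>
  have "6 * card V + (\<Sum>v\<in>V. card (N v) - 6) = (\<Sum>v\<in>V. 6 + (card (N v) - 6))"
    by (simp add: sum.distrib)
  also have "\<dots> \<le> (\<Sum>v\<in>V. card (N v) + of_bool (card (N v) = 5))"
  proof (rule sum_mono)
    fix v assume "v \<in> V"
    then have "5 \<le> card (N v)" by (rule card_N_ge_5)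
    then show "6 + (card (N v) - 6) \<le> card (N v) + of_bool (card (N v) = 5)" by auto
  qed
  also have "\<dots> = (\<Sum>v\<in>V. card (N v)) + card V5" by (simp add: sum.distrib V5_def Int_def)
  finally have 2: "6 * card V + (\<Sum>v\<in>V. card (N v) - 6) \<le> (\<Sum>v\<in>V. card (N v)) + card V5" .
  have "(\<Sum>v\<in>V7. card (N v) - 6) \<le> (\<Sum>v\<in>V. card (N v) - 6)"
    by (rule sum_mono2) (auto simp: V7_def)
  then show False using 1 2 sum_card_N_less by linarith
qed

end

lemma maclane_imp_good:
  fixes V :: "'v set"
  assumes "infinite (UNIV :: 'v set)" "finite_simple_graph V E" "maclane E"
  shows "good V E"
  using exists_min_counterexample[OF assms] min_counterexample.impossible by blast

text \<open>The given vertex type may be finite, while a minimal counterexample is taken over an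
  infinite one. The drawing itself embeds the vertices into the plane, and the minor with singleton
  fibres is an isomorphic copy.\<close>

lemma planar_imp_good:
  fixes V :: "'a set"
  assumes simple: "finite_simple_graph V E" and "planar V E"
  shows "good V E"
proof -
  obtain p \<gamma> where pd: "plane_drawing V E p \<gamma>" using assms(2) by (auto simp: planar_def)
  then interpret drawing V E p \<gamma> using simple by unfold_locales
  have inj: "inj_on p V" using pd by (simp add: plane_drawing_def)
  let ?E = "minor E V p"
  have "maclane ?E"
    using inj by (intro maclane_minor[OF simple_imp_sgraph[OF simple] drawing_maclane]) (simp add: inj_on_eq_iff)
  moreover have "finite_simple_graph (p ` V) ?E"
    using simple by (auto simp: finite_simple_graph_def minor_def)
  moreover have "infinite (UNIV :: complex set)" by (rule infinite_UNIV_char_0)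
  ultimately have "good (p ` V) ?E" by (intro maclane_imp_good)
  then obtain S' where S': "independent_set (p ` V) ?E S'" "3 * card (p ` V) \<le> 13 * card S'"
    by (auto simp: good_def)
  then obtain S where S: "S \<subseteq> V" "S' = p ` S" unfolding independent_set_def by (meson subset_imageE)
  have "\<not> e \<subseteq> S" if e: "e \<in> E" for e
  proof
    assume "e \<subseteq> S"
    have "e \<subseteq> V" "card e = 2" using simple e by (auto simp: finite_simple_graph_def)
    then obtain x y where xy: "e = {x, y}" "x \<noteq> y" "x \<in> V" "y \<in> V" by (auto simp: card_2_iff)
    then have "p x \<noteq> p y" using inj by (simp add: inj_on_eq_iff)
    then have "{p x, p y} \<in> ?E" using xy e unfolding minor_def by blast
    moreover have "{p x, p y} \<subseteq> S'" using \<open>e \<subseteq> S\<close> xy(1) S(2) by auto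
    ultimately show False using S'(1) by (auto simp: independent_set_def)
  qed
  then have "independent_set V E S" using S(1) by (simp add: independent_set_def)
  moreover have "card (p ` V) = card V" "card S' = card S"
    using inj inj_on_subset[OF inj S(1)] S(2) by (simp_all add: card_image)
  ultimately show ?thesis using S'(2) by (auto simp: good_def)
qed

theorem theorem1:
  fixes V :: "'a set" and E :: "'a set set"
  assumes "finite_simple_graph V E"
    and "V \<noteq> {}"
    and "planar V E"
  shows "independence_ratio V E \<ge> 3 / 13"
proof -
  obtain S where S: "independent_set V E S" "3 * card V \<le> 13 * card S"
    using planar_imp_good[OF assms(1,3)] by (auto simp: good_def)
  have "finite V" using assms(1) by (simp add: finite_simple_graph_def)
  then have "finite {S. independent_set V E S}"
    by (rule finite_subset[rotated, OF finite_Pow_iff[THEN iffD2]]) (auto simp: independent_set_def)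
  then have "finite {card S | S. independent_set V E S}" by simp
  then have "card S \<le> independence_number V E"
    unfolding independence_number_def using S(1) by (intro Max_ge) auto
  then have "3 * card V \<le> 13 * independence_number V E" using S(2) by linarith
  then have "3 * real (card V) \<le> 13 * real (independence_number V E)" by linarith
  moreover have "0 < real (card V)" using \<open>finite V\<close> assms(2) by (simp add: card_gt_0_iff)
  ultimately show ?thesis by (simp add: independence_ratio_def field_simps)
qed

end
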